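(* For a positive integer $n$ and integer partitions $\lambda,\mu,\nu\vdash n$, let $k^n_{\lambda,\mu,\nu}$ be the number of ordered triples $(\alpha_1,\alpha_2,\alpha_3)\in S_n^3$ with $\alpha_1\in\mathcal{C}_\lambda$, $\alpha_2\in\mathcal{C}_\mu$, $\alpha_3\in\mathcal{C}_\nu$ and $\alpha_1\alpha_2\alpha_3=\gamma_n$, where $\gamma_n=(1,2,\ldots,n)$. Then $$\sum_{\lambda,\mu,\nu\vdash n}k^n_{\lambda,\mu,\nu}\,p_\lambda(\mathbf{x})p_\mu(\mathbf{y})p_\nu(\mathbf{z})=\sum_{\lambda,\mu,\nu\vdash n}\frac{n!^2\,M^{(n-1)}_{\ell(\lambda),\ell(\mu),\ell(\nu)}}{\binom{n-1}{\ell(\lambda)-1}\binom{n-1}{\ell(\mu)-1}\binom{n-1}{\ell(\nu)-1}}\,m_\lambda(\mathbf{x})m_\mu(\mathbf{y})m_\nu(\mathbf{z}),$$ where $$M^{(n-1)}_{\ell(\lambda),\ell(\mu),\ell(\nu)}=\binom{n-1}{\ell(\nu)-1}\sum_{g\ge 0}\binom{n-\ell(\mu)}{\ell(\lambda)-1-g}\binom{n-\ell(\nu)}{g}\binom{n-1-g}{n-\ell(\mu)}.$$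
   Context: $S_n$ is the symmetric group on $[n]=\{1,\dots,n\}$; $\mathcal{C}_\lambda$ denotes the conjugacy class of permutations of cycle type $\lambda$; $\ell(\lambda)$ is the number of parts of $\lambda$. $m_\lambda(\mathbf{x})$ is the monomial symmetric function (sum of all distinct monomials obtained by permuting the variables in $x_1^{\lambda_1}x_2^{\lambda_2}\cdots$) and $p_\lambda=p_{\lambda_1}p_{\lambda_2}\cdots$ with $p_k(\mathbf{x})=\sum_i x_i^k$ the power sum symmetric functions, in variable sets $\mathbf{x},\mathbf{y},\mathbf{z}$. *)

theory Defs
  imports
    Complex_Main
    "HOL-Library.Multiset"
    "HOL-Combinatorics.Combinatorics"
begin

section \<open>Formal power series in arbitrarily many variables\<close>

text \<open>A monomial in the variables \<^typ>\<open>'v\<close> is encoded as the multiset of its variables: \<^const>\<open>count\<close>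
  gives the exponents, and multiset union is multiplication of monomials.\<close>

typedef ('v, 'a) mfps = "UNIV :: ('v multiset \<Rightarrow> 'a) set"
  morphisms mfps_coeff Abs_mfps ..

setup_lifting type_definition_mfps

lemma mfps_eqI: "(\<And>m. mfps_coeff f m = mfps_coeff g m) \<Longrightarrow> f = g"
  by (metis ext mfps_coeff_inject)

lemma finite_mset_splits: "finite {(a, b). a + b = (m :: 'v multiset)}"
proof (induction m)
  case empty
  have "{(a, b). a + b = ({#} :: 'v multiset)} = {({#}, {#})}"
    by auto
  then show ?case by simp
next
  case (add x m)
  let ?S = "{(a, b). a + b = m}"
  have "{(a, b). a + b = add_mset x m} \<subseteq>
      (\<lambda>(a, b). (add_mset x a, b)) ` ?S \<union> (\<lambda>(a, b). (a, add_mset x b)) ` ?S"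
  proof (clarify)
    fix a b
    assume eq: "a + b = add_mset x m"
      and nb: "(a, b) \<notin> (\<lambda>(a, b). (a, add_mset x b)) ` ?S"
    have "x \<in># a \<or> x \<in># b"
      using eq by (metis union_iff union_single_eq_member)
    then show "(a, b) \<in> (\<lambda>(a, b). (add_mset x a, b)) ` ?S"
    proof
      assume "x \<in># a"
      then obtain a' where a': "a = add_mset x a'"
        by (meson mset_add)
      then have "a' + b = m"
        using eq by simp
      then show ?thesis
        using a' by (auto intro!: image_eqI[where x = "(a', b)"])
    next
      assume "x \<in># b"
      then obtain b' where b': "b = add_mset x b'"
        by (meson mset_add)
      then have "a + b' = m"
        using eq by simp
      then show ?thesis
        using b' nb by (auto simp: image_iff)
    qed
  qed
  then show ?case
    using add.IH by (meson finite_UnI finite_imageI finite_subset)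
qed

instantiation mfps :: (type, comm_ring_1) comm_ring_1
begin

lift_definition zero_mfps :: "('a, 'b) mfps" is "\<lambda>_. 0" .
lift_definition one_mfps :: "('a, 'b) mfps" is "\<lambda>m. if m = {#} then 1 else 0" .
lift_definition plus_mfps :: "('a, 'b) mfps \<Rightarrow> ('a, 'b) mfps \<Rightarrow> ('a, 'b) mfps"
  is "\<lambda>f g m. f m + g m" .
lift_definition minus_mfps :: "('a, 'b) mfps \<Rightarrow> ('a, 'b) mfps \<Rightarrow> ('a, 'b) mfps"
  is "\<lambda>f g m. f m - g m" .
lift_definition uminus_mfps :: "('a, 'b) mfps \<Rightarrow> ('a, 'b) mfps"
  is "\<lambda>f m. - f m" .
lift_definition times_mfps :: "('a, 'b) mfps \<Rightarrow> ('a, 'b) mfps \<Rightarrow> ('a, 'b) mfps"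
  is "\<lambda>f g m. \<Sum>(a, b) | a + b = m. f a * g b" .

instance
proof
  fix f g h :: "('a, 'b) mfps"
  show "f * g * h = f * (g * h)"
  proof (transfer, rule ext)
    fix f g h :: "'a multiset \<Rightarrow> 'b" and m
    let ?D = "\<lambda>m :: 'a multiset. {(a, b). a + b = m}"
    have "(\<Sum>(p, c)\<in>?D m. (\<Sum>(a, b)\<in>?D p. f a * g b) * h c)
        = (\<Sum>q\<in>?D m. \<Sum>r\<in>?D (fst q). f (fst r) * g (snd r) * h (snd q))"
      by (simp add: case_prod_unfold sum_distrib_right)
    also have "\<dots> = (\<Sum>(q, r)\<in>Sigma (?D m) (\<lambda>q. ?D (fst q)). f (fst r) * g (snd r) * h (snd q))"
      by (subst sum.Sigma) (auto simp: finite_mset_splits)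
    also have "\<dots> = (\<Sum>(q, r)\<in>Sigma (?D m) (\<lambda>q. ?D (snd q)). f (fst q) * (g (fst r) * h (snd r)))"
      by (rule sum.reindex_bij_witness
          [where i = "\<lambda>((a, p), (b, c)). ((a + b, c), (a, b))"
            and j = "\<lambda>((p, c), (a, b)). ((a, b + c), (b, c))"])
        (auto simp: add.assoc mult.assoc)
    also have "\<dots> = (\<Sum>q\<in>?D m. \<Sum>r\<in>?D (snd q). f (fst q) * (g (fst r) * h (snd r)))"
      by (subst sum.Sigma) (auto simp: finite_mset_splits)
    also have "\<dots> = (\<Sum>(a, p)\<in>?D m. f a * (\<Sum>(b, c)\<in>?D p. g b * h c))"
      by (simp add: case_prod_unfold sum_distrib_left)
    finally show "(\<Sum>(p, c)\<in>?D m. (\<Sum>(a, b)\<in>?D p. f a * g b) * h c)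
        = (\<Sum>(a, p)\<in>?D m. f a * (\<Sum>(b, c)\<in>?D p. g b * h c))" .
  qed
  show "f * g = g * f"
  proof (transfer, rule ext)
    fix f g :: "'a multiset \<Rightarrow> 'b" and m
    show "(\<Sum>(a, b) | a + b = m. f a * g b) = (\<Sum>(a, b) | a + b = m. g a * f b)"
      by (rule sum.reindex_bij_witness[where i = prod.swap and j = prod.swap])
        (auto simp: add.commute mult.commute)
  qed
  show "1 * f = f"
  proof (transfer, rule ext)
    fix f :: "'a multiset \<Rightarrow> 'b" and m
    have "(\<Sum>(a, b) | a + b = m. (if a = {#} then 1 else 0) * f b)
        = (\<Sum>(a, b)\<in>{({#} :: 'a multiset, m)}. (if a = {#} then 1 else 0) * f b)"
      by (rule sum.mono_neutral_right) (auto simp: finite_mset_splits split: if_splits)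
    then show "(\<Sum>(a, b) | a + b = m. (if a = {#} then 1 else 0) * f b) = f m"
      by simp
  qed
  show "(f + g) * h = f * h + g * h"
    by (transfer, rule ext)
      (simp add: case_prod_unfold distrib_right sum.distrib)
  show "f + g + h = f + (g + h)" by transfer (simp add: add.assoc)
  show "f + g = g + f" by transfer (simp add: add.commute)
  show "0 + f = f" by transfer simp
  show "- f + f = 0" by transfer simp
  show "f - g = f + - g" by transfer simp
  show "(0 :: ('a, 'b) mfps) \<noteq> 1"
    by transfer (metis zero_neq_one)
qed

end

lift_definition mfps_const :: "'a :: zero \<Rightarrow> ('v, 'a) mfps"
  is "\<lambda>c m. if m = {#} then c else 0" .


section \<open>Partitions and symmetric functions\<close>

definition partitions :: "nat \<Rightarrow> nat multiset set" where
  "partitions n = {lam. 0 \<notin># lam \<and> sum_mset lam = n}"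

text \<open>In what follows \<open>x :: nat \<Rightarrow> 'v\<close> is an infinite set of variables \<open>x 0, x 1, \<dots>\<close>.
  The coefficient of a monomial in \<open>\<Sum>i. (x i) ^ k\<close> is the number of summands equal to it.\<close>

definition power_sum :: "(nat \<Rightarrow> 'v) \<Rightarrow> nat \<Rightarrow> ('v, 'a :: comm_ring_1) mfps" where
  "power_sum x k = Abs_mfps (\<lambda>m. of_nat (card {i. m = replicate_mset k (x i)}))"

definition power_sum_sym :: "(nat \<Rightarrow> 'v) \<Rightarrow> nat multiset \<Rightarrow> ('v, 'a :: comm_ring_1) mfps" where
  "power_sum_sym x lam = (\<Prod>k\<in>#lam. power_sum x k)"

definition leading_monomial :: "nat multiset \<Rightarrow> nat multiset" where
  "leading_monomial lam =
     (let ps = rev (sorted_list_of_multiset lam)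
      in \<Sum>i<length ps. replicate_mset (ps ! i) i)"

definition monomial_sym :: "(nat \<Rightarrow> 'v) \<Rightarrow> nat multiset \<Rightarrow> ('v, 'a :: comm_ring_1) mfps" where
  "monomial_sym x lam = Abs_mfps (\<lambda>m.
     if \<exists>\<pi>. bij \<pi> \<and> m = image_mset x (image_mset \<pi> (leading_monomial lam)) then 1 else 0)"

datatype var = X nat | Y nat | Z nat


section \<open>Factorizations of the long cycle\<close>

definition cycle_type :: "nat \<Rightarrow> (nat \<Rightarrow> nat) \<Rightarrow> nat multiset" where
  "cycle_type n \<alpha> = image_mset card (mset_set (orbit \<alpha> ` {1..n}))"

definition conj_class :: "nat \<Rightarrow> nat multiset \<Rightarrow> (nat \<Rightarrow> nat) set" where
  "conj_class n lam = {\<alpha>. \<alpha> permutes {1..n} \<and> cycle_type n \<alpha> = lam}"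

definition long_cycle :: "nat \<Rightarrow> nat \<Rightarrow> nat" where
  "long_cycle n = cycle_of_list [1..<Suc n]"

definition num_factorizations ::
    "nat \<Rightarrow> nat multiset \<Rightarrow> nat multiset \<Rightarrow> nat multiset \<Rightarrow> nat" where
  "num_factorizations n lam mu nu =
     card {(\<alpha>\<^sub>1, \<alpha>\<^sub>2, \<alpha>\<^sub>3). \<alpha>\<^sub>1 \<in> conj_class n lam \<and> \<alpha>\<^sub>2 \<in> conj_class n mu \<and>
       \<alpha>\<^sub>3 \<in> conj_class n nu \<and> \<alpha>\<^sub>1 \<circ> \<alpha>\<^sub>2 \<circ> \<alpha>\<^sub>3 = long_cycle n}"

text \<open>\<open>M_coeff n a b c\<close> is $M^{(n-1)}_{a,b,c}$, used for \<open>1 \<le> a, b, c \<le> n\<close>. The summands with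
  \<open>g > a - 1\<close> vanish, the lower index \<open>a - 1 - g\<close> being negative; they are left out because
  truncated subtraction would turn this index into \<open>0\<close>.\<close>

definition M_coeff :: "nat \<Rightarrow> nat \<Rightarrow> nat \<Rightarrow> nat \<Rightarrow> nat" where
  "M_coeff n a b c = ((n - 1) choose (c - 1)) *
     (\<Sum>g\<in>{0..a - 1}. ((n - b) choose (a - 1 - g)) * ((n - c) choose g) * ((n - 1 - g) choose (n - b)))"

end

theory Submission
  imports Defs
begin

text \<open>
  The coefficient of a monomial on the left counts the factorizations of the long cycle whose
  factors carry colourings, constant on cycles, with prescribed numbers of points of each colour.
  Let \<open>\<psi>\<^sub>k\<close> be the character of the hook \<open>(n - k, 1\<^sup>k)\<close>, i.e. of the k-th exterior power of the
  standard representation. It is an alternating sum of traces of exterior powers of the permutation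
  representation, so it is a signed count of invariant subsets. Three facts suffice:
  \<open>\<Sum>k<n. (-1)\<^sup>k \<psi>\<^sub>k(g)\<close> is \<open>n\<close> if \<open>g\<close> is an n-cycle and \<open>0\<close> otherwise; averaging \<open>\<psi>\<^sub>k\<close> over a Young
  subgroup with \<open>l\<close> blocks gives \<open>(l - 1) choose k\<close>; and
  \<open>\<Sum>\<^sub>s \<psi>\<^sub>k(s\<inverse> g s h) = n! \<psi>\<^sub>k(g) \<psi>\<^sub>k(h) / \<psi>\<^sub>k(1)\<close>. The last one, usually a consequence of
  irreducibility, follows from sign cancellations: after averaging only the entries of the k-th
  compound matrix survive whose index sets differ in at most one element. The resulting sum
  \<open>(n!)\<^sup>2 \<Sum>k. (-1)\<^sup>k (a - 1 choose k) (b - 1 choose k) (c - 1 choose k) / (n - 1 choose k)\<^sup>2\<close> is the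
  inclusion-exclusion form of the stated coefficient.
\<close>

text \<open>The obstacle is the third fact. It is Schur's lemma for the hooks, but only traces of
  exterior powers of the permutation representation are at hand. Such a power contains two hooks, of
  degrees k and k - 1, so averaging over the conjugates of g acts on it by two scalars, which its
  trace alone does not separate. The second class function needed is \<open>exchange_char\<close>,
  the sum of the compound entries between index sets that differ by one exchange. Wedging with the
  all-ones vector and contracting with the all-ones functional gives a Koszul relation that
  expresses it through the same two hooks. Two numbers then determine the averaged matrix, and the
  bilinear form that results has no mixed terms in the hook characters. The squared denominator in
  the final sum arises because each of the three coloured factors contributes one inverse of
  \<open>n - 1 choose k\<close>, and the value of the hook at the identity gives one of them back.
  Only the numbers of parts enter because the average over a Young subgroup sees its blocks only
  through their number.\<close>

section \<open>Principal minors of permutation matrices and exterior powers\<close>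

text \<open>These congruence rules expand \<open>g\<close> to \<open>\<lambda>x. g x\<close> and thereby hide compositions from the simplifier.\<close>
declare sign_on_cong [cong del] restrict_id_cong [cong del]

text \<open>The principal minor of the permutation matrix of \<open>g\<close> with rows and columns in \<open>S\<close>.\<close>
definition principal_minor :: "('a \<Rightarrow> 'a) \<Rightarrow> 'a set \<Rightarrow> int" where
  "principal_minor g S = (if g ` S = S then sign_on S g else 0)"

lemma bij_betw_self: "finite S \<Longrightarrow> g ` S = S \<Longrightarrow> bij_betw g S S"
  by (simp add: bij_betw_def finite_surj_inj)

lemma principal_minor_cong:
  assumes "\<And>x. x \<in> S \<Longrightarrow> g x = h x"
  shows "principal_minor g S = principal_minor h S"
proof -
  have "g ` S = h ` S" using assms by auto
  moreover have "sign_on S g = sign_on S h" by (rule sign_on_cong) (use assms in auto)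
  ultimately show ?thesis by (simp add: principal_minor_def)
qed

lemma principal_minor_eq_0: "x \<in> S \<Longrightarrow> g x \<notin> S \<Longrightarrow> principal_minor g S = 0"
  unfolding principal_minor_def by auto

lemma principal_minor_empty [simp]: "principal_minor g {} = 1"
  unfolding principal_minor_def sign_on_def restrict_id_def by simp

lemma principal_minor_id [simp]: "principal_minor id S = 1"
  by (simp add: principal_minor_def)

lemma principal_minor_transpose:
  "a \<in> S \<Longrightarrow> b \<in> S \<Longrightarrow> a \<noteq> b \<Longrightarrow> principal_minor (transpose a b) S = -1"
  by (simp add: principal_minor_def sign_on_transpose)

text \<open>In general a minor of a product is a sum over intermediate index sets. If a factor
  preserves \<open>S\<close>, the only intermediate set that can contribute is \<open>S\<close>
  itself. If exactly one factor preserves \<open>S\<close>, the product does not, and both sides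
  vanish.\<close>

lemma principal_minor_compose:
  assumes "finite S" "inj p" "p ` S = S \<or> g ` S = S"
  shows "principal_minor (p \<circ> g) S = principal_minor p S * principal_minor g S"
proof (cases "p ` S = S \<and> g ` S = S")
  case True
  moreover from this have "(p \<circ> g) ` S = S" by (metis image_comp)
  ultimately show ?thesis
    using sign_on_compose[OF bij_betw_self bij_betw_self, of S p g] assms(1)
    by (simp add: principal_minor_def)
next
  case False
  have "(p \<circ> g) ` S \<noteq> S"
    using False assms(2,3) by (metis image_comp inj_image_eq_iff)
  then show ?thesis using False by (auto simp: principal_minor_def)
qed

lemma principal_minor_transpose_compose:
  assumes "finite S" "a \<in> S" "b \<in> S" "a \<noteq> b"
  shows "principal_minor (transpose a b \<circ> g) S = - principal_minor g S"
  using principal_minor_compose[of S "transpose a b" g] assms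
  by (simp add: principal_minor_transpose)

text \<open>The submatrix is block diagonal.\<close>

lemma principal_minor_Un:
  assumes "finite S" "finite T" "S \<inter> T = {}" "g ` S = S" "g ` T = T"
  shows "principal_minor g (S \<union> T) = principal_minor g S * principal_minor g T"
proof -
  have p: "restrict_id g S permutes S" "restrict_id g T permutes T"
    by (rule permutes_restrict_id, rule bij_betw_self, use assms in auto)+
  have "restrict_id g (S \<union> T) = restrict_id g S \<circ> restrict_id g T"
    using assms by (auto simp: restrict_id_def fun_eq_iff)
  then have "sign_on (S \<union> T) g = sign_on S g * sign_on T g"
    using p assms unfolding sign_on_def
    by (simp add: sign_compose permutes_imp_permutation)
  then show ?thesis using assms by (simp add: principal_minor_def image_Un)
qed

text \<open>A fixed point splits off a block equal to 1. If \<open>R\<close> is not invariant,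
  neither is \<open>insert s R\<close>, since an injective map sends no point of \<open>R\<close> to
  the fixed point \<open>s\<close>.\<close>

lemma principal_minor_insert:
  assumes "finite R" "s \<notin> R" "g s = s" "inj g"
  shows "principal_minor g (insert s R) = principal_minor g R"
proof (cases "g ` R = R")
  case True
  have "principal_minor g {s} = 1"
    using principal_minor_cong[of "{s}" g id] assms by simp
  with True show ?thesis using principal_minor_Un[of R "{s}" g] assms by simp
next
  case False
  have "g ` insert s R \<noteq> insert s R"
  proof
    assume "g ` insert s R = insert s R"
    then have "insert s (g ` R) = insert s R" using assms by simp
    moreover have "s \<notin> g ` R" using assms by (metis image_iff inj_eq)
    ultimately have "g ` R = R" using assms(2) by (metis insert_ident)
    then show False using False by simp
  qed
  then show ?thesis using False by (simp add: principal_minor_def)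
qed

lemma principal_minor_conj:
  assumes "finite S" "bij p" "bij g"
  shows "principal_minor (p \<circ> g \<circ> inv p) (p ` S) = principal_minor g S"
proof (cases "g ` S = S")
  case True
  have i: "(p \<circ> g \<circ> inv p) ` p ` S = p ` S"
    using True image_inv_f_f[OF bij_is_inj[OF assms(2)], of S] by (simp only: image_comp[symmetric])
  have inj: "inj_on p S" using assms by (meson bij_is_inj inj_on_subset subset_UNIV)
  have b: "restrict_id g S permutes S"
    by (rule permutes_restrict_id, rule bij_betw_self, use assms True in auto)
  have "sign_on (p ` S) (p \<circ> g \<circ> inv p) = sign (map_permutation S p (restrict_id g S))"
    unfolding sign_on_def map_permutation_def
  proof (rule arg_cong[of _ _ sign], rule restrict_id_cong)
    fix x assume "x \<in> p ` S"
    then show "(p \<circ> g \<circ> inv p) x = (p \<circ> restrict_id g S \<circ> inv_into S p) x"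
      using assms inj by (auto simp: bij_is_inj)
  qed simp
  also have "\<dots> = sign_on S g"
    using sign_map_permutation[OF inj b assms(1)] by (simp add: sign_on_def)
  finally show ?thesis using True i by (simp add: principal_minor_def)
next
  case False
  have "(p \<circ> g \<circ> inv p) ` p ` S = p ` (g ` S)"
    using image_inv_f_f[OF bij_is_inj[OF assms(2)], of S] by (simp only: image_comp[symmetric])
  then have "(p \<circ> g \<circ> inv p) ` p ` S \<noteq> p ` S"
    using False assms(2) by (metis bij_is_inj inj_image_eq_iff)
  then show ?thesis using False by (simp add: principal_minor_def)
qed

section \<open>Exterior power, hook and exchange characters\<close>

definition subsets :: "'a set \<Rightarrow> nat \<Rightarrow> 'a set set" where
  "subsets A k = {S. S \<subseteq> A \<and> card S = k}"

text \<open>Character of the k-th exterior power of the permutation representation on \<open>A\<close>.\<close>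
definition ext_char :: "'a set \<Rightarrow> nat \<Rightarrow> ('a \<Rightarrow> 'a) \<Rightarrow> int" where
  "ext_char A k g = (\<Sum>S\<in>subsets A k. principal_minor g S)"

text \<open>Character of the hook \<open>(n - k, 1\<^sup>k)\<close> for \<open>n = card A\<close>.\<close>
definition hook_char :: "'a set \<Rightarrow> nat \<Rightarrow> ('a \<Rightarrow> 'a) \<Rightarrow> int" where
  "hook_char A k g = (\<Sum>j\<le>k. (-1) ^ (k - j) * ext_char A j g)"

text \<open>A triple stands for two k-subsets, \<open>S\<close> and the set with \<open>t\<close> in
  place of \<open>s\<close>. Keeping \<open>s\<close> and \<open>t\<close> lets their transposition
  identify the two index sets, which fixes the sign of a compound entry between them.\<close>

definition exchanges :: "'a set \<Rightarrow> nat \<Rightarrow> ('a set \<times> 'a \<times> 'a) set" where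
  "exchanges A k = (SIGMA S:subsets A k. S \<times> (A - S))"

text \<open>Up to the sign of that identification, a summand is an off-diagonal entry of the k-th
  compound matrix of \<open>g\<close>. It is nonzero only if \<open>g\<close> maps \<open>S\<close>
  onto the exchanged set.\<close>

definition exchange_char :: "'a set \<Rightarrow> nat \<Rightarrow> ('a \<Rightarrow> 'a) \<Rightarrow> int" where
  "exchange_char A k g = (\<Sum>(S, s, t)\<in>exchanges A k. principal_minor (transpose s t \<circ> g) S)"

lemma finite_subsets [simp]: "finite A \<Longrightarrow> finite (subsets A k)"
  by (rule finite_subset[of _ "Pow A"]) (auto simp: subsets_def)

lemma card_subsets: "finite A \<Longrightarrow> card (subsets A k) = card A choose k"
  by (simp add: subsets_def n_subsets)

lemma subsets_finite: "finite A \<Longrightarrow> S \<in> subsets A k \<Longrightarrow> finite S"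
  by (auto simp: subsets_def intro: finite_subset)

lemma subsets_0: "finite A \<Longrightarrow> subsets A 0 = {{}}"
  by (auto simp: subsets_def dest: finite_subset)

lemma ext_char_0 [simp]: "finite A \<Longrightarrow> ext_char A 0 g = 1"
  by (simp add: ext_char_def subsets_0)

lemma hook_char_0 [simp]: "finite A \<Longrightarrow> hook_char A 0 g = 1"
  by (simp add: hook_char_def)

text \<open>The permutation representation is the trivial one plus the standard one V, so its
  exterior power of degree k + 1 is the sum of those of V in degrees k + 1 and k.\<close>

lemma hook_char_Suc: "hook_char A (Suc k) g = ext_char A (Suc k) g - hook_char A k g"
proof -
  have "(\<Sum>j\<le>k. (-1) ^ (Suc k - j) * ext_char A j g) = - hook_char A k g"
    unfolding hook_char_def sum_negf[symmetric] by (rule sum.cong) (auto simp: Suc_diff_le)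
  then show ?thesis by (simp add: hook_char_def)
qed

lemma bij_betw_image_subsets:
  assumes "p permutes A"
  shows "bij_betw ((`) p) (subsets A k) (subsets A k)"
proof (rule bij_betw_byWitness[where f' = "(`) (inv p)"])
  have *: "q ` S \<in> subsets A k" if "q permutes A" "S \<in> subsets A k" for q S
    using that by (auto simp: subsets_def permutes_in_image card_image permutes_inj_on
        intro: permutes_in_image[THEN iffD2])
  show "(`) p ` subsets A k \<subseteq> subsets A k" using * assms by blast
  show "(`) (inv p) ` subsets A k \<subseteq> subsets A k" using * permutes_inv[OF assms] by blast
qed (use permutes_inverses[OF assms] in \<open>auto simp: image_image\<close>)

lemma ext_char_conj:
  assumes "finite A" "p permutes A" "g permutes A"
  shows "ext_char A k (inv p \<circ> g \<circ> p) = ext_char A k g"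
proof -
  have "ext_char A k g = (\<Sum>S\<in>subsets A k. principal_minor g (p ` S))"
    unfolding ext_char_def using bij_betw_image_subsets[OF assms(2)]
    by (rule sum.reindex_bij_betw[symmetric])
  also have "\<dots> = ext_char A k (inv p \<circ> g \<circ> p)"
    unfolding ext_char_def
  proof (rule sum.cong)
    fix S assume "S \<in> subsets A k"
    then have "finite S" using assms(1) by (rule subsets_finite[rotated])
    moreover have "p \<circ> (inv p \<circ> g \<circ> p) \<circ> inv p = g"
      using permutes_inverses[OF assms(2)] by (simp add: fun_eq_iff)
    moreover have "bij (inv p \<circ> g \<circ> p)" using assms
      by (meson bij_comp permutes_bij permutes_inv)
    ultimately show "principal_minor g (p ` S) = principal_minor (inv p \<circ> g \<circ> p) S"
      using principal_minor_conj[of S p "inv p \<circ> g \<circ> p"] permutes_bij[OF assms(2)] by simp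
  qed simp
  finally show ?thesis by simp
qed

lemma hook_char_conj:
  assumes "finite A" "p permutes A" "g permutes A"
  shows "hook_char A k (inv p \<circ> g \<circ> p) = hook_char A k g"
  by (simp add: hook_char_def ext_char_conj[OF assms])

lemma hook_char_id:
  assumes "finite A" "A \<noteq> {}"
  shows "hook_char A k id = int (card A - 1 choose k)"
proof -
  obtain m where m: "card A = Suc m" using assms by (metis card_eq_0_iff not0_implies_Suc)
  have E: "ext_char A j id = int (card A choose j)" for j
    by (simp add: ext_char_def card_subsets assms)
  have "hook_char A k g = int (m choose k)" if "\<And>j. ext_char A j g = int (Suc m choose j)" for g
    by (induction k) (simp_all add: assms that hook_char_Suc)
  then show ?thesis using E m by simp
qed

section \<open>The Koszul relation between consecutive exterior powers\<close>

lemma exchange_char_nested: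
  assumes "finite A"
  shows "exchange_char A k g =
    (\<Sum>S\<in>subsets A k. \<Sum>s\<in>S. \<Sum>t\<in>A - S. principal_minor (transpose s t \<circ> g) S)"
proof -
  have "(\<Sum>S\<in>subsets A k. \<Sum>s\<in>S. \<Sum>t\<in>A - S. principal_minor (transpose s t \<circ> g) S)
      = (\<Sum>S\<in>subsets A k. \<Sum>(s, t)\<in>S \<times> (A - S). principal_minor (transpose s t \<circ> g) S)"
    by (simp add: sum.cartesian_product)
  also have "\<dots> = exchange_char A k g"
    unfolding exchange_char_def exchanges_def
    by (subst sum.Sigma) (use assms in \<open>auto intro: subsets_finite[OF assms] simp: case_prod_unfold\<close>)
  finally show ?thesis by simp
qed

text \<open>The summands of \<open>s\<close> reduce to minors on \<open>R\<close> once
  \<open>s\<close> becomes a fixed point. If \<open>h s\<close> lies outside \<open>R\<close>, only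
  \<open>t = h s\<close> survives, and then \<open>s\<close> is fixed already. If \<open>h s\<close>
  lies in \<open>R\<close>, one more transposition, of \<open>s\<close> and \<open>h s\<close>,
  fixes \<open>s\<close>, flips the sign and leaves an exchange of \<open>h s\<close> for
  \<open>t\<close>.\<close>

lemma sum_minors_insert:
  assumes A: "finite A" and R: "R \<subseteq> A" and h: "h permutes A"
  shows "(\<Sum>s\<in>A - R. \<Sum>t\<in>A - R. principal_minor (transpose s t \<circ> h) (insert s R))
    = int (card (A - R)) * principal_minor h R
      - (\<Sum>s\<in>R. \<Sum>t\<in>A - R. principal_minor (transpose s t \<circ> h) R)"
proof -
  have fR: "finite R" using A R finite_subset by blast
  have inj: "inj h" using h permutes_inj by blast
  have injt: "inj (transpose s t \<circ> h)" for s t using inj by (simp add: inj_compose)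
  define G where "G s = (\<Sum>t\<in>A - R. principal_minor (transpose s t \<circ> h) R)" for s
  define F where "F s = (\<Sum>t\<in>A - R. principal_minor (transpose s t \<circ> h) (insert s R))" for s
  have out: "F s = principal_minor h R" if s: "s \<in> A - R" and hs: "h s \<notin> R" for s
  proof -
    have mem: "h s \<in> A - R" using s hs h by (simp add: permutes_in_image)
    have zero: "principal_minor (transpose s t \<circ> h) (insert s R) = 0" if "t \<in> A - R - {h s}" for t
      by (rule principal_minor_eq_0[of s]) (use that hs in \<open>auto simp: transpose_def\<close>)
    have "F s = principal_minor (transpose s (h s) \<circ> h) (insert s R)"
      unfolding F_def using A mem by (subst sum.remove[of _ "h s"]) (auto simp: zero)
    also have "\<dots> = principal_minor (transpose s (h s) \<circ> h) R"
      by (rule principal_minor_insert) (use s fR injt in auto)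
    also have "\<dots> = principal_minor h R"
    proof (cases "\<exists>x\<in>R. h x = s")
      case True
      then obtain x where x: "x \<in> R" "h x = s" by blast
      have "principal_minor (transpose s (h s) \<circ> h) R = 0"
        by (rule principal_minor_eq_0[of x]) (use x hs in auto)
      moreover have "principal_minor h R = 0"
        by (rule principal_minor_eq_0[of x]) (use x s in auto)
      ultimately show ?thesis by simp
    next
      case False
      then show ?thesis
        using s by (intro principal_minor_cong) (auto simp: transpose_def inj_eq[OF inj])
    qed
    finally show ?thesis .
  qed
  have inn: "F s = - G (h s)" if s: "s \<in> A - R" and hs: "h s \<in> R" for s
  proof -
    have "principal_minor (transpose s t \<circ> h) (insert s R) = - principal_minor (transpose (h s) t \<circ> h) R"
      if t: "t \<in> A - R" for t
    proof -
      have ne: "s \<noteq> h s" "t \<noteq> h s" using s hs t by auto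
      let ?k = "transpose s (h s) \<circ> (transpose s t \<circ> h)"
      have "- principal_minor (transpose s t \<circ> h) (insert s R) = principal_minor ?k (insert s R)"
        by (subst principal_minor_transpose_compose) (use fR ne hs in auto)
      also have "\<dots> = principal_minor ?k R"
        by (rule principal_minor_insert)
          (use s fR ne inj in \<open>auto simp: transpose_def intro!: inj_compose\<close>)
      also have "\<dots> = principal_minor (transpose (h s) t \<circ> h) R"
      \<comment> \<open>In the first case both permutations move \<open>x\<close> out of
        \<open>R\<close>; in the second they agree on \<open>R\<close>.\<close>
      proof (cases "s \<noteq> t \<and> (\<exists>x\<in>R. h x = s)")
        case True
        then obtain x where x: "x \<in> R" "h x = s" "s \<noteq> t" by blast
        have "principal_minor ?k R = 0"
          by (rule principal_minor_eq_0[of x]) (use x ne s t in \<open>auto simp: transpose_def\<close>)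
        moreover have "principal_minor (transpose (h s) t \<circ> h) R = 0"
          by (rule principal_minor_eq_0[of x]) (use x ne s t in \<open>auto simp: transpose_def\<close>)
        ultimately show ?thesis by simp
      next
        case False
        then show ?thesis
          using s ne
          by (intro principal_minor_cong) (auto simp: transpose_def inj_eq[OF inj])
      qed
      finally show ?thesis by simp
    qed
    then show ?thesis unfolding F_def G_def by (simp add: sum_negf)
  qed
  have "(\<Sum>s\<in>A - R. F s) = (\<Sum>s\<in>{s \<in> A - R. h s \<notin> R}. F s) + (\<Sum>s\<in>{s \<in> A - R. h s \<in> R}. F s)"
    using A by (subst sum.union_disjoint[symmetric]) (auto intro!: sum.cong)
  also have "(\<Sum>s\<in>{s \<in> A - R. h s \<notin> R}. F s) = int (card (A - R)) * principal_minor h R"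
  \<comment> \<open>The complement of an invariant \<open>R\<close> is invariant, so every
    \<open>s\<close> outside \<open>R\<close> is counted; otherwise both sides are 0.\<close>
  proof (cases "h ` R = R")
    case True
    then have "{s \<in> A - R. h s \<notin> R} = A - R" using inj by (auto simp: inj_eq dest: equalityD2)
      (metis Diff_iff image_iff inj_eq)
    moreover have "(\<Sum>s\<in>{s \<in> A - R. h s \<notin> R}. F s) = (\<Sum>s\<in>{s \<in> A - R. h s \<notin> R}. principal_minor h R)"
      by (rule sum.cong) (use out in auto)
    ultimately show ?thesis by simp
  next
    case False
    then show ?thesis using out by (simp add: principal_minor_def)
  qed
  also have "(\<Sum>s\<in>{s \<in> A - R. h s \<in> R}. F s) = - (\<Sum>s\<in>{s \<in> A - R. h s \<in> R}. G (h s))"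
    by (simp add: inn sum_negf)
  also have "(\<Sum>s\<in>{s \<in> A - R. h s \<in> R}. G (h s)) = (\<Sum>u\<in>{u \<in> R. inv h u \<notin> R}. G u)"
    by (rule sum.reindex_bij_witness[of _ "inv h" h])
      (use R in \<open>auto simp: permutes_inverses[OF h] permutes_in_image[OF permutes_inv[OF h]]\<close>)
  \<comment> \<open>A point \<open>u\<close> whose preimage lies in \<open>R\<close> may be added:
    the exchange sends that preimage to \<open>t\<close>, outside \<open>R\<close>.\<close>
  also have "\<dots> = (\<Sum>u\<in>R. G u)"
  proof (rule sum.mono_neutral_left)
    show "\<forall>u\<in>R - {u \<in> R. inv h u \<notin> R}. G u = 0"
    proof
      fix u assume u: "u \<in> R - {u \<in> R. inv h u \<notin> R}"
      have "principal_minor (transpose u t \<circ> h) R = 0" if "t \<in> A - R" for t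
        by (rule principal_minor_eq_0[of "inv h u"]) (use u that in \<open>auto simp: permutes_inverses[OF h]\<close>)
      then show "G u = 0" unfolding G_def by simp
    qed
  qed (use fR in auto)
  finally show ?thesis unfolding F_def G_def by simp
qed

text \<open>This is the trace form of the Koszul homotopy. Let W wedge with the sum of all basis
  vectors and C contract with the sum of all coordinate functionals. Then CW + WC is multiplication
  by \<open>card A\<close>, and both operators commute with \<open>h\<close>. The trace of
  \<open>h\<close> times WC in degree k is \<open>exchange_char A k h\<close> plus k times
  \<open>ext_char A k h\<close>; that of \<open>h\<close> times CW equals the one for WC in degree k
  + 1.\<close>

lemma exchange_char_Suc_ext:
  assumes A: "finite A" and h: "h permutes A"
  shows "exchange_char A (Suc k) h + int (Suc k) * ext_char A (Suc k) h
    = (int (card A) - int k) * ext_char A k h - exchange_char A k h"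
proof -
  let ?F = "\<lambda>R s. \<Sum>t\<in>A - R. principal_minor (transpose s t \<circ> h) (insert s R)"
  have "(\<Sum>R\<in>subsets A k. \<Sum>s\<in>A - R. ?F R s)
      = (\<Sum>(R, s)\<in>(SIGMA R:subsets A k. A - R). ?F R s)"
    using A by (subst sum.Sigma) auto
  also have "\<dots> = (\<Sum>(S, s)\<in>(SIGMA S:subsets A (Suc k). S). ?F (S - {s}) s)"
    by (rule sum.reindex_bij_witness
        [of _ "\<lambda>(S, s). (S - {s}, s)" "\<lambda>(R, s). (insert s R, s)"])
      (use A in \<open>auto simp: subsets_def card_insert_if intro: finite_subset dest: finite_subset\<close>)
  also have "\<dots> = (\<Sum>S\<in>subsets A (Suc k). \<Sum>s\<in>S. ?F (S - {s}) s)"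
    using A by (subst sum.Sigma) (auto intro: subsets_finite)
  also have "\<dots> = (\<Sum>S\<in>subsets A (Suc k). \<Sum>s\<in>S.
      (principal_minor h S + (\<Sum>t\<in>A - S. principal_minor (transpose s t \<circ> h) S)))"
  proof (intro sum.cong refl)
    fix S s assume S: "S \<in> subsets A (Suc k)" and s: "s \<in> S"
    \<comment> \<open>The value \<open>t = s\<close> is the trivial exchange and yields the minor of
      \<open>h\<close> itself.\<close>
    have "A - (S - {s}) = insert s (A - S)" using S s by (auto simp: subsets_def)
    then show "?F (S - {s}) s =
        principal_minor h S + (\<Sum>t\<in>A - S. principal_minor (transpose s t \<circ> h) S)"
      using s A by (simp add: insert_absorb)
  qed
  also have "\<dots> = exchange_char A (Suc k) h + int (Suc k) * ext_char A (Suc k) h"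
    unfolding exchange_char_nested[OF A] ext_char_def sum_distrib_left sum.distrib[symmetric]
    by (rule sum.cong) (auto simp: sum.distrib subsets_def)
  finally have "exchange_char A (Suc k) h + int (Suc k) * ext_char A (Suc k) h
      = (\<Sum>R\<in>subsets A k. \<Sum>s\<in>A - R. ?F R s)" by simp
  also have "\<dots> = (\<Sum>R\<in>subsets A k. (int (card A) - int k) * principal_minor h R
      - (\<Sum>s\<in>R. \<Sum>t\<in>A - R. principal_minor (transpose s t \<circ> h) R))"
  proof (rule sum.cong, rule refl)
    fix R assume R: "R \<in> subsets A k"
    then have "int (card (A - R)) = int (card A) - int k"
      using A by (auto simp: subsets_def card_Diff_subset finite_subset card_mono of_nat_diff)
    then show "(\<Sum>s\<in>A - R. ?F R s) = (int (card A) - int k) * principal_minor h R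
      - (\<Sum>s\<in>R. \<Sum>t\<in>A - R. principal_minor (transpose s t \<circ> h) R)"
      using sum_minors_insert[OF A _ h, of R] R by (simp add: subsets_def)
  qed
  also have "\<dots> = (int (card A) - int k) * ext_char A k h - exchange_char A k h"
    unfolding exchange_char_nested[OF A] ext_char_def sum_distrib_left sum_subtractf[symmetric] ..
  finally show ?thesis .
qed

lemma exchange_char_0: "finite A \<Longrightarrow> exchange_char A 0 h = 0"
  by (simp add: exchange_char_nested subsets_0)

text \<open>On the exterior power of degree k + 1, contraction followed by wedging is
  \<open>card A\<close> on the hook of degree k and 0 on the hook of degree k + 1; this is the trace
  of that statement.\<close>

lemma exchange_char_Suc:
  assumes A: "finite A" and h: "h permutes A"
  shows "exchange_char A (Suc k) h = int (card A) * hook_char A k h - int (Suc k) * ext_char A (Suc k) h"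
proof (induction k)
  case 0
  show ?case using exchange_char_Suc_ext[OF assms, of 0] by (simp add: A exchange_char_0)
next
  case (Suc k)
  have "exchange_char A (Suc (Suc k)) h + int (Suc (Suc k)) * ext_char A (Suc (Suc k)) h
      = (int (card A) - int (Suc k)) * ext_char A (Suc k) h
        - (int (card A) * hook_char A k h - int (Suc k) * ext_char A (Suc k) h)"
    using exchange_char_Suc_ext[OF assms, of "Suc k"] Suc by simp
  also have "\<dots> = int (card A) * hook_char A (Suc k) h"
    unfolding hook_char_Suc by (simp add: algebra_simps)
  finally show ?case by simp
qed

text \<open>There are no subsets with \<open>card A + 1\<close> elements, so in that degree the
  Koszul relation reads \<open>card A\<close> times this character equals 0.\<close>

lemma hook_char_card:
  assumes A: "finite A" "A \<noteq> {}" and h: "h permutes A"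
  shows "hook_char A (card A) h = 0"
proof -
  have "subsets A (Suc (card A)) = {}"
    using A by (auto simp: subsets_def dest: card_mono)
  then have "int (card A) * hook_char A (card A) h = 0"
    using exchange_char_Suc[OF A(1) h, of "card A"]
    by (simp add: exchange_char_def exchanges_def ext_char_def)
  then show ?thesis using A by simp
qed

section \<open>Averaging minors over a conjugacy class\<close>

lemma finite_exchanges [simp]: "finite A \<Longrightarrow> finite (exchanges A k)"
  unfolding exchanges_def by (rule finite_SigmaI) (auto intro: subsets_finite)

lemma card_exchanges:
  assumes "finite A"
  shows "card (exchanges A k) = (card A choose k) * (k * (card A - k))"
proof -
  have "card (S \<times> (A - S)) = k * (card A - k)" if "S \<in> subsets A k" for S
    using that assms by (auto simp: subsets_def card_cartesian_product card_Diff_subset finite_subset)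
  then show ?thesis
    unfolding exchanges_def using assms
    by (subst card_SigmaI) (auto simp: card_subsets intro: subsets_finite)
qed

lemma image_transpose_exchange:
  "s \<in> S \<Longrightarrow> t \<notin> S \<Longrightarrow> transpose s t ` S = insert t (S - {s})"
  by (auto simp: transpose_def image_iff)

text \<open>Conjugation by the transposition of \<open>s\<close> and \<open>t\<close> turns the
  exchange into its reverse and moves the transposition from the right of \<open>g\<close> to the
  left.\<close>

lemma exchange_char_commute:
  assumes A: "finite A" and g: "g permutes A"
  shows "(\<Sum>(S, s, t)\<in>exchanges A k. principal_minor (g \<circ> transpose s t) S) = exchange_char A k g"
  unfolding exchange_char_def
proof (rule sum.reindex_bij_witness[of _ "\<lambda>(S, s, t). (transpose s t ` S, t, s)" "\<lambda>(S, s, t). (transpose s t ` S, t, s)"])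
  fix x assume x: "x \<in> exchanges A k"
  obtain S s t where xs: "x = (S, s, t)" by (metis prod_cases3)
  have S: "S \<subseteq> A" "card S = k" "s \<in> S" "t \<in> A" "t \<notin> S" and fS: "finite S"
    using x A by (auto simp: xs exchanges_def subsets_def intro: finite_subset)
  have e: "transpose s t ` S = insert t (S - {s})" by (rule image_transpose_exchange) (use S in auto)
  have c: "card (transpose s t ` S) = k" using S by (simp add: card_image)
  have m: "(transpose s t ` S, t, s) \<in> exchanges A k"
    using S c unfolding exchanges_def subsets_def e by auto
  then show "(case x of (S, s, t) \<Rightarrow> (transpose s t ` S, t, s)) \<in> exchanges A k" by (simp add: xs)
  then show "(case x of (S, s, t) \<Rightarrow> (transpose s t ` S, t, s)) \<in> exchanges A k" .
  show "(case case x of (S, s, t) \<Rightarrow> (transpose s t ` S, t, s) of (S, s, t) \<Rightarrow> (transpose s t ` S, t, s)) = x"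
    by (simp add: xs image_image transpose_commute)
  then show "(case case x of (S, s, t) \<Rightarrow> (transpose s t ` S, t, s) of (S, s, t) \<Rightarrow> (transpose s t ` S, t, s)) = x" .
  have "principal_minor (transpose s t \<circ> (g \<circ> transpose s t) \<circ> inv (transpose s t)) (transpose s t ` S)
      = principal_minor (g \<circ> transpose s t) S"
    by (rule principal_minor_conj) (use fS permutes_bij[OF g] in \<open>auto intro!: bij_comp\<close>)
  moreover have "transpose s t \<circ> (g \<circ> transpose s t) \<circ> inv (transpose s t) = transpose t s \<circ> g"
    by (simp add: fun_eq_iff transpose_commute[of t s])
  ultimately show "(case case x of (S, s, t) \<Rightarrow> (transpose s t ` S, t, s) of
      (S, s, t) \<Rightarrow> principal_minor (transpose s t \<circ> g) S)
    = (case x of (S, s, t) \<Rightarrow> principal_minor (g \<circ> transpose s t) S)"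
    by (simp add: xs)
qed

lemma exists_permutes_image:
  assumes "finite A" "S \<in> subsets A k" "S' \<in> subsets A k"
  obtains p where "p permutes A" "p ` S = S'"
proof -
  \<comment> \<open>Equal counts mean that membership in \<open>S\<close> and membership in
    \<open>S'\<close> take each truth value equally often on \<open>A\<close>, so some permutation
    matches them.\<close>
  have c: "card {a \<in> A. (a \<in> S) = b} = card {a \<in> A. (a \<in> S') = b}" for b
  proof -
    have "{a \<in> A. a \<in> T} = T" "{a \<in> A. a \<notin> T} = A - T" if "T \<subseteq> A" for T using that by auto
    then show ?thesis using assms
      by (cases b) (auto simp: subsets_def card_Diff_subset finite_subset)
  qed
  have "image_mset (\<lambda>x. x \<in> S) (mset_set A) = image_mset (\<lambda>x. x \<in> S') (mset_set A)"
    by (rule multiset_eqI) (use c assms in \<open>simp add: count_image_mset_eq_card_vimage\<close>)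
  from image_mset_eq_implies_permutes[OF assms(1) this]
  obtain p where p: "p permutes A" "\<forall>x\<in>A. (x \<in> S) = (p x \<in> S')" by blast
  have "p ` S \<subseteq> S'" using p assms by (auto simp: subsets_def)
  moreover have "card (p ` S) = card S'"
    using p assms by (simp add: subsets_def card_image permutes_inj_on)
  ultimately have "p ` S = S'" using assms subsets_finite by (metis card_subset_eq)
  with p show ?thesis using that by blast
qed

text \<open>After any permutation carrying \<open>S\<close> to \<open>S'\<close>, a transposition
  inside \<open>S'\<close> corrects the image of \<open>s\<close> and one outside \<open>S'\<close>
  corrects the image of \<open>t\<close>; neither disturbs the image of \<open>S\<close>.\<close>

lemma exists_permutes_exchange:
  assumes A: "finite A" and "(S, s, t) \<in> exchanges A k" "(S', s', t') \<in> exchanges A k"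
  obtains p where "p permutes A" "p ` S = S'" "p s = s'" "p t = t'"
proof -
  have S: "S \<in> subsets A k" "s \<in> S" "t \<in> A" "t \<notin> S" and S': "S' \<in> subsets A k" "s' \<in> S'" "t' \<in> A" "t' \<notin> S'"
    using assms by (auto simp: exchanges_def)
  have sub: "S \<subseteq> A" "S' \<subseteq> A" using S S' by (auto simp: subsets_def)
  obtain p where p: "p permutes A" "p ` S = S'" using exists_permutes_image[OF A S(1) S'(1)] by blast
  define q where "q = transpose (p s) s' \<circ> p"
  have q: "q permutes A" unfolding q_def
    by (rule permutes_compose[OF p(1)], rule permutes_swap_id)
      (use S S' sub p permutes_in_image[OF p(1)] in auto)
  have qS: "q ` S = S'"
    unfolding q_def image_comp[symmetric] p(2)
    using p S S' by (intro transpose_image_eq) auto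
  have qt: "q t \<notin> S'" using qS S(4) q by (metis image_iff permutes_inj inj_eq)
  define r where "r = transpose (q t) t' \<circ> q"
  have "r permutes A" unfolding r_def
    by (rule permutes_compose[OF q], rule permutes_swap_id)
      (use S S' permutes_in_image[OF q] in auto)
  moreover have "r ` S = S'"
    unfolding r_def image_comp[symmetric] qS
    using qt S' by (intro transpose_image_eq) auto
  moreover have "r s = s'"
  proof -
    have "q s = s'" by (simp add: q_def)
    then show ?thesis unfolding r_def using qt S' by (auto simp: transpose_def)
  qed
  moreover have "r t = t'" by (simp add: r_def)
  ultimately show ?thesis using that by blast
qed

text \<open>The diagonal entry at \<open>S\<close> of a product of compound matrices: the sum of
  those of all conjugates of \<open>g\<close>, times that of \<open>h\<close>.\<close>

definition conj_minor_sum :: "'a set \<Rightarrow> ('a \<Rightarrow> 'a) \<Rightarrow> ('a \<Rightarrow> 'a) \<Rightarrow> 'a set \<Rightarrow> int" where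
  "conj_minor_sum A g h S = (\<Sum>p | p permutes A. principal_minor (inv p \<circ> g \<circ> p \<circ> h) S)"

lemma sum_permutations_compose_right:
  assumes "q permutes A"
  shows "(\<Sum>p | p permutes A. f (p \<circ> q)) = (\<Sum>p | p permutes A. f p)"
  by (rule sum.reindex_bij_witness[of _ "\<lambda>p. p \<circ> inv q" "\<lambda>p. p \<circ> q"])
    (use assms in \<open>auto simp: permutes_compose permutes_inv fun.map_comp permutes_inv_o o_assoc[symmetric]\<close>)

text \<open>Conjugating \<open>h\<close> relabels \<open>S\<close>, and the sum over
  \<open>p\<close> absorbs the relabelling on the side of \<open>g\<close>. Together with
  transitivity on subsets and on exchanges, this makes the entries that survive the averaging
  constant.\<close>

lemma conj_minor_sum_image:
  assumes A: "finite A" and q: "q permutes A" and g: "g permutes A" and h: "h permutes A" and S: "S \<subseteq> A"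
  shows "conj_minor_sum A g (q \<circ> h \<circ> inv q) (q ` S) = conj_minor_sum A g h S"
proof -
  have "conj_minor_sum A g h S = (\<Sum>p | p permutes A. principal_minor (inv (p \<circ> q) \<circ> g \<circ> (p \<circ> q) \<circ> h) S)"
    unfolding conj_minor_sum_def
    by (rule sum_permutations_compose_right[OF q, symmetric])
  also have "\<dots> = conj_minor_sum A g (q \<circ> h \<circ> inv q) (q ` S)"
    unfolding conj_minor_sum_def
  proof (rule sum.cong, rule refl)
    fix p assume "p \<in> {p. p permutes A}"
    then have p: "p permutes A" by simp
    let ?k = "inv (p \<circ> q) \<circ> g \<circ> (p \<circ> q) \<circ> h"
    have inv: "inv (p \<circ> q) = inv q \<circ> inv p"
      using p q by (simp add: o_inv_distrib permutes_bij)
    have "q \<circ> ?k \<circ> inv q = inv p \<circ> g \<circ> p \<circ> (q \<circ> h \<circ> inv q)"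
      unfolding inv by (simp add: fun_eq_iff permutes_inverses[OF q])
    moreover have "?k permutes A"
      using p q g h by (intro permutes_compose permutes_inv) auto
    ultimately show "principal_minor ?k S = principal_minor (inv p \<circ> g \<circ> p \<circ> (q \<circ> h \<circ> inv q)) (q ` S)"
      using principal_minor_conj[of S q ?k] A S permutes_bij[OF q] permutes_bij[of ?k A]
      by (metis finite_subset)
  qed
  finally show ?thesis by simp
qed

text \<open>If \<open>h ` S\<close> leaves \<open>S\<close> in two points, conjugating by the transposition of these points
  flips the sign of every summand.\<close>
lemma conj_minor_sum_eq_0:
  assumes A: "finite A" and g: "g permutes A" and h: "h permutes A" and S: "S \<subseteq> A"
    and t: "t1 \<in> h ` S - S" "t2 \<in> h ` S - S" "t1 \<noteq> t2"
  shows "conj_minor_sum A g h S = 0"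
proof -
  have fS: "finite S" using A S finite_subset by blast
  have inj: "inj h" using h permutes_inj by blast
  obtain u1 u2 where u: "u1 \<in> S" "u2 \<in> S" "h u1 = t1" "h u2 = t2" "u1 \<noteq> u2" using t by auto
  have tA: "t1 \<in> A" "t2 \<in> A" using u S h by (auto simp: permutes_in_image)
  let ?q = "transpose t1 t2"
  have q: "?q permutes A" using tA by (rule permutes_swap_id)
  have qS: "?q ` S = S" using t by (intro transpose_image_eq) auto
  have "conj_minor_sum A g h S = (\<Sum>p | p permutes A. principal_minor (inv (p \<circ> ?q) \<circ> g \<circ> (p \<circ> ?q) \<circ> h) S)"
    unfolding conj_minor_sum_def by (rule sum_permutations_compose_right[OF q, symmetric])
  also have "\<dots> = (\<Sum>p | p permutes A. - principal_minor (inv p \<circ> g \<circ> p \<circ> h) S)"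
  proof (rule sum.cong, rule refl)
    fix p assume "p \<in> {p. p permutes A}"
    then have p: "p permutes A" by simp
    let ?k = "inv p \<circ> g \<circ> p \<circ> h"
    have "inv (p \<circ> ?q) = ?q \<circ> inv p"
      using p by (simp add: o_inv_distrib permutes_bij)
    \<comment> \<open>The swap of \<open>t1\<close> and \<open>t2\<close> stands on both sides of
      the conjugate of \<open>g\<close>. The left one fixes \<open>S\<close> pointwise; the right
      one passes through \<open>h\<close> and becomes the swap of \<open>u1\<close> and
      \<open>u2\<close> inside \<open>S\<close>, which contributes -1.\<close>
    then have "inv (p \<circ> ?q) \<circ> g \<circ> (p \<circ> ?q) \<circ> h = ?q \<circ> (?k \<circ> transpose u1 u2)"
      using u inj by (auto simp: fun_eq_iff transpose_def inj_eq)
    moreover have "principal_minor (?q \<circ> (?k \<circ> transpose u1 u2)) S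
        = principal_minor ?q S * principal_minor (?k \<circ> transpose u1 u2) S"
      using fS qS by (intro principal_minor_compose) auto
    moreover have "principal_minor ?q S = 1"
    proof -
      have "principal_minor ?q S = principal_minor id S"
        by (rule principal_minor_cong) (use t in \<open>auto simp: transpose_def\<close>)
      then show ?thesis by simp
    qed
    moreover have "inj ?k" using p g h by (meson inj_compose permutes_inj permutes_inv)
    moreover from this have "principal_minor (?k \<circ> transpose u1 u2) S
        = principal_minor ?k S * principal_minor (transpose u1 u2) S"
      using fS u by (intro principal_minor_compose disjI2 transpose_image_eq) auto
    ultimately show "principal_minor (inv (p \<circ> ?q) \<circ> g \<circ> (p \<circ> ?q) \<circ> h) S = - principal_minor ?k S"
      using u by (simp add: principal_minor_transpose)
  qed
  also have "\<dots> = - conj_minor_sum A g h S" by (simp add: conj_minor_sum_def sum_negf)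
  finally show ?thesis by simp
qed

lemma conj_minor_sum_compose:
  assumes "finite S" "g permutes A" "q permutes A" "h ` S = S"
  shows "conj_minor_sum A g (q \<circ> h) S = conj_minor_sum A g q S * principal_minor h S"
  unfolding conj_minor_sum_def sum_distrib_right
proof (rule sum.cong, rule refl)
  fix p assume "p \<in> {p. p permutes A}"
  then have "inv p \<circ> g \<circ> p \<circ> q permutes A"
    using assms by (intro permutes_compose permutes_inv) auto
  then show "principal_minor (inv p \<circ> g \<circ> p \<circ> (q \<circ> h)) S
      = principal_minor (inv p \<circ> g \<circ> p \<circ> q) S * principal_minor h S"
    using principal_minor_compose[of S "inv p \<circ> g \<circ> p \<circ> q" h] assms permutes_inj[of _ A]
    by (simp add: o_assoc)
qed

text \<open>Matrix multiplication with only the diagonal and single-exchange entries of the summed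
  matrix kept. Since \<open>h\<close> maps \<open>S\<close> to one set, at most one summand on the
  right survives; if the image leaves \<open>S\<close> in two or more points, none does, and the
  left side vanishes by \<open>conj_minor_sum_eq_0\<close>.\<close>

lemma conj_minor_sum_expand:
  assumes A: "finite A" and g: "g permutes A" and h: "h permutes A" and S: "S \<subseteq> A"
  shows "conj_minor_sum A g h S = conj_minor_sum A g id S * principal_minor h S
    + (\<Sum>(s, t)\<in>S \<times> (A - S). conj_minor_sum A g (transpose s t) S * principal_minor (transpose s t \<circ> h) S)"
proof -
  have fS: "finite S" using A S finite_subset by blast
  have inj: "inj h" using h permutes_inj by blast
  have ch: "card (h ` S) = card S" by (simp add: card_image inj_on_subset[OF inj])
  have supp: "h ` S = insert t (S - {s})"
    if "s \<in> S" "t \<notin> S" "principal_minor (transpose s t \<circ> h) S \<noteq> 0" for s t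
  proof -
    have "transpose s t ` (h ` S) = S"
      using that(3) by (auto simp: principal_minor_def image_comp split: if_splits)
    then have "h ` S = transpose s t ` S" by (metis image_comp transpose_comp_involutory image_id id_apply)
    then show ?thesis using image_transpose_exchange[OF that(1,2)] by simp
  qed
  consider (eq) "h ` S = S" | (one) s t where "s \<in> S" "t \<in> A - S" "h ` S = insert t (S - {s})"
    | (two) t1 t2 where "t1 \<in> h ` S - S" "t2 \<in> h ` S - S" "t1 \<noteq> t2"
  proof (cases "h ` S = S")
    case False
    have "\<not> h ` S \<subseteq> S" using False ch fS by (metis card_subset_eq)
    then obtain t where t: "t \<in> h ` S" "t \<notin> S" by blast
    have tA: "t \<in> A" using t S permutes_in_image[OF h] by auto
    show ?thesis
    proof (cases "h ` S - S = {t}")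
      case True
      have "card (S - h ` S) = card (h ` S - S)"
        using ch fS by (metis card_Diff_subset_Int finite_Int finite_imageI inf_commute)
      then obtain s where s: "S - h ` S = {s}" using True by (metis card_1_singletonE card.empty card_insert_disjoint finite.emptyI empty_iff One_nat_def)
      have "h ` S = insert t (S - {s})" using s True by blast
      then show ?thesis using one s t tA by blast
    next
      case False
      then show ?thesis using two t by blast
    qed
  qed
  then show ?thesis
  proof cases
    case eq
    have z: "principal_minor (transpose s t \<circ> h) S = 0" if "s \<in> S" "t \<notin> S" for s t
      using supp[OF that] eq that by auto
    have "(\<Sum>(s, t)\<in>S \<times> (A - S). conj_minor_sum A g (transpose s t) S * principal_minor (transpose s t \<circ> h) S) = 0"
      by (rule sum.neutral) (auto simp: z)
    moreover have "conj_minor_sum A g h S = conj_minor_sum A g id S * principal_minor h S"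
      using conj_minor_sum_compose[of S g A id h] fS g eq by (simp add: permutes_id)
    ultimately show ?thesis by simp
  next
    case (one s t)
    have z: "principal_minor (transpose s' t' \<circ> h) S = 0"
      if "s' \<in> S" "t' \<notin> S" "(s', t') \<noteq> (s, t)" for s' t'
    proof (rule ccontr)
      assume "principal_minor (transpose s' t' \<circ> h) S \<noteq> 0"
      from supp[OF that(1,2) this] have eq: "insert t (S - {s}) = insert t' (S - {s'})" using one by simp
      have "t = t'" using eq that(1,2) one(1,2) by (metis Diff_iff insert_iff)
      moreover have "s \<notin> insert t' (S - {s'})" unfolding eq[symmetric] using one(1,2) by auto
      then have "s = s'" using one(1) by simp
      ultimately have "t = t'" "s = s'" by auto
      then show False using that(3) by simp
    qed
    have "(\<Sum>(s, t)\<in>S \<times> (A - S). conj_minor_sum A g (transpose s t) S * principal_minor (transpose s t \<circ> h) S)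
        = conj_minor_sum A g (transpose s t) S * principal_minor (transpose s t \<circ> h) S"
    proof (subst sum.remove[of _ "(s, t)"])
      have "(\<Sum>(s, t)\<in>S \<times> (A - S) - {(s, t)}. conj_minor_sum A g (transpose s t) S * principal_minor (transpose s t \<circ> h) S) = 0"
        by (rule sum.neutral) (use z in fastforce)
      then show "(case (s, t) of (s, t) \<Rightarrow> conj_minor_sum A g (transpose s t) S * principal_minor (transpose s t \<circ> h) S) +
        (\<Sum>(s, t)\<in>S \<times> (A - S) - {(s, t)}. conj_minor_sum A g (transpose s t) S * principal_minor (transpose s t \<circ> h) S)
        = conj_minor_sum A g (transpose s t) S * principal_minor (transpose s t \<circ> h) S" by simp
    qed (use one fS A in auto)
    moreover have "h ` S \<noteq> S" using one by auto
    then have "principal_minor h S = 0" by (simp add: principal_minor_def)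
    moreover have "conj_minor_sum A g h S = conj_minor_sum A g (transpose s t) S * principal_minor (transpose s t \<circ> h) S"
    proof -
      have "transpose s t ` h ` S = S"
        using one image_transpose_exchange[of s S t] by (metis DiffD2 image_comp transpose_comp_involutory image_id id_apply)
      then have im: "(transpose s t \<circ> h) ` S = S" by (simp only: image_comp)
      \<comment> \<open>The swap is an involution, so \<open>h\<close> is the swap after a map that
        preserves \<open>S\<close>, and that map can be split off.\<close>
      have "conj_minor_sum A g (transpose s t \<circ> (transpose s t \<circ> h)) S
          = conj_minor_sum A g (transpose s t) S * principal_minor (transpose s t \<circ> h) S"
        by (rule conj_minor_sum_compose[OF fS g permutes_swap_id im]) (use one S in auto)
      then show ?thesis by (simp add: o_assoc)
    qed
    ultimately show ?thesis by simp
  next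
    case (two t1 t2)
    have z: "principal_minor (transpose s t \<circ> h) S = 0" if "s \<in> S" "t \<notin> S" for s t
    proof (rule ccontr)
      assume "principal_minor (transpose s t \<circ> h) S \<noteq> 0"
      then have "h ` S - S \<subseteq> {t}" using supp[OF that] by auto
      then show False using two by (metis singletonD subsetD)
    qed
    have "(\<Sum>(s, t)\<in>S \<times> (A - S). conj_minor_sum A g (transpose s t) S * principal_minor (transpose s t \<circ> h) S) = 0"
      by (rule sum.neutral) (auto simp: z)
    moreover have "h ` S \<noteq> S" using two by auto
    then have "principal_minor h S = 0" by (simp add: principal_minor_def)
    ultimately show ?thesis using conj_minor_sum_eq_0[OF A g h S two] by simp
  qed
qed

text \<open>All k-subsets give the same value, and their total is the sum of \<open>ext_char\<close>
  over all conjugates of \<open>g\<close>.\<close>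

lemma conj_minor_sum_id:
  assumes A: "finite A" and g: "g permutes A" and S: "S \<in> subsets A k"
  shows "int (card A choose k) * conj_minor_sum A g id S = fact (card A) * ext_char A k g"
proof -
  have eq: "conj_minor_sum A g id T = conj_minor_sum A g id S" if T: "T \<in> subsets A k" for T
  proof -
    obtain q where q: "q permutes A" "q ` S = T" using exists_permutes_image[OF A S T] by blast
    have "q \<circ> id \<circ> inv q = id" using permutes_inv_o[OF q(1)] by simp
    then show ?thesis
      using conj_minor_sum_image[OF A q(1) g permutes_id, of S] S q by (simp add: subsets_def)
  qed
  have "int (card A choose k) * conj_minor_sum A g id S = (\<Sum>T\<in>subsets A k. conj_minor_sum A g id T)"
    using eq by (simp add: card_subsets A)
  also have "\<dots> = (\<Sum>p | p permutes A. ext_char A k (inv p \<circ> g \<circ> p))"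
    unfolding conj_minor_sum_def ext_char_def by (subst sum.swap) simp
  also have "\<dots> = fact (card A) * ext_char A k g"
    using ext_char_conj[OF A _ g] by (simp add: card_permutations[OF refl A])
  finally show ?thesis .
qed

text \<open>The Koszul relation writes this sum through class functions.\<close>

lemma exchange_char_conj:
  assumes A: "finite A" and p: "p permutes A" and g: "g permutes A"
  shows "exchange_char A k (inv p \<circ> g \<circ> p) = exchange_char A k g"
proof (cases k)
  case (Suc j)
  have "inv p \<circ> g \<circ> p permutes A" using p g by (intro permutes_compose permutes_inv) auto
  then show ?thesis
    unfolding Suc by (simp only: exchange_char_Suc[OF A] g hook_char_conj[OF assms] ext_char_conj[OF assms])
qed (simp add: A exchange_char_0)

text \<open>The argument of \<open>conj_minor_sum_id\<close> with exchanges in place of subsets. The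
  transposition here stands to the right of the conjugate, whence the appeal to
  \<open>exchange_char_commute\<close>.\<close>

lemma conj_minor_sum_transpose:
  assumes A: "finite A" and g: "g permutes A" and S: "(S, s, t) \<in> exchanges A k"
  shows "int (card (exchanges A k)) * conj_minor_sum A g (transpose s t) S
    = fact (card A) * exchange_char A k g"
proof -
  have eq: "conj_minor_sum A g (transpose s' t') S' = conj_minor_sum A g (transpose s t) S"
    if S': "(S', s', t') \<in> exchanges A k" for S' s' t'
  proof -
    obtain q where q: "q permutes A" "q ` S = S'" "q s = s'" "q t = t'"
      using exists_permutes_exchange[OF A S S'] by blast
    have "q \<circ> transpose s t \<circ> inv q = transpose s' t'"
      using permutes_inverses[OF q(1)] q(3,4) permutes_bij[OF q(1)]
      by (auto simp: fun_eq_iff transpose_def)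
    moreover have "transpose s t permutes A" "S \<subseteq> A"
      using S by (auto simp: exchanges_def subsets_def intro!: permutes_swap_id)
    ultimately show ?thesis
      using conj_minor_sum_image[OF A q(1) g, of "transpose s t" S] q by simp
  qed
  have "int (card (exchanges A k)) * conj_minor_sum A g (transpose s t) S
      = (\<Sum>(S', s', t')\<in>exchanges A k. conj_minor_sum A g (transpose s t) S)" by simp
  also have "\<dots> = (\<Sum>(S', s', t')\<in>exchanges A k. conj_minor_sum A g (transpose s' t') S')"
    by (rule sum.cong) (use eq in auto)
  also have "\<dots> = (\<Sum>p | p permutes A. \<Sum>(S', s', t')\<in>exchanges A k.
      principal_minor (inv p \<circ> g \<circ> p \<circ> transpose s' t') S')"
    unfolding conj_minor_sum_def case_prod_unfold by (rule sum.swap)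
  also have "\<dots> = (\<Sum>p | p permutes A. exchange_char A k g)"
  proof (rule sum.cong, rule refl)
    fix p assume "p \<in> {p. p permutes A}"
    then have p: "p permutes A" by simp
    have "inv p \<circ> g \<circ> p permutes A" using p g by (intro permutes_compose permutes_inv) auto
    then show "(\<Sum>(S', s', t')\<in>exchanges A k. principal_minor (inv p \<circ> g \<circ> p \<circ> transpose s' t') S')
      = exchange_char A k g"
      using exchange_char_commute[OF A] exchange_char_conj[OF A p g] by metis
  qed
  also have "\<dots> = fact (card A) * exchange_char A k g"
    by (simp add: card_permutations[OF refl A])
  finally show ?thesis .
qed

text \<open>The factor \<open>card (exchanges A k)\<close> clears the denominators of both kinds of
  entries. It is \<open>k * (card A - k)\<close> times the number of k-subsets, which explains the
  weight of the first product.\<close>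

lemma sum_ext_char_conj:
  assumes A: "finite A" and g: "g permutes A" and h: "h permutes A" and k: "k \<noteq> 0" "k < card A"
  shows "int (card (exchanges A k)) * (\<Sum>p | p permutes A. ext_char A k (inv p \<circ> g \<circ> p \<circ> h))
    = fact (card A) * (int (k * (card A - k)) * ext_char A k g * ext_char A k h
        + exchange_char A k g * exchange_char A k h)"
proof -
  let ?E = "int (card (exchanges A k))"
  have E: "?E = int (k * (card A - k)) * int (card A choose k)"
    by (simp add: card_exchanges A)
  have "(\<Sum>p | p permutes A. ext_char A k (inv p \<circ> g \<circ> p \<circ> h)) = (\<Sum>S\<in>subsets A k. conj_minor_sum A g h S)"
    unfolding conj_minor_sum_def ext_char_def by (rule sum.swap)
  also have "\<dots> = (\<Sum>S\<in>subsets A k. conj_minor_sum A g id S * principal_minor h S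
    + (\<Sum>(s, t)\<in>S \<times> (A - S). conj_minor_sum A g (transpose s t) S * principal_minor (transpose s t \<circ> h) S))"
    by (rule sum.cong, rule refl, rule conj_minor_sum_expand) (auto simp: A g h subsets_def)
  also have "\<dots> = (\<Sum>S\<in>subsets A k. conj_minor_sum A g id S * principal_minor h S)
    + (\<Sum>(S, s, t)\<in>exchanges A k. conj_minor_sum A g (transpose s t) S * principal_minor (transpose s t \<circ> h) S)"
    unfolding exchanges_def sum.distrib using A
    by (subst sum.Sigma[symmetric]) (auto intro: subsets_finite simp: case_prod_unfold)
  finally have "?E * (\<Sum>p | p permutes A. ext_char A k (inv p \<circ> g \<circ> p \<circ> h))
    = (\<Sum>S\<in>subsets A k. ?E * conj_minor_sum A g id S * principal_minor h S)
    + (\<Sum>(S, s, t)\<in>exchanges A k. ?E * conj_minor_sum A g (transpose s t) S * principal_minor (transpose s t \<circ> h) S)"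
    by (simp add: distrib_left sum_distrib_left case_prod_unfold mult.assoc)
  also have "(\<Sum>S\<in>subsets A k. ?E * conj_minor_sum A g id S * principal_minor h S)
    = (\<Sum>S\<in>subsets A k. int (k * (card A - k)) * (fact (card A) * ext_char A k g) * principal_minor h S)"
  proof (rule sum.cong, rule refl)
    fix S assume "S \<in> subsets A k"
    from conj_minor_sum_id[OF A g this]
    have "?E * conj_minor_sum A g id S = int (k * (card A - k)) * (fact (card A) * ext_char A k g)"
      unfolding E by (metis mult.assoc)
    then show "?E * conj_minor_sum A g id S * principal_minor h S
      = int (k * (card A - k)) * (fact (card A) * ext_char A k g) * principal_minor h S" by simp
  qed
  also have "\<dots> = fact (card A) * (int (k * (card A - k)) * ext_char A k g * ext_char A k h)"
    unfolding sum_distrib_left[symmetric] ext_char_def[of A k h, symmetric] by (simp only: ac_simps)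
  also have "(\<Sum>(S, s, t)\<in>exchanges A k. ?E * conj_minor_sum A g (transpose s t) S * principal_minor (transpose s t \<circ> h) S)
    = (\<Sum>(S, s, t)\<in>exchanges A k. fact (card A) * exchange_char A k g * principal_minor (transpose s t \<circ> h) S)"
    by (rule sum.cong) (auto simp: conj_minor_sum_transpose[OF A g])
  also have "\<dots> = fact (card A) * (exchange_char A k g * exchange_char A k h)"
    unfolding exchange_char_def[of A k h] by (simp add: sum_distrib_left case_prod_unfold mult.assoc)
  finally show ?thesis by (simp only: distrib_left)
qed

text \<open>The exterior power of degree k + 1 consists of the hooks of degrees k + 1 and k. Its
  averaged trace is a form in their characters without mixed terms, and the induction hypothesis
  removes the part of degree k.\<close>

lemma sum_hook_char_conj:
  assumes A: "finite A" "A \<noteq> {}" and g: "g permutes A" and h: "h permutes A" and k: "k < card A"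
  shows "(\<Sum>p | p permutes A. rat_of_int (hook_char A k (inv p \<circ> g \<circ> p \<circ> h)))
    = fact (card A) * of_int (hook_char A k g) * of_int (hook_char A k h) / of_nat (card A - 1 choose k)"
  using k
proof (induction k)
  case 0
  show ?case by (simp add: A card_permutations[OF refl A(1)])
next
  case (Suc k)
  define n where "n = card A"
  define m where "m = n - Suc k"
  have nm: "n = Suc k + m" and m: "m > 0" using Suc.prems by (auto simp: n_def m_def)
  define p p' q q' :: rat where "p = of_int (hook_char A (Suc k) g)"
    and "p' = of_int (hook_char A (Suc k) h)" and "q = of_int (hook_char A k g)"
    and "q' = of_int (hook_char A k h)"
  define K :: rat where "K = of_nat (Suc k)"
  define M :: rat where "M = of_nat m"
  define N :: rat where "N = of_nat n"
  have N: "N = K + M" by (simp add: N_def K_def M_def nm)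
  have pos: "K > 0" "M > 0" "N > 0" using m by (auto simp: K_def M_def N_def nm)
  define c c1 c0 :: rat where "c = of_nat (n choose Suc k)" and "c1 = of_nat (n - 1 choose Suc k)"
    and "c0 = of_nat (n - 1 choose k)"
  have c0: "c * K = N * c0"
  proof -
    have "Suc k * (n choose Suc k) = n * (n - 1 choose k)"
      using Suc_times_binomial[of k "k + m"] by (simp add: nm)
    then show ?thesis unfolding c_def K_def N_def c0_def by (metis mult.commute of_nat_mult)
  qed
  have c1: "c * M = N * c1"
  proof -
    have "c = c0 + c1" using m by (cases m) (auto simp: c_def c0_def c1_def nm)
    then show ?thesis using c0 N by (simp add: algebra_simps)
  qed
  have cpos: "c > 0" "c0 > 0" "c1 > 0"
    using m by (auto simp: c_def c0_def c1_def nm simp del: binomial_Suc_Suc)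
  define \<Phi> where "\<Phi> = (\<Sum>r | r permutes A. rat_of_int (ext_char A (Suc k) (inv r \<circ> g \<circ> r \<circ> h)))"
  have ext: "rat_of_int (ext_char A (Suc k) g) = p + q" "rat_of_int (ext_char A (Suc k) h) = p' + q'"
    unfolding p_def q_def p'_def q'_def hook_char_Suc by simp_all
  have exc: "rat_of_int (exchange_char A (Suc k) g) = N * q - K * (p + q)"
      "rat_of_int (exchange_char A (Suc k) h) = N * q' - K * (p' + q')"
    unfolding exchange_char_Suc[OF A(1) g] exchange_char_Suc[OF A(1) h] ext[symmetric]
    by (simp_all add: N_def K_def n_def q_def q'_def)
  have E: "rat_of_int (int (card (exchanges A (Suc k)))) = c * (K * M)"
    by (simp add: card_exchanges A n_def[symmetric] c_def K_def M_def m_def distrib_right)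
  have KM: "rat_of_int (int (Suc k * (card A - Suc k))) = K * M"
    unfolding K_def M_def m_def n_def by (simp only: of_int_of_nat_eq of_nat_mult of_int_mult)
  have "rat_of_int (int (card (exchanges A (Suc k))) * (\<Sum>r | r permutes A. ext_char A (Suc k) (inv r \<circ> g \<circ> r \<circ> h)))
    = rat_of_int (fact (card A) * (int (Suc k * (card A - Suc k)) * ext_char A (Suc k) g * ext_char A (Suc k) h
        + exchange_char A (Suc k) g * exchange_char A (Suc k) h))"
    using sum_ext_char_conj[OF A(1) g h _ Suc.prems] by simp
  then have "c * (K * M) * \<Phi> = fact n * (K * M * (p + q) * (p' + q') + (N * q - K * (p + q)) * (N * q' - K * (p' + q')))"
    unfolding of_int_mult of_int_add of_int_sum E KM ext exc of_int_fact
    by (simp only: \<Phi>_def n_def)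
  \<comment> \<open>As \<open>N = K + M\<close>, the exchange characters are
    \<open>M * q - K * p\<close> and \<open>M * q' - K * p'\<close>, and the mixed products
    cancel.\<close>
  also have "\<dots> = fact n * N * (K * (p * p') + M * (q * q'))" unfolding N by algebra
  finally have "\<Phi> = fact n * N * (K * (p * p') + M * (q * q')) / (c * (K * M))"
    using cpos pos by (simp add: field_simps)
  also have "\<dots> = fact n * (p * p') * (N / (c * M)) + fact n * (q * q') * (N / (c * K))"
    using cpos pos by (simp add: field_simps)
  also have "\<dots> = fact n * p * p' / c1 + fact n * q * q' / c0"
    unfolding c0 c1 using pos by simp
  finally have \<Phi>: "\<Phi> = fact n * p * p' / c1 + fact n * q * q' / c0" .
  have "(\<Sum>r | r permutes A. rat_of_int (hook_char A (Suc k) (inv r \<circ> g \<circ> r \<circ> h)))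
    = \<Phi> - (\<Sum>r | r permutes A. rat_of_int (hook_char A k (inv r \<circ> g \<circ> r \<circ> h)))"
    unfolding hook_char_Suc of_int_diff \<Phi>_def sum_subtractf ..
  also have "\<dots> = fact n * p * p' / c1"
    unfolding \<Phi> using Suc.IH Suc.prems by (simp add: n_def q_def q'_def c0_def o_def)
  finally show ?case by (simp add: n_def p_def p'_def c1_def o_def)
qed

section \<open>Long cycles\<close>

lemma sign_cycle_of_list:
  "distinct cs \<Longrightarrow> cs \<noteq> [] \<Longrightarrow> sign (cycle_of_list cs) = (-1) ^ (length cs - 1)"
proof (induction cs rule: cycle_of_list.induct)
  case (1 i j cs)
  have "sign (transpose i j \<circ> cycle_of_list (j # cs)) = - sign (cycle_of_list (j # cs))"
    using 1 by (subst sign_compose) (auto simp: permutation_swap_id permutation_of_cycle sign_swap_id)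
  with 1 show ?case by (simp add: o_def)
qed auto

lemma orbit_eq_set_support: "permutation g \<Longrightarrow> orbit g x = set (support g x)"
  unfolding support_set orbit_altdef_permutation by auto

lemma card_orbit_eq_least_power: "permutation g \<Longrightarrow> card (orbit g x) = least_power g x"
  using distinct_card[OF cycle_of_permutation, of g x] by (simp add: orbit_eq_set_support)

lemma image_orbit: "permutation g \<Longrightarrow> g ` orbit g x = orbit g x"
proof (rule endo_inj_surj)
  assume g: "permutation g"
  show "finite (orbit g x)" using g by (simp add: orbit_eq_set_support)
  show "g ` orbit g x \<subseteq> orbit g x" by (auto intro: orbit.step)
  show "inj_on g (orbit g x)" using g by (meson permutation bij_is_inj inj_on_subset subset_UNIV)
qed

lemma principal_minor_orbit:
  assumes "permutation g"
  shows "principal_minor g (orbit g x) = (-1) ^ (card (orbit g x) - 1)"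
proof -
  let ?cs = "support g x"
  have "restrict_id g (orbit g x) = cycle_of_list ?cs"
  proof
    fix y
    show "restrict_id g (orbit g x) y = cycle_of_list ?cs y"
      using cycle_restrict[OF assms, of y x] id_outside_supp[of y ?cs]
      unfolding orbit_eq_set_support[OF assms] restrict_id_def by presburger
  qed
  then have "sign_on (orbit g x) g = (-1) ^ (length ?cs - 1)"
    unfolding sign_on_def
    using sign_cycle_of_list[OF cycle_of_permutation[OF assms], of x] least_power_of_permutation(2)[OF assms, of x]
    by simp
  then show ?thesis
    using image_orbit[OF assms] card_orbit_eq_least_power[OF assms] by (simp add: principal_minor_def)
qed

text \<open>An invariant subset contains or avoids the orbit \<open>C\<close>; all other subsets
  have minor 0. Adjoining \<open>C\<close> multiplies the minor by the sign of a cycle of length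
  \<open>card C\<close>, and the power of -1 by the parity of \<open>card C\<close>: in total by -1.
  Two weights \<open>a\<close> are used later, the cardinality and the constant 1.\<close>

lemma sum_minors_split_orbit:
  fixes a :: "'a set \<Rightarrow> int"
  assumes g: "permutation g" and B: "finite B" "g ` B = B" and x: "x \<in> B"
  defines "C \<equiv> orbit g x"
  shows "(\<Sum>S\<in>Pow B. a S * ((-1) ^ card S * principal_minor g S))
    = (\<Sum>S\<in>Pow (B - C). (a S - a (S \<union> C)) * ((-1) ^ card S * principal_minor g S))"
proof -
  have inj: "inj g" using g by (simp add: permutation bij_is_inj)
  have gC: "g ` C = C" unfolding C_def by (rule image_orbit[OF g])
  have CB: "C \<subseteq> B"
  proof
    fix y assume "y \<in> C"
    then show "y \<in> B" unfolding C_def by (induction rule: orbit.induct) (use B x in auto)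
  qed
  have fC: "finite C" using CB B finite_subset by blast
  have xC: "x \<in> C" unfolding C_def using g by (rule permutation_self_in_orbit)
  let ?F = "\<lambda>S. a S * ((-1) ^ card S * principal_minor g S)"
  have inter: "S \<inter> C = {} \<or> C \<subseteq> S" if "g ` S = S" for S
  proof (rule disjCI)
    assume "\<not> C \<subseteq> S"
    then obtain y where y: "y \<in> C" "y \<notin> S" by blast
    have Cy: "C = orbit g y" using y unfolding C_def
      using cyclic_on_orbit'[OF g, of x] by (metis cyclic_on_alldef)
    have step: "g z \<notin> S" if "z \<notin> S" for z
      using that \<open>g ` S = S\<close> inj by (metis inj_image_mem_iff)
    have "z \<notin> S" if "z \<in> orbit g y" for z
      using that by (induction rule: orbit.induct) (use y step in auto)
    then show "S \<inter> C = {}" using Cy by blast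
  qed
  have "(\<Sum>S\<in>Pow B. ?F S) = (\<Sum>S\<in>Pow (B - C) \<union> (\<lambda>S. S \<union> C) ` Pow (B - C). ?F S)"
  proof (rule sum.mono_neutral_right)
    show "\<forall>S\<in>Pow B - (Pow (B - C) \<union> (\<lambda>S. S \<union> C) ` Pow (B - C)). ?F S = 0"
    proof
      fix S assume S: "S \<in> Pow B - (Pow (B - C) \<union> (\<lambda>S. S \<union> C) ` Pow (B - C))"
      have "g ` S \<noteq> S"
      proof
        assume "g ` S = S"
        from inter[OF this] show False
        proof
          assume "C \<subseteq> S"
          then have "S = (S - C) \<union> C" by blast
          then show False using S by blast
        qed (use S in blast)
      qed
      then show "?F S = 0" by (simp add: principal_minor_def)
    qed
  qed (use B CB in auto)
  also have "\<dots> = (\<Sum>S\<in>Pow (B - C). ?F S) + (\<Sum>S\<in>(\<lambda>S. S \<union> C) ` Pow (B - C). ?F S)"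
    by (rule sum.union_disjoint) (use B xC in auto)
  also have "(\<Sum>S\<in>(\<lambda>S. S \<union> C) ` Pow (B - C). ?F S) = (\<Sum>S\<in>Pow (B - C). ?F (S \<union> C))"
    by (subst sum.reindex) (auto simp: inj_on_def)
  also have "\<dots> = (\<Sum>S\<in>Pow (B - C). - (a (S \<union> C) * ((-1) ^ card S * principal_minor g S)))"
  proof (rule sum.cong, rule refl)
    fix S assume S: "S \<in> Pow (B - C)"
    then have fS: "finite S" and disj: "S \<inter> C = {}" using B finite_subset by (blast, blast)
    obtain c where c: "card C = Suc c" using fC xC by (metis card_gt_0_iff empty_iff gr0_implies_Suc)
    have cd: "card (S \<union> C) = card S + Suc c" using card_Un_disjoint[OF fS fC disj] c by simp
    have "(-1) ^ card (S \<union> C) * principal_minor g (S \<union> C) = - ((-1) ^ card S * principal_minor g S)"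
    proof (cases "g ` S = S")
      case True
      have "principal_minor g (S \<union> C) = principal_minor g S * (-1) ^ c"
        using principal_minor_Un[OF fS fC disj True gC] principal_minor_orbit[OF g, of x] c
        by (simp add: C_def)
      then show ?thesis unfolding cd by (simp add: power_add)
    next
      case False
      have "g ` (S \<union> C) \<noteq> S \<union> C"
      proof
        assume "g ` (S \<union> C) = S \<union> C"
        then have "g ` S \<union> C = S \<union> C" using gC by (simp add: image_Un)
        moreover have "g ` S \<inter> C = {}" using gC disj inj by (metis image_Int image_empty)
        ultimately have "g ` S = S" using disj by blast
        then show False using False by simp
      qed
      then show ?thesis using False by (simp add: principal_minor_def)
    qed
    then show "?F (S \<union> C) = - (a (S \<union> C) * ((-1) ^ card S * principal_minor g S))" by simp
  qed
  also have "(\<Sum>S\<in>Pow (B - C). ?F S) + (\<Sum>S\<in>Pow (B - C). - (a (S \<union> C) * ((-1) ^ card S * principal_minor g S)))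
    = (\<Sum>S\<in>Pow (B - C). (a S - a (S \<union> C)) * ((-1) ^ card S * principal_minor g S))"
    by (simp add: sum.distrib[symmetric] left_diff_distrib)
  finally show ?thesis .
qed

text \<open>The sum is the derivative at t = 1 of det(1 - t g), the product of 1 - t^l over the
  cycle lengths l. Each cycle contributes a zero at 1, so only a single cycle leaves a nonzero
  value. Accordingly, splitting off one orbit makes the weight constant, and a second orbit cancels
  everything.\<close>

lemma sum_card_minors:
  assumes A: "finite A" "A \<noteq> {}" and g: "g permutes A"
  shows "(\<Sum>S\<in>Pow A. int (card S) * ((-1) ^ card S * principal_minor g S))
    = (if cyclic_on g A then - int (card A) else 0)"
proof -
  have pg: "permutation g" using A g permutes_imp_permutation by blast
  have inj: "inj g" using g permutes_inj by blast
  obtain x where x: "x \<in> A" using A by blast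
  define C where "C = orbit g x"
  have CA: "C \<subseteq> A" unfolding C_def by (rule permutes_orbit_subset[OF g x])
  have gC: "g ` C = C" unfolding C_def by (rule image_orbit[OF pg])
  have gA: "g ` A = A" using g by (rule permutes_image)
  have fC: "finite C" using CA A finite_subset by blast
  have "(\<Sum>S\<in>Pow A. int (card S) * ((-1) ^ card S * principal_minor g S))
      = (\<Sum>S\<in>Pow (A - C). (int (card S) - int (card (S \<union> C))) * ((-1) ^ card S * principal_minor g S))"
    unfolding C_def by (rule sum_minors_split_orbit[OF pg A(1) gA x])
  also have "\<dots> = (\<Sum>S\<in>Pow (A - C). - int (card C) * ((-1) ^ card S * principal_minor g S))"
  proof (rule sum.cong, rule refl)
    fix S assume "S \<in> Pow (A - C)"
    then have "finite S" "S \<inter> C = {}" using A finite_subset by (blast, blast)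
    then have "card (S \<union> C) = card S + card C" using fC by (simp add: card_Un_disjoint)
    then show "(int (card S) - int (card (S \<union> C))) * ((-1) ^ card S * principal_minor g S)
      = - int (card C) * ((-1) ^ card S * principal_minor g S)" by simp
  qed
  also have "\<dots> = - int (card C) * (\<Sum>S\<in>Pow (A - C). (-1) ^ card S * principal_minor g S)"
    by (simp add: sum_distrib_left sum_negf)
  finally have eq: "(\<Sum>S\<in>Pow A. int (card S) * ((-1) ^ card S * principal_minor g S))
    = - int (card C) * (\<Sum>S\<in>Pow (A - C). (-1) ^ card S * principal_minor g S)" .
  show ?thesis
  proof (cases "cyclic_on g A")
    case True
    then have "C = A" unfolding C_def using x by (metis cyclic_on_alldef)
    then show ?thesis using True eq by simp
  next
    case False
    then have "C \<noteq> A" unfolding C_def using x cyclic_on_def by metis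
    then obtain y where y: "y \<in> A - C" using CA by blast
    have gB: "g ` (A - C) = A - C" using gA gC inj by (metis image_set_diff)
    have "(\<Sum>S\<in>Pow (A - C). 1 * ((-1) ^ card S * principal_minor g S)) = 0"
      using sum_minors_split_orbit[OF pg _ gB y, of "\<lambda>_. 1"] A by simp
    then show ?thesis using False eq by simp
  qed
qed

lemma alternating_sum_hook_char:
  assumes A: "finite A" "A \<noteq> {}" and g: "g permutes A"
  shows "(\<Sum>k<card A. (-1) ^ k * hook_char A k g) = (if cyclic_on g A then int (card A) else 0)"
proof -
  \<comment> \<open>Summation by parts; at \<open>m = card A\<close> the boundary term vanishes by
    \<open>hook_char_card\<close>.\<close>
  have part: "(\<Sum>k\<le>m. (-1) ^ Suc k * int k * ext_char A k g)
      = (\<Sum>k<m. (-1) ^ k * hook_char A k g) + (-1) ^ Suc m * int m * hook_char A m g" for m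
  proof (induction m)
    case (Suc m)
    have "ext_char A (Suc m) g = hook_char A (Suc m) g + hook_char A m g" by (simp add: hook_char_Suc)
    then show ?case using Suc by (simp add: algebra_simps)
  qed simp
  have "(\<Sum>k<card A. (-1) ^ k * hook_char A k g) = (\<Sum>k\<le>card A. (-1) ^ Suc k * int k * ext_char A k g)"
    using part[of "card A"] hook_char_card[OF assms] by simp
  also have "\<dots> = (\<Sum>k\<le>card A. \<Sum>S | S \<in> Pow A \<and> card S = k. - (int (card S) * ((-1) ^ card S * principal_minor g S)))"
    unfolding ext_char_def subsets_def sum_distrib_left by (intro sum.cong) auto
  also have "\<dots> = (\<Sum>S\<in>Pow A. - (int (card S) * ((-1) ^ card S * principal_minor g S)))"
    by (rule sum.group) (use A in \<open>auto intro: card_mono\<close>)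
  also have "\<dots> = (if cyclic_on g A then int (card A) else 0)"
    unfolding sum_negf sum_card_minors[OF assms] by simp
  finally show ?thesis .
qed

section \<open>Permutations conjugating a long cycle into a given permutation\<close>

lemma conjugate_funpow:
  assumes "\<And>x. g (p x) = p (c x)"
  shows "(g ^^ i) (p x) = p ((c ^^ i) x)"
  by (induction i) (simp_all add: assms)

lemma cyclic_eq_cycle_of_list:
  assumes A: "finite A" and c: "c permutes A" "cyclic_on c A" and x: "x \<in> A"
  shows "c = cycle_of_list (support c x)" "set (support c x) = A" "length (support c x) = card A"
    "hd (support c x) = x" "support c x \<noteq> []"
proof -
  have pc: "permutation c" using A c permutes_imp_permutation by blast
  have orb: "orbit c x = A" using c(2) x by (metis cyclic_on_alldef)
  show s: "set (support c x) = A" using orbit_eq_set_support[OF pc, of x] orb by simp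
  show "length (support c x) = card A" using card_orbit_eq_least_power[OF pc, of x] orb by simp
  show "c = cycle_of_list (support c x)"
  proof
    fix y show "c y = cycle_of_list (support c x) y"
      using cycle_restrict[OF pc, of y x] id_outside_supp[of y "support c x"] s permutes_not_in[OF c(1), of y]
      by metis
  qed
  show "hd (support c x) = x" "support c x \<noteq> []"
    using least_power_of_permutation(2)[OF pc, of x] by (simp_all add: hd_map)
qed

lemma exists_permutes_map:
  assumes "distinct xs" "distinct ys" "set xs = A" "set ys = A"
  obtains p where "p permutes A" "map p xs = ys"
proof -
  define p where "p a = (if a \<in> A then the (map_of (zip xs ys) a) else a)" for a
  have len: "length xs = length ys" using assms distinct_card by metis
  have m: "map p xs = ys"
    by (rule nth_equalityI) (use assms len in \<open>auto simp: p_def map_of_zip_nth nth_mem\<close>)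
  have "p ` A = A" using m assms by (metis set_map)
  then have "bij_betw p A A" using assms(3) by (intro bij_betw_self) auto
  then have "p permutes A" by (rule bij_imp_permutes) (simp add: p_def)
  with m show ?thesis using that by blast
qed

text \<open>A conjugator carries the iterates of \<open>c\<close> at \<open>x\<close> to the
  iterates of \<open>g\<close> at its image, so the image of \<open>x\<close> determines it. If
  \<open>g\<close> is a single cycle, every point of \<open>A\<close> occurs as that image.\<close>

lemma card_conjugators:
  assumes A: "finite A" and c: "c permutes A" "cyclic_on c A" and g: "g permutes A"
  shows "card {p. p permutes A \<and> p \<circ> c \<circ> inv p = g} = (if cyclic_on g A then card A else 0)"
proof -
  obtain x where x: "x \<in> A" using c(2) unfolding cyclic_on_def by blast
  have pc: "permutation c" "permutation g" using A c g permutes_imp_permutation by (blast, blast)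
  have orbA: "A = {(c ^^ i) x | i. True}"
    using c(2) x pc orbit_altdef_permutation by (metis cyclic_on_alldef)
  have comm: "g (p y) = p (c y)" if "p permutes A" "p \<circ> c \<circ> inv p = g" for p y
    using that permutes_inverses[OF that(1)] by auto
  have cyc: "cyclic_on g A" if p: "p permutes A" "p \<circ> c \<circ> inv p = g" for p
  proof -
    have "orbit g (p x) = {(g ^^ i) (p x) | i. True}"
      using orbit_altdef_permutation[OF pc(2)] by simp
    also have "\<dots> = p ` A"
      using conjugate_funpow[of g p c, OF comm[OF p]] orbA by (auto simp: image_iff)
    finally have "orbit g (p x) = A" using permutes_image[OF p(1)] by simp
    then show ?thesis unfolding cyclic_on_def using permutes_in_image[OF p(1)] x by metis
  qed
  show ?thesis
  proof (cases "cyclic_on g A")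
    case True
    have "bij_betw (\<lambda>p. p x) {p. p permutes A \<and> p \<circ> c \<circ> inv p = g} A"
      unfolding bij_betw_def
    proof
      show "inj_on (\<lambda>p. p x) {p. p permutes A \<and> p \<circ> c \<circ> inv p = g}"
      proof (rule inj_onI, rule ext)
        fix p q y assume p: "p \<in> {p. p permutes A \<and> p \<circ> c \<circ> inv p = g}"
          and q: "q \<in> {p. p permutes A \<and> p \<circ> c \<circ> inv p = g}" and e: "p x = q x"
        show "p y = q y"
        proof (cases "y \<in> A")
          case True
          then obtain i where i: "y = (c ^^ i) x" using orbA by blast
          have "p y = (g ^^ i) (p x)" "q y = (g ^^ i) (q x)"
            unfolding i using conjugate_funpow[of g p c] conjugate_funpow[of g q c] comm p q by auto
          then show ?thesis using e by simp
        next
          case False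
          moreover have "p permutes A" "q permutes A" using p q by auto
          ultimately show ?thesis using permutes_not_in[of p A y] permutes_not_in[of q A y] by simp
        qed
      qed
      show "(\<lambda>p. p x) ` {p. p permutes A \<and> p \<circ> c \<circ> inv p = g} = A"
      proof
        show "A \<subseteq> (\<lambda>p. p x) ` {p. p permutes A \<and> p \<circ> c \<circ> inv p = g}"
        proof
          fix y assume y: "y \<in> A"
          note C = cyclic_eq_cycle_of_list[OF A c x] and G = cyclic_eq_cycle_of_list[OF A g True y]
          obtain p where p: "p permutes A" "map p (support c x) = support g y"
            using exists_permutes_map[OF cycle_of_permutation[OF pc(1)] cycle_of_permutation[OF pc(2)] C(2) G(2)] by blast
          have "p \<circ> c \<circ> inv p = cycle_of_list (map p (support c x))"
            using conjugation_of_cycle[OF cycle_of_permutation[OF pc(1)] permutes_bij[OF p(1)], of x] C(1) by simp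
          also have "\<dots> = g" using p(2) G(1) by simp
          finally have "p \<circ> c \<circ> inv p = g" .
          moreover have "p x = y" using p(2) C(4,5) G(4) by (metis hd_map)
          ultimately show "y \<in> (\<lambda>p. p x) ` {p. p permutes A \<and> p \<circ> c \<circ> inv p = g}" using p(1) by blast
        qed
      qed (use x in \<open>auto simp: permutes_in_image\<close>)
    qed
    then show ?thesis using True bij_betw_same_card by fastforce
  next
    case False
    then have "{p. p permutes A \<and> p \<circ> c \<circ> inv p = g} = {}" using cyc by blast
    then show ?thesis using False by (simp only: card.empty if_False)
  qed
qed

section \<open>Young subgroups and coloured permutations\<close>

text \<open>The blocks of this Young subgroup are the fibres of \<open>f\<close>; membership of
  \<open>p\<close> also says that \<open>f\<close> is constant on the cycles of
  \<open>p\<close>.\<close>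

definition young :: "'a set \<Rightarrow> ('a \<Rightarrow> 'c) \<Rightarrow> ('a \<Rightarrow> 'a) set" where
  "young A f = {p. p permutes A \<and> (\<forall>x\<in>A. f (p x) = f x)}"

lemma finite_young [simp]: "finite A \<Longrightarrow> finite (young A f)"
  unfolding young_def by (rule finite_subset[OF _ finite_permutations]) auto

lemma young_compose: "p \<in> young A f \<Longrightarrow> q \<in> young A f \<Longrightarrow> p \<circ> q \<in> young A f"
  by (auto simp: young_def permutes_compose permutes_in_image)

lemma young_inv: "p \<in> young A f \<Longrightarrow> inv p \<in> young A f"
proof -
  assume "p \<in> young A f"
  then have p: "p permutes A" and f: "\<And>x. x \<in> A \<Longrightarrow> f (p x) = f x" by (auto simp: young_def)
  have "f (inv p x) = f x" if "x \<in> A" for x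
    using f[of "inv p x"] that permutes_in_image[OF permutes_inv[OF p]] permutes_inverses(1)[OF p] by simp
  then show ?thesis using permutes_inv[OF p] by (simp add: young_def)
qed

lemma young_swap: "a \<in> A \<Longrightarrow> b \<in> A \<Longrightarrow> f a = f b \<Longrightarrow> transpose a b \<in> young A f"
  by (auto simp: young_def permutes_swap_id transpose_def)

lemma sum_young_compose_left:
  assumes "q \<in> young A f"
  shows "(\<Sum>p\<in>young A f. F (q \<circ> p)) = (\<Sum>p\<in>young A f. F p)"
proof (rule sum.reindex_bij_witness[of _ "\<lambda>p. inv q \<circ> p" "\<lambda>p. q \<circ> p"])
  have q: "q permutes A" using assms by (simp add: young_def)
  fix p assume "p \<in> young A f"
  then show "inv q \<circ> (q \<circ> p) = p" "q \<circ> (inv q \<circ> p) = p"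
    "q \<circ> p \<in> young A f" "inv q \<circ> p \<in> young A f"
    using assms permutes_inv_o[OF q] by (simp_all add: o_assoc young_compose young_inv)
qed simp

text \<open>Two points of \<open>S\<close> of one colour can be swapped within the subgroup; left
  multiplication by the swap permutes the summands and flips their signs.\<close>

lemma sum_young_minor_noninj:
  assumes A: "finite A" and S: "S \<subseteq> A" and ninj: "\<not> inj_on f S"
  shows "(\<Sum>p\<in>young A f. principal_minor p S) = 0"
proof -
  obtain a b where ab: "a \<in> S" "b \<in> S" "a \<noteq> b" "f a = f b" using ninj by (auto simp: inj_on_def)
  have fS: "finite S" using A S finite_subset by blast
  have "(\<Sum>p\<in>young A f. principal_minor p S) = (\<Sum>p\<in>young A f. principal_minor (transpose a b \<circ> p) S)"
    by (rule sum_young_compose_left[symmetric], rule young_swap) (use ab S in auto)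
  also have "\<dots> = - (\<Sum>p\<in>young A f. principal_minor p S)"
    by (simp add: principal_minor_transpose_compose[OF fS ab(1-3)] sum_negf)
  finally show ?thesis by simp
qed

text \<open>Colours separate the points of \<open>S\<close>, so a colour-preserving map of
  \<open>S\<close> to itself fixes \<open>S\<close> pointwise.\<close>

lemma principal_minor_young:
  assumes "S \<subseteq> A" "inj_on f S" "p \<in> young A f"
  shows "principal_minor p S = (if p ` S = S then 1 else 0)"
proof (cases "p ` S = S")
  case True
  have "p x = id x" if "x \<in> S" for x
  proof -
    have "p x \<in> S" "f (p x) = f x" using True that assms by (auto simp: young_def)
    then show ?thesis using that assms(2) by (simp add: inj_on_eq_iff)
  qed
  then have "principal_minor p S = principal_minor id S" by (rule principal_minor_cong)
  then show ?thesis using True by simp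
qed (simp add: principal_minor_def)

lemma young_transitive:
  assumes S: "S \<subseteq> A" "inj_on f S" and T: "T \<subseteq> A" "inj_on f T" and eq: "f ` S = f ` T"
  obtains p where "p \<in> young A f" "p ` S = T"
proof -
  define u where "u = inv_into S f"
  define v where "v = inv_into T f"
  have u: "u (f x) = x" if "x \<in> S" for x using that S by (simp add: u_def)
  have v: "v (f x) = x" if "x \<in> T" for x using that T by (simp add: v_def)
  have uS: "u (f x) \<in> S" "f (u (f x)) = f x" if "x \<in> T" for x
    using that eq inv_into_into[of "f x" f S] f_inv_into_f[of "f x" f S] by (auto simp: u_def)
  have vT: "v (f x) \<in> T" "f (v (f x)) = f x" if "x \<in> S" for x
    using that eq inv_into_into[of "f x" f T] f_inv_into_f[of "f x" f T] by (auto simp: v_def)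
  \<comment> \<open>The involution that exchanges each point of \<open>S\<close> with the point of
    \<open>T\<close> of the same colour; common points stay fixed.\<close>
  define p where "p x = (if x \<in> S then v (f x) else if x \<in> T then u (f x) else x)" for x
  have inv: "p (p x) = x" for x
  proof -
    consider "x \<in> S" "x \<in> T" | "x \<in> S" "x \<notin> T" | "x \<notin> S" "x \<in> T" | "x \<notin> S" "x \<notin> T" by blast
    then show ?thesis
    proof cases
      case 1
      then show ?thesis by (simp add: p_def v)
    next
      case 2
      have "v (f x) \<notin> S" using 2 vT[of x] S(2) by (metis inj_on_eq_iff)
      then show ?thesis using 2 vT[of x] u[of x] by (simp add: p_def)
    next
      case 3
      then show ?thesis using uS[of x] v[of x] by (simp add: p_def)
    qed (simp add: p_def)
  qed
  have out: "p x = x" if "x \<notin> A" for x using that S T by (auto simp: p_def)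
  have "p permutes A" unfolding permutes_def using inv out by metis
  moreover have "f (p x) = f x" for x by (auto simp: p_def uS vT)
  ultimately have "p \<in> young A f" by (simp add: young_def)
  moreover have "p ` S = T"
  proof
    show "p ` S \<subseteq> T" by (auto simp: p_def vT)
    show "T \<subseteq> p ` S"
    proof
      fix x assume x: "x \<in> T"
      then have "p (u (f x)) = x" using uS[OF x] v by (simp add: p_def)
      then show "x \<in> p ` S" using uS[OF x] by force
    qed
  qed
  ultimately show ?thesis using that by blast
qed

text \<open>As many permutations preserve a transversal \<open>S\<close> as carry a fixed
  transversal \<open>S0\<close> to \<open>S\<close>. Each element of the subgroup carries
  \<open>S0\<close> to exactly one transversal with colour set \<open>K\<close>, so the counts add
  up to the order of the subgroup.\<close>

lemma sum_young_minor_transversals: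
  assumes A: "finite A" and K: "K \<subseteq> f ` A"
  shows "(\<Sum>S | S \<subseteq> A \<and> inj_on f S \<and> f ` S = K. \<Sum>p\<in>young A f. principal_minor p S) = int (card (young A f))"
proof -
  let ?Tr = "{S. S \<subseteq> A \<and> inj_on f S \<and> f ` S = K}"
  obtain S0 where S0: "S0 \<subseteq> A" "inj_on f S0" "f ` S0 = K" using K by (metis subset_image_inj)
  have fTr: "finite ?Tr" using A by (intro finite_subset[of ?Tr "Pow A"]) auto
  have "(\<Sum>S\<in>?Tr. \<Sum>p\<in>young A f. principal_minor p S) = (\<Sum>S\<in>?Tr. \<Sum>p | p \<in> young A f \<and> p ` S0 = S. 1)"
  proof (rule sum.cong, rule refl)
    fix S assume S: "S \<in> ?Tr"
    obtain q where q: "q \<in> young A f" "q ` S0 = S" using young_transitive[of S0 A f S] S S0 by auto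
    have qp: "q permutes A" using q by (simp add: young_def)
    have "(\<Sum>p\<in>young A f. principal_minor p S) = (\<Sum>p\<in>young A f. if p ` S = S then 1 else 0)"
      by (rule sum.cong) (use S principal_minor_young[of S A f] in auto)
    also have "\<dots> = (\<Sum>p | p \<in> young A f \<and> p ` S = S. 1)"
      using A by (simp add: sum.inter_filter[symmetric])
    also have "\<dots> = (\<Sum>p | p \<in> young A f \<and> p ` S0 = S. 1)"
    proof (rule sum.reindex_bij_witness[of _ "\<lambda>p. p \<circ> inv q" "\<lambda>p. p \<circ> q"])
      have iS: "inv q ` S = S0" using q permutes_inv_o[OF qp] by (metis image_comp image_id id_apply)
      fix p :: "'a \<Rightarrow> 'a"
      have "p \<circ> q \<circ> inv q = p" "p \<circ> inv q \<circ> q = p"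
        using permutes_inv_o[OF qp] by (simp_all add: o_assoc[symmetric])
      then show "p \<circ> q \<circ> inv q = p" "p \<circ> inv q \<circ> q = p" .
      show "p \<circ> q \<in> {p \<in> young A f. p ` S0 = S}" if "p \<in> {p \<in> young A f. p ` S = S}"
        using that q young_compose[of p A f q] image_comp[of p q S0] by simp
      show "p \<circ> inv q \<in> {p \<in> young A f. p ` S = S}" if "p \<in> {p \<in> young A f. p ` S0 = S}"
        using that q iS young_compose[of p A f "inv q"] young_inv[of q A f] image_comp[of p "inv q" S] by simp
    qed simp
    finally show "(\<Sum>p\<in>young A f. principal_minor p S) = (\<Sum>p | p \<in> young A f \<and> p ` S0 = S. 1)" .
  qed
  also have "\<dots> = (\<Sum>p\<in>young A f. 1)"
  proof (rule sum.group)
    show "(\<lambda>p. p ` S0) ` young A f \<subseteq> ?Tr"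
    proof clarify
      fix p assume p: "p \<in> young A f"
      have "p ` S0 \<subseteq> A" using p S0 by (auto simp: young_def permutes_in_image)
      moreover have "f (p x) = f x" if "x \<in> S0" for x using p S0 that by (auto simp: young_def)
      then have "f ` p ` S0 = K" "inj_on f (p ` S0)"
        using S0 by (auto simp: image_image inj_on_def)
      ultimately show "p ` S0 \<subseteq> A \<and> inj_on f (p ` S0) \<and> f ` p ` S0 = K" by simp
    qed
  qed (use A fTr in auto)
  finally show ?thesis by simp
qed

text \<open>Only sets with distinct colours contribute, and those with a given set of k colours
  contribute the order of the subgroup in total.\<close>

lemma sum_young_ext_char:
  assumes A: "finite A"
  shows "(\<Sum>p\<in>young A f. ext_char A k p) = int (card (young A f)) * int (card (f ` A) choose k)"
proof -
  have "(\<Sum>p\<in>young A f. ext_char A k p) = (\<Sum>S\<in>subsets A k. \<Sum>p\<in>young A f. principal_minor p S)"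
    unfolding ext_char_def by (rule sum.swap)
  also have "\<dots> = (\<Sum>S\<in>{S \<in> subsets A k. inj_on f S}. \<Sum>p\<in>young A f. principal_minor p S)"
    by (rule sum.mono_neutral_right) (use A sum_young_minor_noninj[OF A] in \<open>auto simp: subsets_def\<close>)
  also have "\<dots> = (\<Sum>K\<in>subsets (f ` A) k. \<Sum>S | S \<in> {S \<in> subsets A k. inj_on f S} \<and> f ` S = K.
      \<Sum>p\<in>young A f. principal_minor p S)"
    by (rule sum.group[symmetric]) (use A in \<open>auto simp: subsets_def card_image\<close>)
  also have "\<dots> = (\<Sum>K\<in>subsets (f ` A) k. int (card (young A f)))"
  proof (rule sum.cong, rule refl)
    fix K assume K: "K \<in> subsets (f ` A) k"
    then have "{S. S \<in> {S \<in> subsets A k. inj_on f S} \<and> f ` S = K} = {S. S \<subseteq> A \<and> inj_on f S \<and> f ` S = K}"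
      by (auto simp: subsets_def card_image)
    then show "(\<Sum>S | S \<in> {S \<in> subsets A k. inj_on f S} \<and> f ` S = K.
      \<Sum>p\<in>young A f. principal_minor p S) = int (card (young A f))"
      using sum_young_minor_transversals[OF A, of K f] K by (simp add: subsets_def)
  qed
  also have "\<dots> = int (card (young A f)) * int (card (f ` A) choose k)"
    using A by (simp add: card_subsets)
  finally show ?thesis .
qed

lemma sum_young_hook_char:
  assumes A: "finite A" "A \<noteq> {}"
  shows "(\<Sum>p\<in>young A f. hook_char A k p) = int (card (young A f)) * int (card (f ` A) - 1 choose k)"
proof (induction k)
  case 0
  show ?case by (simp add: A)
next
  case (Suc k)
  obtain l where l: "card (f ` A) = Suc l" using A by (metis card_eq_0_iff finite_imageI image_is_empty not0_implies_Suc)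
  have "(\<Sum>p\<in>young A f. hook_char A (Suc k) p)
      = (\<Sum>p\<in>young A f. ext_char A (Suc k) p) - (\<Sum>p\<in>young A f. hook_char A k p)"
    unfolding hook_char_Suc by (rule sum_subtractf)
  then show ?case unfolding sum_young_ext_char[OF A(1)] using Suc by (simp add: l algebra_simps)
qed

section \<open>Colourings with prescribed content\<close>

text \<open>Extensionality makes a colouring determined by its values on \<open>A\<close>, so that
  colourings can be counted.\<close>

definition colourings :: "'a set \<Rightarrow> 'c multiset \<Rightarrow> ('a \<Rightarrow> 'c) set" where
  "colourings A a = {f \<in> extensional A. image_mset f (mset_set A) = a}"

definition coloured_perms :: "'a set \<Rightarrow> 'c multiset \<Rightarrow> (('a \<Rightarrow> 'c) \<times> ('a \<Rightarrow> 'a)) set" where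
  "coloured_perms A a = (SIGMA f:colourings A a. young A f)"

lemma colourings_image: "finite A \<Longrightarrow> f \<in> colourings A a \<Longrightarrow> f ` A = set_mset a"
  by (auto simp: colourings_def)

lemma finite_colourings [simp]:
  assumes "finite A"
  shows "finite (colourings A a)"
proof (rule finite_subset)
  show "colourings A a \<subseteq> A \<rightarrow>\<^sub>E set_mset a"
    using colourings_image[OF assms] by (auto simp: colourings_def PiE_def)
  show "finite (A \<rightarrow>\<^sub>E set_mset a)" using assms by (intro finite_PiE) auto
qed

lemma finite_coloured_perms [simp]: "finite A \<Longrightarrow> finite (coloured_perms A a)"
  unfolding coloured_perms_def by (rule finite_SigmaI) auto

lemma colourings_compose:
  assumes "p permutes A" "f \<in> colourings A a"
  shows "f \<circ> p \<in> colourings A a"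
proof -
  have "f \<circ> p \<in> extensional A" using assms
    by (auto simp: colourings_def extensional_def permutes_not_in)
  moreover have "image_mset (f \<circ> p) (mset_set A) = image_mset f (mset_set A)"
    by (metis permutes_image_mset[OF assms(1)] image_mset.comp comp_apply)
  ultimately show ?thesis using assms by (simp add: colourings_def)
qed

lemma colourings_transitive:
  assumes "finite A" "f \<in> colourings A a" "f' \<in> colourings A a"
  obtains p where "p permutes A" "f = f' \<circ> p"
proof -
  have "image_mset f (mset_set A) = image_mset f' (mset_set A)" using assms by (simp add: colourings_def)
  from image_mset_eq_implies_permutes[OF assms(1) this]
  obtain p where p: "p permutes A" "\<forall>x\<in>A. f x = f' (p x)" by blast
  have "f = f' \<circ> p"
  proof (rule extensionalityI[of _ A])
    show "f \<in> extensional A" using assms by (simp add: colourings_def)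
    show "f' \<circ> p \<in> extensional A" using colourings_compose[OF p(1) assms(3)] by (simp add: colourings_def)
  qed (use p in auto)
  with p show ?thesis using that by blast
qed

lemma colourings_nonempty:
  assumes "finite A" "size a = card A"
  shows "colourings A a \<noteq> {}"
proof -
  obtain xs where xs: "mset xs = a" using ex_mset by blast
  obtain ys where ys: "set ys = A" "distinct ys" using finite_distinct_list[OF assms(1)] by blast
  have len: "length xs = length ys" using assms xs ys by (metis distinct_card size_mset)
  define f where "f = restrict (\<lambda>y. the (map_of (zip ys xs) y)) A"
  have "map f ys = xs"
    by (rule nth_equalityI) (use ys len in \<open>auto simp: f_def map_of_zip_nth\<close>)
  then have "image_mset f (mset_set A) = a"
    using xs ys by (metis mset_map mset_set_set)
  then have "f \<in> colourings A a" by (auto simp: colourings_def f_def)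
  then show ?thesis by blast
qed

text \<open>Fixing one colouring \<open>f\<^sub>0\<close> and writing each \<open>f\<close> as \<open>f\<^sub>0 \<circ> \<pi> f\<close>, the pairs \<open>(f, p)\<close> correspond
  to the permutations \<open>\<pi> f \<circ> p\<close>.\<close>
lemma card_coloured_perms:
  assumes A: "finite A" and a: "size a = card A"
  shows "card (coloured_perms A a) = fact (card A)"
proof -
  obtain f0 where f0: "f0 \<in> colourings A a" using colourings_nonempty[OF assms] by blast
  have "\<forall>f\<in>colourings A a. \<exists>p. p permutes A \<and> f = f0 \<circ> p"
    using colourings_transitive[OF A _ f0] by metis
  then obtain \<pi> where \<pi>: "\<And>f. f \<in> colourings A a \<Longrightarrow> \<pi> f permutes A \<and> f = f0 \<circ> \<pi> f"
    by metis
  have "bij_betw (\<lambda>(f, p). \<pi> f \<circ> p) (coloured_perms A a) {p. p permutes A}"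
  proof (rule bij_betw_byWitness[where f' = "\<lambda>r. (f0 \<circ> r, inv (\<pi> (f0 \<circ> r)) \<circ> r)"])
    \<comment> \<open>The product determines \<open>f\<close> because \<open>p\<close> preserves the
      colours of \<open>f\<close>; then it determines \<open>p\<close> as well.\<close>
    have key: "f0 \<circ> (\<pi> f \<circ> p) = f" if "f \<in> colourings A a" "p \<in> young A f" for f p
    proof -
      have "f0 \<circ> (\<pi> f \<circ> p) = f \<circ> p" using \<pi>[OF that(1)] by (metis o_assoc)
      also have "\<dots> = f"
      proof
        fix x show "(f \<circ> p) x = f x"
          using that by (cases "x \<in> A") (auto simp: young_def permutes_not_in)
      qed
      finally show ?thesis .
    qed
    show "\<forall>x\<in>coloured_perms A a. (\<lambda>r. (f0 \<circ> r, inv (\<pi> (f0 \<circ> r)) \<circ> r)) ((\<lambda>(f, p). \<pi> f \<circ> p) x) = x"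
    proof
      fix x assume x: "x \<in> coloured_perms A a"
      obtain f p where xfp: "x = (f, p)" by fastforce
      have fp: "f \<in> colourings A a" "p \<in> young A f" using x xfp by (auto simp: coloured_perms_def)
      have "inv (\<pi> f) \<circ> (\<pi> f \<circ> p) = p" using permutes_inv_o[of "\<pi> f" A] \<pi>[OF fp(1)] by (simp add: o_assoc)
      then show "(f0 \<circ> (case x of (f, p) \<Rightarrow> \<pi> f \<circ> p), inv (\<pi> (f0 \<circ> (case x of (f, p) \<Rightarrow> \<pi> f \<circ> p)))
          \<circ> (case x of (f, p) \<Rightarrow> \<pi> f \<circ> p)) = x"
        using key[OF fp] xfp by simp
    qed
    show "\<forall>r\<in>{p. p permutes A}. (\<lambda>(f, p). \<pi> f \<circ> p) ((\<lambda>r. (f0 \<circ> r, inv (\<pi> (f0 \<circ> r)) \<circ> r)) r) = r"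
    proof clarify
      fix r assume r: "r permutes A"
      have "\<pi> (f0 \<circ> r) permutes A" using \<pi> colourings_compose[OF r f0] by blast
      from permutes_inv_o(1)[OF this] show "\<pi> (f0 \<circ> r) \<circ> (inv (\<pi> (f0 \<circ> r)) \<circ> r) = r"
        by (simp add: o_assoc)
    qed
    show "(\<lambda>(f, p). \<pi> f \<circ> p) ` coloured_perms A a \<subseteq> {p. p permutes A}"
      using \<pi> by (auto simp: coloured_perms_def young_def intro: permutes_compose)
    show "(\<lambda>r. (f0 \<circ> r, inv (\<pi> (f0 \<circ> r)) \<circ> r)) ` {p. p permutes A} \<subseteq> coloured_perms A a"
    proof clarify
      fix r assume r: "r permutes A"
      let ?f = "f0 \<circ> r" and ?p = "inv (\<pi> (f0 \<circ> r)) \<circ> r"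
      have f: "?f \<in> colourings A a" by (rule colourings_compose[OF r f0])
      note P = \<pi>[OF f]
      have "?f (?p x) = ?f x" for x
      proof -
        have "?f (?p x) = f0 (\<pi> ?f (?p x))" using P by (metis comp_apply)
        also have "\<dots> = ?f x" using permutes_inverses(1)[of "\<pi> ?f" A] P by simp
        finally show ?thesis .
      qed
      moreover have "?p permutes A" using P r by (intro permutes_compose permutes_inv) auto
      ultimately show "(?f, ?p) \<in> coloured_perms A a" using f by (simp add: coloured_perms_def young_def)
    qed
  qed
  then show ?thesis using bij_betw_same_card card_permutations[OF refl A] by metis
qed

text \<open>The colouring is transported along with the permutation and keeps its content.\<close>

lemma sum_coloured_perms_conj:
  assumes A: "finite A" and s: "s permutes A"
  shows "(\<Sum>(f, p)\<in>coloured_perms A a. F (inv s \<circ> p \<circ> s)) = (\<Sum>(f, p)\<in>coloured_perms A a. F p)"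
proof (rule sum.reindex_bij_witness[of _ "\<lambda>(f, p). (f \<circ> inv s, s \<circ> p \<circ> inv s)" "\<lambda>(f, p). (f \<circ> s, inv s \<circ> p \<circ> s)"])
  have mem: "(f \<circ> s, inv s \<circ> p \<circ> s) \<in> coloured_perms A a"
    if "(f, p) \<in> coloured_perms A a" and s: "s permutes A" for f p s
  proof -
    have f: "f \<in> colourings A a" and p: "p permutes A" "\<And>x. x \<in> A \<Longrightarrow> f (p x) = f x"
      using that by (auto simp: coloured_perms_def young_def)
    have "inv s \<circ> p \<circ> s permutes A" using s p by (intro permutes_compose permutes_inv) auto
    moreover have "(f \<circ> s) ((inv s \<circ> p \<circ> s) x) = (f \<circ> s) x" if "x \<in> A" for x
      using p(2)[of "s x"] that permutes_in_image[OF s] permutes_inverses[OF s] by simp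
    ultimately show ?thesis
      using colourings_compose[OF s f] by (simp add: coloured_perms_def young_def)
  qed
  have si: "inv s permutes A" "inv (inv s) = s" using s by (simp_all add: permutes_inv permutes_inv_inv)
  fix x assume x: "x \<in> coloured_perms A a"
  obtain f p where fp: "x = (f, p)" by fastforce
  show "(case x of (f, p) \<Rightarrow> (f \<circ> s, inv s \<circ> p \<circ> s)) \<in> coloured_perms A a"
    using mem[OF _ s] x fp by simp
  show "(case x of (f, p) \<Rightarrow> (f \<circ> inv s, s \<circ> p \<circ> inv s)) \<in> coloured_perms A a"
    using mem[OF _ si(1)] si(2) x fp by simp
  show "(case case x of (f, p) \<Rightarrow> (f \<circ> s, inv s \<circ> p \<circ> s) of (f, p) \<Rightarrow> (f \<circ> inv s, s \<circ> p \<circ> inv s)) = x"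
    "(case case x of (f, p) \<Rightarrow> (f \<circ> inv s, s \<circ> p \<circ> inv s) of (f, p) \<Rightarrow> (f \<circ> s, inv s \<circ> p \<circ> s)) = x"
    using permutes_inverses[OF s] by (auto simp: fp fun_eq_iff)
  show "(case case x of (f, p) \<Rightarrow> (f \<circ> s, inv s \<circ> p \<circ> s) of (f, p) \<Rightarrow> F p) = (case x of (f, p) \<Rightarrow> F (inv s \<circ> p \<circ> s))"
    by (simp add: fp)
qed

text \<open>Coloured permutations are invariant under conjugation, so convolution with them
  multiplies the hook character by a scalar. \<open>sum_hook_char_conj\<close> reduces this scalar
  to a character sum over Young subgroups, and the number of coloured permutations is a factorial
  whatever the content.\<close>

lemma sum_coloured_perms_hook_char:
  assumes A: "finite A" "A \<noteq> {}" and a: "size a = card A" and h: "h permutes A" and k: "k < card A"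
  shows "(\<Sum>(f, p)\<in>coloured_perms A a. rat_of_int (hook_char A k (p \<circ> h)))
    = fact (card A) * of_nat (card (set_mset a) - 1 choose k) / of_nat (card A - 1 choose k)
        * of_int (hook_char A k h)"
proof -
  let ?c = "rat_of_nat (card A - 1 choose k)" and ?n = "fact (card A) :: rat"
  have pp: "p permutes A" if "(f, p) \<in> coloured_perms A a" for f p
    using that by (auto simp: coloured_perms_def young_def)
  have "?n * (\<Sum>(f, p)\<in>coloured_perms A a. rat_of_int (hook_char A k (p \<circ> h)))
      = (\<Sum>s | s permutes A. \<Sum>(f, p)\<in>coloured_perms A a. rat_of_int (hook_char A k (p \<circ> h)))"
    by (simp add: card_permutations[OF refl A(1)])
  also have "\<dots> = (\<Sum>s | s permutes A. \<Sum>(f, p)\<in>coloured_perms A a. rat_of_int (hook_char A k (inv s \<circ> p \<circ> s \<circ> h)))"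
    by (intro sum.cong refl sum_coloured_perms_conj[OF A(1), symmetric, of _ "\<lambda>p. rat_of_int (hook_char A k (p \<circ> h))"]) simp
  also have "\<dots> = (\<Sum>(f, p)\<in>coloured_perms A a. \<Sum>s | s permutes A. rat_of_int (hook_char A k (inv s \<circ> p \<circ> s \<circ> h)))"
    unfolding case_prod_unfold by (rule sum.swap)
  also have "\<dots> = (\<Sum>(f, p)\<in>coloured_perms A a. ?n / ?c * of_int (hook_char A k h) * rat_of_int (hook_char A k p))"
    by (intro sum.cong refl) (use pp sum_hook_char_conj[OF A _ h k] in \<open>auto simp: mult_ac\<close>)
  also have "\<dots> = ?n / ?c * of_int (hook_char A k h) * of_int (\<Sum>(f, p)\<in>coloured_perms A a. hook_char A k p)"
    unfolding of_int_sum sum_distrib_left by (intro sum.cong) auto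
  also have "(\<Sum>(f, p)\<in>coloured_perms A a. hook_char A k p) = (\<Sum>f\<in>colourings A a. \<Sum>p\<in>young A f. hook_char A k p)"
    unfolding coloured_perms_def using A by (subst sum.Sigma) auto
  also have "\<dots> = (\<Sum>f\<in>colourings A a. int (card (young A f)) * int (card (set_mset a) - 1 choose k))"
    by (intro sum.cong refl) (simp add: sum_young_hook_char[OF A] colourings_image[OF A(1)])
  also have "\<dots> = int (card (coloured_perms A a)) * int (card (set_mset a) - 1 choose k)"
    unfolding coloured_perms_def using A
    by (subst card_SigmaI) (auto simp: sum_distrib_right)
  finally have "?n * (\<Sum>(f, p)\<in>coloured_perms A a. rat_of_int (hook_char A k (p \<circ> h)))
    = ?n * (?n * of_nat (card (set_mset a) - 1 choose k) / ?c * of_int (hook_char A k h))"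
    unfolding card_coloured_perms[OF A(1) a] by (simp add: mult_ac o_def)
  then show ?thesis by (simp only: mult_cancel_left fact_nonzero simp_thms)
qed

section \<open>Counting coloured factorizations of a long cycle\<close>

definition coloured_factorizations ::
    "'a set \<Rightarrow> ('a \<Rightarrow> 'a) \<Rightarrow> 'c multiset \<Rightarrow> 'c multiset \<Rightarrow> 'c multiset \<Rightarrow> nat" where
  "coloured_factorizations A \<gamma> a b c =
    (\<Sum>(f, p)\<in>coloured_perms A a. \<Sum>(g, q)\<in>coloured_perms A b. \<Sum>(h, r)\<in>coloured_perms A c.
      if p \<circ> q \<circ> r = \<gamma> then 1 else 0)"

text \<open>Each of the three sums is invariant under conjugation separately, so the factors are
  conjugated one at a time, innermost sum first, until all three are conjugated by
  \<open>s\<close>.\<close>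

lemma coloured_factorizations_conj:
  assumes A: "finite A" and s: "s permutes A"
  shows "coloured_factorizations A (s \<circ> \<gamma> \<circ> inv s) a b c = coloured_factorizations A \<gamma> a b c"
proof -
  let ?C = "\<lambda>p. inv s \<circ> p \<circ> s"
  have e: "?C p \<circ> ?C q \<circ> ?C r = \<gamma> \<longleftrightarrow> p \<circ> q \<circ> r = s \<circ> \<gamma> \<circ> inv s" for p q r
  proof -
    have *: "?C p \<circ> ?C q \<circ> ?C r = inv s \<circ> (p \<circ> q \<circ> r) \<circ> s"
      using permutes_inverses[OF s] by (simp add: fun_eq_iff)
    show ?thesis
    proof
      assume "?C p \<circ> ?C q \<circ> ?C r = \<gamma>"
      then have "s \<circ> \<gamma> \<circ> inv s = s \<circ> (inv s \<circ> (p \<circ> q \<circ> r) \<circ> s) \<circ> inv s" using * by simp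
      also have "\<dots> = p \<circ> q \<circ> r" using permutes_inverses[OF s] by (simp add: fun_eq_iff)
      finally show "p \<circ> q \<circ> r = s \<circ> \<gamma> \<circ> inv s" by simp
    next
      assume "p \<circ> q \<circ> r = s \<circ> \<gamma> \<circ> inv s"
      then have "?C p \<circ> ?C q \<circ> ?C r = inv s \<circ> (s \<circ> \<gamma> \<circ> inv s) \<circ> s" using * by simp
      also have "\<dots> = \<gamma>" using permutes_inverses[OF s] by (simp add: fun_eq_iff)
      finally show "?C p \<circ> ?C q \<circ> ?C r = \<gamma>" .
    qed
  qed
  have "coloured_factorizations A \<gamma> a b c
    = (\<Sum>(f, p)\<in>coloured_perms A a. \<Sum>(g, q)\<in>coloured_perms A b. \<Sum>(h, r)\<in>coloured_perms A c.
        if p \<circ> q \<circ> ?C r = \<gamma> then 1 else 0)"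
    unfolding coloured_factorizations_def
    by (intro sum.cong refl) (auto simp: sum_coloured_perms_conj[OF assms, of "\<lambda>r. if _ \<circ> _ \<circ> r = \<gamma> then 1 else (0::nat)"])
  also have "\<dots> = (\<Sum>(f, p)\<in>coloured_perms A a. \<Sum>(g, q)\<in>coloured_perms A b. \<Sum>(h, r)\<in>coloured_perms A c.
        if p \<circ> ?C q \<circ> ?C r = \<gamma> then 1 else 0)"
    by (intro sum.cong refl) (auto simp: sum_coloured_perms_conj[OF assms, of
        "\<lambda>q. \<Sum>(h, r)\<in>coloured_perms A c. if _ \<circ> q \<circ> _ r = \<gamma> then 1 else (0::nat)"])
  also have "\<dots> = (\<Sum>(f, p)\<in>coloured_perms A a. \<Sum>(g, q)\<in>coloured_perms A b. \<Sum>(h, r)\<in>coloured_perms A c.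
        if ?C p \<circ> ?C q \<circ> ?C r = \<gamma> then 1 else 0)"
    by (rule sum_coloured_perms_conj[OF assms, of "\<lambda>p. \<Sum>(g, q)\<in>coloured_perms A b. \<Sum>(h, r)\<in>coloured_perms A c.
        if p \<circ> ?C q \<circ> ?C r = \<gamma> then 1 else (0::nat)", symmetric])
  also have "\<dots> = coloured_factorizations A (s \<circ> \<gamma> \<circ> inv s) a b c"
    unfolding coloured_factorizations_def e ..
  finally show ?thesis by simp
qed

lemma sum_rotate:
  "(\<Sum>s\<in>S. \<Sum>x\<in>A. \<Sum>y\<in>B. \<Sum>z\<in>C. F s x y z) = (\<Sum>x\<in>A. \<Sum>y\<in>B. \<Sum>z\<in>C. \<Sum>s\<in>S. F s x y z)"
proof -
  have "(\<Sum>s\<in>S. \<Sum>x\<in>A. \<Sum>y\<in>B. \<Sum>z\<in>C. F s x y z) = (\<Sum>x\<in>A. \<Sum>s\<in>S. \<Sum>y\<in>B. \<Sum>z\<in>C. F s x y z)"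
    by (rule sum.swap)
  also have "\<dots> = (\<Sum>x\<in>A. \<Sum>y\<in>B. \<Sum>s\<in>S. \<Sum>z\<in>C. F s x y z)"
    by (rule sum.cong[OF refl], rule sum.swap)
  also have "\<dots> = (\<Sum>x\<in>A. \<Sum>y\<in>B. \<Sum>z\<in>C. \<Sum>s\<in>S. F s x y z)"
    by (rule sum.cong[OF refl], rule sum.cong[OF refl], rule sum.swap)
  finally show ?thesis .
qed

lemma sum_reverse:
  "(\<Sum>x\<in>A. \<Sum>y\<in>B. \<Sum>z\<in>C. F x y z) = (\<Sum>z\<in>C. \<Sum>y\<in>B. \<Sum>x\<in>A. F x y z)"
proof -
  have "(\<Sum>x\<in>A. \<Sum>y\<in>B. \<Sum>z\<in>C. F x y z) = (\<Sum>y\<in>B. \<Sum>x\<in>A. \<Sum>z\<in>C. F x y z)"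
    by (rule sum.swap)
  also have "\<dots> = (\<Sum>y\<in>B. \<Sum>z\<in>C. \<Sum>x\<in>A. F x y z)"
    by (rule sum.cong[OF refl], rule sum.swap)
  also have "\<dots> = (\<Sum>z\<in>C. \<Sum>y\<in>B. \<Sum>x\<in>A. F x y z)" by (rule sum.swap)
  finally show ?thesis .
qed

text \<open>Summing over all conjugates of the cycle costs a factor \<open>fact n\<close> and turns
  the indicator into the number of conjugators, which \<open>alternating_sum_hook_char\<close>
  writes through hooks. The factors are then absorbed from the left by
  \<open>sum_coloured_perms_hook_char\<close>, down to the value of the hook at the
  identity.\<close>

lemma of_nat_coloured_factorizations:
  fixes a b c :: "'c multiset"
  assumes A: "finite A" and \<gamma>: "\<gamma> permutes A" "cyclic_on \<gamma> A"
    and sz: "size a = card A" "size b = card A" "size c = card A"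
  defines "n \<equiv> card A"
  shows "rat_of_nat (coloured_factorizations A \<gamma> a b c)
    = (fact n)\<^sup>2 * (\<Sum>k<n. (-1) ^ k * of_nat (card (set_mset a) - 1 choose k)
        * of_nat (card (set_mset b) - 1 choose k) * of_nat (card (set_mset c) - 1 choose k)
        / (of_nat (n - 1 choose k))\<^sup>2)"
proof -
  have ne: "A \<noteq> {}" using \<gamma>(2) by (auto simp: cyclic_on_def)
  let ?Qa = "coloured_perms A a" and ?Qb = "coloured_perms A b" and ?Qc = "coloured_perms A c"
  have perm: "p permutes A" if "(f, p) \<in> coloured_perms A d" for f p and d :: "'c multiset"
    using that by (auto simp: coloured_perms_def young_def)
  define u where "u d k = fact n * of_nat (card (set_mset d) - 1 choose k) / rat_of_nat (n - 1 choose k)"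
    for d :: "'c multiset" and k
  have S: "(\<Sum>(f, p)\<in>coloured_perms A d. rat_of_int (hook_char A k (p \<circ> h))) = u d k * of_int (hook_char A k h)"
    if "size d = card A" "h permutes A" "k < n" for d h k
    using sum_coloured_perms_hook_char[OF A ne that(1,2)] that(3) unfolding n_def u_def by simp
  have "fact n * rat_of_nat (coloured_factorizations A \<gamma> a b c)
      = (\<Sum>s | s permutes A. rat_of_nat (coloured_factorizations A (s \<circ> \<gamma> \<circ> inv s) a b c))"
    by (simp add: coloured_factorizations_conj[OF A] card_permutations[OF refl A] n_def)
  also have "\<dots> = (\<Sum>s | s permutes A. \<Sum>x\<in>?Qa. \<Sum>y\<in>?Qb. \<Sum>z\<in>?Qc.
      if s \<circ> \<gamma> \<circ> inv s = snd x \<circ> snd y \<circ> snd z then 1 else 0)"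
    unfolding coloured_factorizations_def case_prod_unfold of_nat_sum
    by (intro sum.cong refl) auto
  also have "\<dots> = (\<Sum>x\<in>?Qa. \<Sum>y\<in>?Qb. \<Sum>z\<in>?Qc. \<Sum>s | s permutes A.
      if s \<circ> \<gamma> \<circ> inv s = snd x \<circ> snd y \<circ> snd z then 1 else 0)"
    by (rule sum_rotate)
  also have "\<dots> = (\<Sum>x\<in>?Qa. \<Sum>y\<in>?Qb. \<Sum>z\<in>?Qc. \<Sum>k<n. (-1) ^ k * rat_of_int (hook_char A k (snd x \<circ> (snd y \<circ> snd z))))"
  proof (intro sum.cong refl)
    fix x y z assume "x \<in> ?Qa" "y \<in> ?Qb" "z \<in> ?Qc"
    then have p: "snd x \<circ> snd y \<circ> snd z permutes A"
      using perm by (metis permutes_compose prod.collapse)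
    have "(\<Sum>s | s permutes A. if s \<circ> \<gamma> \<circ> inv s = snd x \<circ> snd y \<circ> snd z then 1 else 0)
        = rat_of_nat (card {s. s permutes A \<and> s \<circ> \<gamma> \<circ> inv s = snd x \<circ> snd y \<circ> snd z})"
      using finite_permutations[OF A] by (simp add: sum.inter_filter[symmetric])
    also have "\<dots> = rat_of_int (\<Sum>k<n. (-1) ^ k * hook_char A k (snd x \<circ> snd y \<circ> snd z))"
      unfolding card_conjugators[OF A \<gamma> p] n_def alternating_sum_hook_char[OF A ne p] by simp
    also have "\<dots> = (\<Sum>k<n. (-1) ^ k * rat_of_int (hook_char A k (snd x \<circ> (snd y \<circ> snd z))))"
      by (simp add: o_assoc)
    finally show "(\<Sum>s | s permutes A. if s \<circ> \<gamma> \<circ> inv s = snd x \<circ> snd y \<circ> snd z then 1 else 0)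
        = (\<Sum>k<n. (-1) ^ k * rat_of_int (hook_char A k (snd x \<circ> (snd y \<circ> snd z))))" .
  qed
  \<comment> \<open>The sums are reversed because the leftmost factor, which is absorbed before the
    others, has to be summed innermost.\<close>
  also have "\<dots> = (\<Sum>k<n. (-1) ^ k * (\<Sum>z\<in>?Qc. \<Sum>y\<in>?Qb. \<Sum>x\<in>?Qa. rat_of_int (hook_char A k (snd x \<circ> (snd y \<circ> snd z)))))"
    unfolding sum_distrib_left
    by (rule trans[OF sum_rotate[symmetric]], rule sum.cong[OF refl], rule sum_reverse)
  also have "\<dots> = (\<Sum>k<n. (-1) ^ k * (u a k * u b k * u c k * of_nat (n - 1 choose k)))"
  proof (intro sum.cong refl)
    fix k assume "k \<in> {..<n}"
    then have k: "k < n" by simp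
    have "(\<Sum>z\<in>?Qc. \<Sum>y\<in>?Qb. \<Sum>x\<in>?Qa. rat_of_int (hook_char A k (snd x \<circ> (snd y \<circ> snd z))))
        = (\<Sum>z\<in>?Qc. \<Sum>y\<in>?Qb. u a k * of_int (hook_char A k (snd y \<circ> snd z)))"
    proof (intro sum.cong refl)
      fix z y assume "z \<in> ?Qc" "y \<in> ?Qb"
      then have "snd y \<circ> snd z permutes A" using perm by (metis permutes_compose prod.collapse)
      from S[OF sz(1) this k]
      show "(\<Sum>x\<in>?Qa. rat_of_int (hook_char A k (snd x \<circ> (snd y \<circ> snd z)))) = u a k * of_int (hook_char A k (snd y \<circ> snd z))"
        by (simp only: case_prod_unfold)
    qed
    also have "\<dots> = (\<Sum>z\<in>?Qc. u a k * (u b k * of_int (hook_char A k (snd z))))"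
    proof (rule sum.cong[OF refl])
      fix z assume "z \<in> ?Qc"
      then have "snd z permutes A" using perm by (metis prod.collapse)
      from S[OF sz(2) this k]
      show "(\<Sum>y\<in>?Qb. u a k * rat_of_int (hook_char A k (snd y \<circ> snd z))) = u a k * (u b k * of_int (hook_char A k (snd z)))"
        by (simp only: sum_distrib_left[symmetric] case_prod_unfold)
    qed
    also have "\<dots> = u a k * (u b k * (u c k * of_int (hook_char A k id)))"
      using S[OF sz(3) permutes_id k] by (simp add: sum_distrib_left[symmetric] case_prod_unfold)
    finally show "(-1) ^ k * (\<Sum>z\<in>?Qc. \<Sum>y\<in>?Qb. \<Sum>x\<in>?Qa. rat_of_int (hook_char A k (snd x \<circ> (snd y \<circ> snd z))))
        = (-1) ^ k * (u a k * u b k * u c k * of_nat (n - 1 choose k))"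
      unfolding hook_char_id[OF A ne] by (simp add: n_def mult.assoc)
  qed
  also have "\<dots> = fact n * ((fact n)\<^sup>2 * (\<Sum>k<n. (-1) ^ k * of_nat (card (set_mset a) - 1 choose k)
        * of_nat (card (set_mset b) - 1 choose k) * of_nat (card (set_mset c) - 1 choose k)
        / (of_nat (n - 1 choose k))\<^sup>2))"
    unfolding sum_distrib_left
  proof (intro sum.cong refl)
    fix k assume "k \<in> {..<n}"
    then have "rat_of_nat (n - 1 choose k) \<noteq> 0" by simp
    then show "(-1) ^ k * (u a k * u b k * u c k * of_nat (n - 1 choose k))
      = fact n * ((fact n)\<^sup>2 * ((-1) ^ k * of_nat (card (set_mset a) - 1 choose k)
        * of_nat (card (set_mset b) - 1 choose k) * of_nat (card (set_mset c) - 1 choose k)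
        / (of_nat (n - 1 choose k))\<^sup>2))"
      unfolding u_def by (simp add: field_simps power2_eq_square)
  qed
  finally show ?thesis by (simp only: mult_cancel_left fact_nonzero simp_thms)
qed

lemma long_cycle_permutes: "long_cycle n permutes {1..n}"
  using cycle_permutes[of "[1..<Suc n]"] by (simp add: long_cycle_def atLeastLessThanSuc_atLeastAtMost del: upt_Suc)

lemma cyclic_on_long_cycle:
  assumes "n > 0"
  shows "cyclic_on (long_cycle n) {1..n}"
proof -
  let ?cs = "[1..<Suc n]"
  have d: "distinct ?cs" "?cs \<noteq> []" using assms by auto
  have "y \<in> orbit (long_cycle n) 1" if "y \<in> {1..n}" for y
  proof -
    have "(long_cycle n ^^ (y - 1)) 1 = hd (map (long_cycle n ^^ (y - 1)) ?cs)"
      using d(2) by (simp add: hd_map hd_upt del: upt_Suc)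
    also have "\<dots> = hd (rotate (y - 1) ?cs)"
      using cyclic_rotation[OF d(1), of "y - 1"] by (simp add: long_cycle_def)
    also have "\<dots> = y" using that by (subst hd_rotate_conv_nth) (auto simp: nth_append split: if_splits)
    finally have e: "(long_cycle n ^^ (y - 1)) 1 = y" .
    have "permutation (long_cycle n)" unfolding long_cycle_def by (rule permutation_of_cycle)
    then have orb: "orbit (long_cycle n) 1 = {(long_cycle n ^^ k) 1 | k. True}"
      by (rule orbit_altdef_permutation)
    have "(long_cycle n ^^ (y - 1)) 1 \<in> {(long_cycle n ^^ k) 1 | k. True}" by (rule CollectI, rule exI[of _ "y - 1"], rule conjI[OF refl TrueI])
    then show ?thesis by (simp only: e orb)
  qed
  moreover have "orbit (long_cycle n) 1 \<subseteq> {1..n}"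
    using permutes_orbit_subset[OF long_cycle_permutes, of 1 n] assms by simp
  ultimately show ?thesis unfolding cyclic_on_def using assms by (intro bexI[of _ 1]) auto
qed

section \<open>Binomial identities for \<open>M_coeff\<close>\<close>

text \<open>Inclusion-exclusion for the \<open>c\<close>-subsets of an \<open>N\<close>-set that
  avoid \<open>g\<close> given points. The guard \<open>k \<le> c\<close> is essential: truncated
  subtraction would turn a negative lower index into 0 and the binomial into 1.\<close>

lemma binomial_inclusion_exclusion:
  "g \<le> N \<Longrightarrow> (\<Sum>k\<le>g. (-1) ^ k * int (g choose k) * (if k \<le> c then int (N - k choose (c - k)) else 0))
    = int (N - g choose c)"
proof (induction g arbitrary: N c)
  case (Suc g)
  then obtain M where N: "N = Suc M" by (cases N) auto
  have gM: "g \<le> M" using Suc.prems N by simp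
  define e where "e N c k = (if k \<le> c then int (N - k choose (c - k)) else 0)" for N c k :: nat
  have IH: "(\<Sum>k\<le>g. (-1) ^ k * int (g choose k) * e N c k) = int (N - g choose c)" if "g \<le> N" for N c
    using Suc.IH[OF that] by (simp add: e_def)
  \<comment> \<open>Pascal's rule separates the sum for \<open>g\<close> points from a shifted one.
    The latter is the instance for \<open>M\<close> and \<open>c - 1\<close> and counts the subsets
    that contain the extra point.\<close>
  have "(\<Sum>k\<le>Suc g. (-1) ^ k * int (Suc g choose k) * e N c k)
      = e N c 0 + (\<Sum>k\<le>g. (-1) ^ Suc k * int (g choose Suc k) * e N c (Suc k))
        - (\<Sum>k\<le>g. (-1) ^ k * int (g choose k) * e N c (Suc k))"
    by (subst sum.atMost_Suc_shift) (simp add: algebra_simps sum.distrib sum_negf sum_subtractf)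
  also have "e N c 0 + (\<Sum>k\<le>g. (-1) ^ Suc k * int (g choose Suc k) * e N c (Suc k))
      = (\<Sum>k\<le>Suc g. (-1) ^ k * int (g choose k) * e N c k)"
    by (subst sum.atMost_Suc_shift) simp
  also have "\<dots> = int (N - g choose c)" using IH[of N c] gM N by simp
  also have "(\<Sum>k\<le>g. (-1) ^ k * int (g choose k) * e N c (Suc k)) = (if c = 0 then 0 else int (M - g choose (c - 1)))"
  proof (cases c)
    case (Suc d)
    have "e N c (Suc k) = e M d k" for k by (simp add: e_def N Suc)
    then show ?thesis using IH[OF gM, of d] Suc by simp
  qed (simp add: e_def)
  also have "int (N - g choose c) - (if c = 0 then 0 else int (M - g choose (c - 1))) = int (N - Suc g choose c)"
    using gM by (cases c) (auto simp: N Suc_diff_le)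
  finally show ?case unfolding e_def .
qed simp

lemma of_nat_choose_mult:
  assumes "k \<le> m" "m \<le> n"
  shows "rat_of_nat (n - k choose (m - k)) = of_nat (n choose m) * of_nat (m choose k) / of_nat (n choose k)"
proof -
  have "rat_of_nat ((n choose m) * (m choose k)) = rat_of_nat ((n choose k) * (n - k choose (m - k)))"
    using choose_mult[OF assms] by simp
  moreover have "rat_of_nat (n choose k) \<noteq> 0" using assms by simp
  ultimately show ?thesis by (simp add: field_simps)
qed

text \<open>Here \<open>g\<close> and \<open>c\<close> enter in separate binomials, and the range of
  \<open>k\<close> is extended by zero terms so as not to depend on \<open>g\<close>. Both are
  needed to interchange the sums over \<open>g\<close> and \<open>k\<close>.\<close>

lemma choose_complement_expand:
  assumes "g \<le> N" "c \<le> N"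
  shows "rat_of_nat (N - g choose c)
    = of_nat (N choose c) * (\<Sum>k\<le>N. (-1) ^ k * of_nat (g choose k) * of_nat (c choose k) / of_nat (N choose k))"
proof -
  have "rat_of_nat (N - g choose c) = of_int (\<Sum>k\<le>g. (-1) ^ k * int (g choose k) * (if k \<le> c then int (N - k choose (c - k)) else 0))"
    unfolding binomial_inclusion_exclusion[OF assms(1)] by simp
  also have "\<dots> = (\<Sum>k\<le>g. (-1) ^ k * of_nat (g choose k) * (if k \<le> c then rat_of_nat (N - k choose (c - k)) else 0))"
    by (simp add: of_int_sum if_distrib cong: if_cong)
  also have "\<dots> = (\<Sum>k\<le>g. of_nat (N choose c) * ((-1) ^ k * of_nat (g choose k) * of_nat (c choose k) / of_nat (N choose k)))"
    by (intro sum.cong refl) (use assms of_nat_choose_mult[of _ c N] in \<open>auto simp: binomial_eq_0\<close>)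
  also have "\<dots> = (\<Sum>k\<le>N. of_nat (N choose c) * ((-1) ^ k * of_nat (g choose k) * of_nat (c choose k) / of_nat (N choose k)))"
    by (rule sum.mono_neutral_left) (use assms in \<open>auto simp: binomial_eq_0\<close>)
  finally show ?thesis by (simp add: sum_distrib_left)
qed

text \<open>With a fixed \<open>a\<close>-subset of an \<open>N\<close>-set, the sum counts
  \<open>b\<close>-subsets together with \<open>k\<close> points of the intersection, whose size is
  \<open>g\<close>. Choosing the \<open>k\<close> points before the subset leaves a Vandermonde
  convolution.\<close>

lemma sum_choose_choose:
  assumes "a \<le> N" "b \<le> N" "k \<le> N"
  shows "(\<Sum>g\<le>min a b. rat_of_nat (a choose g) * of_nat (g choose k) * of_nat (N - a choose (b - g)))
    = of_nat (N choose b) * of_nat (a choose k) * of_nat (b choose k) / of_nat (N choose k)"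
proof (cases "k \<le> a \<and> k \<le> b")
  case True
  have "(\<Sum>g\<le>min a b. (a choose g) * (g choose k) * (N - a choose (b - g)))
      = (\<Sum>g\<in>{k..min a b}. (a choose g) * (g choose k) * (N - a choose (b - g)))"
    by (rule sum.mono_neutral_right) (auto simp: binomial_eq_0)
  also have "\<dots> = (\<Sum>g\<in>{k..min a b}. (a choose k) * ((a - k choose (g - k)) * (N - a choose (b - g))))"
    by (intro sum.cong refl) (simp add: choose_mult mult.assoc[symmetric])
  also have "\<dots> = (\<Sum>g\<in>{k..b}. (a choose k) * ((a - k choose (g - k)) * (N - a choose (b - g))))"
    by (rule sum.mono_neutral_left) (use True in \<open>auto simp: binomial_eq_0 min_def\<close>)
  also have "\<dots> = (a choose k) * (\<Sum>j\<le>b - k. (a - k choose j) * (N - a choose (b - k - j)))"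
    unfolding sum_distrib_left
    by (rule sum.reindex_bij_witness[of _ "\<lambda>j. j + k" "\<lambda>g. g - k"]) (use True in auto)
  also have "\<dots> = (a choose k) * (N - k choose (b - k))"
    using vandermonde[of "a - k" "N - a" "b - k"] True assms by simp
  finally have "(\<Sum>g\<le>min a b. rat_of_nat (a choose g) * of_nat (g choose k) * of_nat (N - a choose (b - g)))
    = of_nat (a choose k) * of_nat (N - k choose (b - k))"
    by (simp only: of_nat_mult[symmetric] of_nat_sum[symmetric])
  then show ?thesis using of_nat_choose_mult[of k b N] True assms by simp
next
  case False
  have "(\<Sum>g\<le>min a b. rat_of_nat (a choose g) * of_nat (g choose k) * of_nat (N - a choose (b - g))) = 0"
    by (rule sum.neutral) (use False in \<open>auto simp: binomial_eq_0\<close>)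
  moreover have "rat_of_nat (a choose k) * of_nat (b choose k) = 0" using False by (auto simp: binomial_eq_0)
  ultimately show ?thesis by auto
qed

text \<open>The nonzero summand \<open>g\<close> counts the triples of subsets of a set of size \<open>N\<close>, of sizes
  \<open>a, b, c\<close> and with empty common intersection, whose first two members meet in \<open>g\<close> points.\<close>
lemma M_coeff_summand:
  assumes "a \<le> N" "b \<le> N" "c \<le> N" "g \<le> a"
  shows "(N choose c) * ((N - b choose (a - g)) * (N - c choose g) * (N - g choose (N - b)))
    = (if g \<le> b then (N choose a) * ((a choose g) * (N - a choose (b - g)) * (N - g choose c)) else 0)"
proof (cases "g \<le> b")
  case True
  \<comment> \<open>Both sides count pairs of disjoint subsets of sizes \<open>c\<close> and
    \<open>g\<close>.\<close>
  have 1: "(N choose c) * (N - c choose g) = (N choose g) * (N - g choose c)"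
  proof (cases "g + c \<le> N")
    case True
    then have "(N choose (g + c)) * ((g + c) choose g) = (N choose g) * (N - g choose c)"
      and "(N choose (g + c)) * ((g + c) choose c) = (N choose c) * (N - c choose g)"
      using choose_mult[of g "g + c" N] choose_mult[of c "g + c" N] by simp_all
    moreover have "(g + c) choose g = (g + c) choose c" using binomial_symmetric[of g "g + c"] by simp
    ultimately show ?thesis by simp
  qed (use assms in \<open>auto simp: binomial_eq_0\<close>)
  \<comment> \<open>Away from the \<open>g\<close> common points the two sets leave disjoint
    remainders of sizes \<open>a - g\<close> and \<open>b - g\<close>. The left side chooses the
    complement of the second set and the first remainder inside it; the right side chooses the two
    remainders in turn.\<close>
  have 2: "(N - b choose (a - g)) * (N - g choose (N - b)) = (N - g choose (a - g)) * (N - a choose (b - g))"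
  proof (cases "a - g \<le> N - b")
    case le: True
    have "(N - g choose (N - b)) * (N - b choose (a - g)) = (N - g choose (a - g)) * (N - g - (a - g) choose (N - b - (a - g)))"
      by (rule choose_mult) (use True le in auto)
    moreover have "N - g - (a - g) = N - a" using assms by simp
    moreover have "(N - a choose (N - b - (a - g))) = (N - a choose (b - g))"
    proof -
      have "N - b - (a - g) = N - a - (b - g)" "b - g \<le> N - a" using le True assms by auto
      then show ?thesis using binomial_symmetric[of "b - g" "N - a"] by simp
    qed
    ultimately show ?thesis by (simp add: mult.commute)
  qed (use assms True in \<open>auto simp: binomial_eq_0\<close>)
  have 3: "(N choose g) * (N - g choose (a - g)) = (N choose a) * (a choose g)"
    using choose_mult[of g a N] assms by simp
  have "(N choose c) * ((N - b choose (a - g)) * (N - c choose g) * (N - g choose (N - b)))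
      = ((N choose c) * (N - c choose g)) * ((N - b choose (a - g)) * (N - g choose (N - b)))" by (simp only: ac_simps)
  also have "\<dots> = ((N choose g) * (N - g choose (a - g))) * (N - a choose (b - g)) * (N - g choose c)"
    unfolding 1 2 by (simp only: ac_simps)
  finally show ?thesis using True unfolding 3 by (simp only: ac_simps if_True)
qed (use assms in \<open>auto simp: binomial_eq_0\<close>)

text \<open>In the form of \<open>M_coeff_summand\<close>, the third set is expanded by
  inclusion-exclusion, and \<open>sum_choose_choose\<close> evaluates the sum over \<open>g\<close>.
  The outcome is symmetric in \<open>a\<close>, \<open>b\<close> and \<open>c\<close>, which the
  definition of \<open>M_coeff\<close> hides.\<close>

lemma M_coeff_alternating_sum:
  assumes "1 \<le> a" "a \<le> n" "1 \<le> b" "b \<le> n" "1 \<le> c" "c \<le> n"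
  shows "rat_of_nat (M_coeff n a b c) / (of_nat (n - 1 choose (a - 1)) * of_nat (n - 1 choose (b - 1)) * of_nat (n - 1 choose (c - 1)))
    = (\<Sum>k<n. (-1) ^ k * of_nat (a - 1 choose k) * of_nat (b - 1 choose k) * of_nat (c - 1 choose k) / (of_nat (n - 1 choose k))\<^sup>2)"
proof -
  obtain N a' b' c' where eq: "n = Suc N" "a = Suc a'" "b = Suc b'" "c = Suc c'"
    using assms by (metis Suc_le_D One_nat_def Suc_le_D le_trans)
  have le: "a' \<le> N" "b' \<le> N" "c' \<le> N" using assms eq by auto
  have "M_coeff n a b c = (\<Sum>g\<in>{0..a'}. (N choose c') * ((N - b' choose (a' - g)) * (N - c' choose g) * (N - g choose (N - b'))))"
    unfolding M_coeff_def eq by (simp add: sum_distrib_left)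
  also have "\<dots> = (\<Sum>g\<in>{0..a'}. if g \<le> b' then (N choose a') * ((a' choose g) * (N - a' choose (b' - g)) * (N - g choose c')) else 0)"
    by (intro sum.cong refl M_coeff_summand le) simp
  also have "\<dots> = (\<Sum>g\<le>min a' b'. (N choose a') * ((a' choose g) * (N - a' choose (b' - g)) * (N - g choose c')))"
    by (subst sum.inter_filter[symmetric]) (auto intro!: sum.cong)
  finally have "rat_of_nat (M_coeff n a b c)
    = of_nat (N choose a') * (\<Sum>g\<le>min a' b'. of_nat (a' choose g) * of_nat (N - a' choose (b' - g)) * of_nat (N - g choose c'))"
    by (simp add: sum_distrib_left)
  also have "(\<Sum>g\<le>min a' b'. rat_of_nat (a' choose g) * of_nat (N - a' choose (b' - g)) * of_nat (N - g choose c'))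
    = (\<Sum>g\<le>min a' b'. \<Sum>k\<le>N. of_nat (N choose c') * ((-1) ^ k * of_nat (c' choose k) / of_nat (N choose k))
        * (of_nat (a' choose g) * of_nat (g choose k) * of_nat (N - a' choose (b' - g))))"
  proof (intro sum.cong refl)
    fix g assume "g \<in> {..min a' b'}"
    then have g: "g \<le> N" using le by auto
    show "rat_of_nat (a' choose g) * of_nat (N - a' choose (b' - g)) * of_nat (N - g choose c')
      = (\<Sum>k\<le>N. of_nat (N choose c') * ((-1) ^ k * of_nat (c' choose k) / of_nat (N choose k))
        * (of_nat (a' choose g) * of_nat (g choose k) * of_nat (N - a' choose (b' - g))))"
      unfolding choose_complement_expand[OF g le(3)] sum_distrib_left by (intro sum.cong refl) simp
  qed
  also have "\<dots> = (\<Sum>k\<le>N. of_nat (N choose c') * ((-1) ^ k * of_nat (c' choose k) / of_nat (N choose k))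
        * (of_nat (N choose b') * of_nat (a' choose k) * of_nat (b' choose k) / of_nat (N choose k)))"
    by (subst sum.swap, rule sum.cong[OF refl], unfold sum_distrib_left[symmetric],
        subst sum_choose_choose[OF le(1,2)]) auto
  also have "\<dots> = of_nat (N choose b') * of_nat (N choose c') * (\<Sum>k\<le>N. (-1) ^ k * of_nat (a' choose k) * of_nat (b' choose k) * of_nat (c' choose k) / (of_nat (N choose k))\<^sup>2)"
    unfolding sum_distrib_left by (intro sum.cong refl) (simp add: power2_eq_square)
  finally have "rat_of_nat (M_coeff n a b c) = of_nat (N choose a') * (of_nat (N choose b') * of_nat (N choose c')
    * (\<Sum>k\<le>N. (-1) ^ k * of_nat (a' choose k) * of_nat (b' choose k) * of_nat (c' choose k) / (of_nat (N choose k))\<^sup>2))" .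
  moreover have "rat_of_nat (N choose a') \<noteq> 0" "rat_of_nat (N choose b') \<noteq> 0" "rat_of_nat (N choose c') \<noteq> 0"
    using le by auto
  ultimately show ?thesis by (simp add: eq lessThan_Suc_atMost)
qed

section \<open>Coefficients of power sums and monomial symmetric functions\<close>

lemma mfps_coeff_times: "mfps_coeff (f * g) m = (\<Sum>(a, b) | a + b = m. mfps_coeff f a * mfps_coeff g b)"
  by (simp add: times_mfps.rep_eq)

lemma mfps_coeff_sum: "mfps_coeff (sum f A) m = (\<Sum>i\<in>A. mfps_coeff (f i) m)"
  by (induction A rule: infinite_finite_induct) (simp_all add: zero_mfps.rep_eq plus_mfps.rep_eq)

lemma mfps_coeff_const_times:
  fixes f :: "('v, 'a :: comm_ring_1) mfps"
  shows "mfps_coeff (mfps_const c * f) m = c * mfps_coeff f m"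
proof -
  have "mfps_coeff (mfps_const c * f) m = (\<Sum>(a, b)\<in>{({#} :: 'v multiset, m)}. mfps_coeff (mfps_const c) a * mfps_coeff f b)"
    unfolding mfps_coeff_times
    by (rule sum.mono_neutral_right) (auto simp: finite_mset_splits mfps_const.rep_eq split: if_splits)
  then show ?thesis by (simp add: mfps_const.rep_eq)
qed

definition mfps_vars :: "('v, 'a :: comm_ring_1) mfps \<Rightarrow> 'v set \<Rightarrow> bool" where
  "mfps_vars f U \<longleftrightarrow> (\<forall>m. mfps_coeff f m \<noteq> 0 \<longrightarrow> set_mset m \<subseteq> U)"

lemma mfps_vars_times: "mfps_vars f U \<Longrightarrow> mfps_vars g V \<Longrightarrow> mfps_vars (f * g) (U \<union> V)"
  unfolding mfps_vars_def
proof (intro allI impI)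
  fix m
  assume f: "\<forall>m. mfps_coeff f m \<noteq> 0 \<longrightarrow> set_mset m \<subseteq> U" and g: "\<forall>m. mfps_coeff g m \<noteq> 0 \<longrightarrow> set_mset m \<subseteq> V"
    and "mfps_coeff (f * g) m \<noteq> 0"
  then obtain x where x: "x \<in> {(a, b). a + b = m}" "(case x of (a, b) \<Rightarrow> mfps_coeff f a * mfps_coeff g b) \<noteq> 0"
    unfolding mfps_coeff_times using sum.not_neutral_contains_not_neutral by metis
  obtain a b where ab: "x = (a, b)" by fastforce
  have "mfps_coeff f a \<noteq> 0" "mfps_coeff g b \<noteq> 0" using x(2) ab by auto
  then have "set_mset a \<subseteq> U" "set_mset b \<subseteq> V" using f g by auto
  moreover have "m = a + b" using x(1) ab by simp
  ultimately show "set_mset m \<subseteq> U \<union> V" by auto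
qed

text \<open>A splitting of \<open>m\<close> contributes only if its parts use variables of
  \<open>U\<close> and of \<open>V\<close>; disjointness leaves exactly one.\<close>

lemma mfps_coeff_times_disjoint:
  assumes f: "mfps_vars f U" and g: "mfps_vars g V" and disj: "U \<inter> V = {}" and m: "set_mset m \<subseteq> U \<union> V"
  shows "mfps_coeff (f * g) m
    = mfps_coeff f (filter_mset (\<lambda>v. v \<in> U) m) * mfps_coeff g (filter_mset (\<lambda>v. v \<in> V) m)"
proof -
  let ?a = "filter_mset (\<lambda>v. v \<in> U) m" and ?b = "filter_mset (\<lambda>v. v \<in> V) m"
  have ab: "?a + ?b = m"
  proof -
    have "?b = filter_mset (\<lambda>v. v \<notin> U) m" by (rule filter_mset_cong) (use disj m in auto)
    then show ?thesis by (metis multiset_partition)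
  qed
  have "mfps_coeff (f * g) m = (\<Sum>(a, b)\<in>{(?a, ?b)}. mfps_coeff f a * mfps_coeff g b)"
    unfolding mfps_coeff_times
  proof (rule sum.mono_neutral_right)
    show "\<forall>x\<in>{(a, b). a + b = m} - {(?a, ?b)}. (case x of (a, b) \<Rightarrow> mfps_coeff f a * mfps_coeff g b) = 0"
    proof
      fix x assume x: "x \<in> {(a, b). a + b = m} - {(?a, ?b)}"
      obtain a b where xab: "x = (a, b)" by fastforce
      have "mfps_coeff f a * mfps_coeff g b = 0"
      proof (rule ccontr)
        assume "mfps_coeff f a * mfps_coeff g b \<noteq> 0"
        then have "mfps_coeff f a \<noteq> 0" "mfps_coeff g b \<noteq> 0" by auto
        then have s: "set_mset a \<subseteq> U" "set_mset b \<subseteq> V" using f g by (auto simp: mfps_vars_def)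
        have "m = a + b" using x xab by simp
        moreover have "filter_mset (\<lambda>v. v \<in> U) a = a" "filter_mset (\<lambda>v. v \<in> V) b = b"
          using s by (auto simp: filter_mset_eq_conv)
        moreover have "filter_mset (\<lambda>v. v \<in> U) b = {#}" "filter_mset (\<lambda>v. v \<in> V) a = {#}"
          using s disj by (auto simp: multiset_eq_iff count_eq_zero_iff)
        ultimately have "(?a, ?b) = (a, b)" by simp
        then show False using x xab by simp
      qed
      then show "(case x of (a, b) \<Rightarrow> mfps_coeff f a * mfps_coeff g b) = 0" by (simp add: xab)
    qed
  qed (use ab in \<open>auto simp: finite_mset_splits\<close>)
  then show ?thesis by simp
qed

lemma mfps_coeff_times3:
  assumes f: "mfps_vars f U" and g: "mfps_vars g V" and h: "mfps_vars h W"
    and disj: "U \<inter> V = {}" "U \<inter> W = {}" "V \<inter> W = {}" and m: "set_mset m \<subseteq> U \<union> V \<union> W"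
  shows "mfps_coeff (f * g * h) m = mfps_coeff f (filter_mset (\<lambda>v. v \<in> U) m)
    * mfps_coeff g (filter_mset (\<lambda>v. v \<in> V) m) * mfps_coeff h (filter_mset (\<lambda>v. v \<in> W) m)"
proof -
  let ?m = "filter_mset (\<lambda>v. v \<in> U \<union> V) m"
  have "mfps_coeff (f * g * h) m = mfps_coeff (f * g) ?m * mfps_coeff h (filter_mset (\<lambda>v. v \<in> W) m)"
    by (rule mfps_coeff_times_disjoint[OF mfps_vars_times[OF f g] h]) (use disj m in auto)
  also have "mfps_coeff (f * g) ?m = mfps_coeff f (filter_mset (\<lambda>v. v \<in> U) ?m) * mfps_coeff g (filter_mset (\<lambda>v. v \<in> V) ?m)"
    by (rule mfps_coeff_times_disjoint[OF f g]) (use disj in auto)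
  also have "filter_mset (\<lambda>v. v \<in> U) ?m = filter_mset (\<lambda>v. v \<in> U) m"
    by (simp add: filter_filter_mset) (rule filter_mset_cong, auto)
  also have "filter_mset (\<lambda>v. v \<in> V) ?m = filter_mset (\<lambda>v. v \<in> V) m"
    by (simp add: filter_filter_mset) (rule filter_mset_cong, auto)
  finally show ?thesis .
qed

section \<open>Coefficients of products of power sums\<close>

text \<open>A positive \<open>k\<close> lets the monomial determine its index. For
  \<open>k = 0\<close> all indices give the empty monomial, and their infinite set has
  \<open>card\<close> 0.\<close>

lemma mfps_coeff_power_sum:
  assumes "inj x" "k > 0"
  shows "mfps_coeff (power_sum x k) m = (if \<exists>v\<in>range x. m = replicate_mset k v then 1 else 0)"
proof (cases "\<exists>v\<in>range x. m = replicate_mset k v")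
  case True
  then obtain i where i: "m = replicate_mset k (x i)" by blast
  have "{j. m = replicate_mset k (x j)} = {i}"
    using assms i by (auto simp: replicate_mset_eq_iff inj_eq)
  then show ?thesis using True by (simp add: power_sum_def Abs_mfps_inverse)
next
  case False
  then have "{j. m = replicate_mset k (x j)} = {}" by auto
  then show ?thesis using False by (simp add: power_sum_def Abs_mfps_inverse)
qed

text \<open>Expanding the product means choosing a variable \<open>c i\<close> from each factor. As
  power sums have infinitely many terms, this is done coefficientwise, splitting off the monomial
  contributed by the factor of \<open>j\<close>.\<close>

lemma mfps_coeff_prod_power_sum:
  fixes x :: "nat \<Rightarrow> 'v"
  assumes x: "inj x" and "finite I" "\<And>i. i \<in> I \<Longrightarrow> w i > 0"
  shows "mfps_coeff (\<Prod>i\<in>I. power_sum x (w i) :: ('v, 'a :: comm_ring_1) mfps) m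
    = of_nat (card {c \<in> I \<rightarrow>\<^sub>E range x. (\<Sum>i\<in>I. replicate_mset (w i) (c i)) = m})"
  using assms(2,3)
proof (induction I arbitrary: m rule: finite_induct)
  case empty
  show ?case by (auto simp: one_mfps.rep_eq PiE_empty_domain)
next
  case (insert j I)
  define B where "B m = {c \<in> I \<rightarrow>\<^sub>E range x. (\<Sum>i\<in>I. replicate_mset (w i) (c i)) = m}" for m
  let ?I = "insert j I"
  let ?B = "{c \<in> ?I \<rightarrow>\<^sub>E range x. (\<Sum>i\<in>?I. replicate_mset (w i) (c i)) = m}"
  define \<phi> where "\<phi> c = (replicate_mset (w j) (c j), \<Sum>i\<in>I. replicate_mset (w i) (c i))"
    for c :: "_ \<Rightarrow> 'v"
  have wj: "w j > 0" using insert.prems by simp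
  \<comment> \<open>Positive exponents force every chosen variable to occur in \<open>m\<close>;
    without finiteness \<open>card\<close> would not count the choices.\<close>
  have fin: "finite ?B"
  proof (rule finite_subset)
    show "?B \<subseteq> ?I \<rightarrow>\<^sub>E set_mset m"
    proof
      fix c assume c: "c \<in> ?B"
      have "c i \<in># m" if i: "i \<in> ?I" for i
      proof -
        have "c i \<in># replicate_mset (w i) (c i)" using insert.prems[OF i] by simp
        then have "c i \<in># (\<Sum>i\<in>?I. replicate_mset (w i) (c i))"
          using i insert.hyps(1) by (subst sum.remove[of _ i]) auto
        then show ?thesis using c by simp
      qed
      then show "c \<in> ?I \<rightarrow>\<^sub>E set_mset m" using c by (auto simp: PiE_def)
    qed
    show "finite (?I \<rightarrow>\<^sub>E set_mset m)" using insert.hyps(1) by (intro finite_PiE) auto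
  qed
  have "of_nat (card ?B) = (\<Sum>y\<in>{(a, b). a + b = m}. \<Sum>c | c \<in> ?B \<and> \<phi> c = y. (1::'a))"
    by (subst sum.group) (use fin insert.hyps in \<open>auto simp: finite_mset_splits \<phi>_def\<close>)
  also have "\<dots> = (\<Sum>y\<in>{(a, b). a + b = m}. case y of (a, b) \<Rightarrow>
      mfps_coeff (power_sum x (w j)) a * of_nat (card (B b)))"
  proof (rule sum.cong[OF refl], clarify)
    fix a b assume m: "m = a + b"
    show "(\<Sum>c | c \<in> {c \<in> ?I \<rightarrow>\<^sub>E range x. (\<Sum>i\<in>?I. replicate_mset (w i) (c i)) = a + b} \<and> \<phi> c = (a, b). (1::'a))
      = mfps_coeff (power_sum x (w j)) a * of_nat (card (B b))"
      (is "(\<Sum>c | c \<in> ?C \<and> _. 1) = _")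
    proof (cases "\<exists>v\<in>range x. a = replicate_mset (w j) v")
      case True
      then obtain v where v: "v \<in> range x" "a = replicate_mset (w j) v" by blast
      have "bij_betw (\<lambda>c. c(j := v)) (B b) {c \<in> ?C. \<phi> c = (a, b)}"
      proof (rule bij_betw_byWitness[where f' = "\<lambda>c. c(j := undefined)"])
        have same: "(\<Sum>i\<in>I. replicate_mset (w i) ((c(j := u)) i)) = (\<Sum>i\<in>I. replicate_mset (w i) (c i))" for c u
          by (rule sum.cong) (use insert.hyps(2) in auto)
        show "\<forall>c\<in>B b. c(j := v, j := undefined) = c"
          using insert.hyps(2) by (auto simp: B_def PiE_def extensional_def)
        show "\<forall>c\<in>{c \<in> ?C. \<phi> c = (a, b)}. c(j := undefined, j := v) = c"
          using wj v(2) by (auto simp: \<phi>_def replicate_mset_eq_iff)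
        show "(\<lambda>c. c(j := v)) ` B b \<subseteq> {c \<in> ?C. \<phi> c = (a, b)}"
        proof clarify
          fix c assume "c \<in> B b"
          then have c: "c \<in> I \<rightarrow>\<^sub>E range x" "(\<Sum>i\<in>I. replicate_mset (w i) (c i)) = b" by (auto simp: B_def)
          have "c(j := v) \<in> ?I \<rightarrow>\<^sub>E range x" using c(1) v(1) by (intro PiE_fun_upd) auto
          moreover have "(\<Sum>i\<in>?I. replicate_mset (w i) ((c(j := v)) i)) = a + b"
            unfolding sum.insert[OF insert.hyps(1,2)] same c(2) using v(2) by simp
          moreover have "\<phi> (c(j := v)) = (a, b)" unfolding \<phi>_def same c(2) using v(2) by simp
          ultimately show "c(j := v) \<in> ?C \<and> \<phi> (c(j := v)) = (a, b)" by blast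
        qed
        show "(\<lambda>c. c(j := undefined)) ` {c \<in> ?C. \<phi> c = (a, b)} \<subseteq> B b"
        proof (rule image_subsetI)
          fix c assume c: "c \<in> {c \<in> ?C. \<phi> c = (a, b)}"
          then have "c(j := undefined) \<in> I \<rightarrow>\<^sub>E range x"
            using insert.hyps(2) by (auto simp: PiE_def extensional_def)
          moreover have "(\<Sum>i\<in>I. replicate_mset (w i) (c i)) = b" using c by (simp add: \<phi>_def)
          ultimately show "c(j := undefined) \<in> B b" unfolding B_def mem_Collect_eq same by blast
        qed
      qed
      then have "card {c \<in> ?C. \<phi> c = (a, b)} = card (B b)" using bij_betw_same_card by fastforce
      then show ?thesis using True by (simp add: mfps_coeff_power_sum[OF x wj])
    next
      case False
      then have "{c. c \<in> ?C \<and> \<phi> c = (a, b)} = {}" by (auto simp: \<phi>_def PiE_def)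
      then show ?thesis using False by (simp only: mfps_coeff_power_sum[OF x wj]) simp
    qed
  qed
  also have "\<dots> = mfps_coeff (power_sum x (w j) * (\<Prod>i\<in>I. power_sum x (w i))) m"
    unfolding mfps_coeff_times using insert.IH insert.prems by (simp add: B_def)
  finally show ?case using insert.hyps by simp
qed

lemma sum_singleton_const: "finite A \<Longrightarrow> (\<Sum>a\<in>A. {#v#}) = replicate_mset (card A) v"
  by (induction A rule: finite_induct) auto

lemma image_mset_mset_set_eq_sum: "finite A \<Longrightarrow> image_mset g (mset_set A) = (\<Sum>a\<in>A. {#g a#})"
  by (induction A rule: finite_induct) auto

lemma orbit_eq_of_mem:
  assumes "permutation p" "y \<in> orbit p x"
  shows "orbit p y = orbit p x"
  using cyclic_on_orbit'[OF assms(1), of x] assms(2) by (metis cyclic_on_alldef)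

text \<open>One variable per cycle amounts to a colouring of the points by variables that is
  constant on cycles; a cycle of length k contributes the exponent k.\<close>

lemma mfps_coeff_power_sum_cycle_type:
  assumes x: "inj x" and p: "p permutes {1..n}"
  shows "mfps_coeff (power_sum_sym x (cycle_type n p)) m
    = (if set_mset m \<subseteq> range x then of_nat (card {f \<in> colourings {1..n} m. p \<in> young {1..n} f}) else 0)"
proof -
  let ?A = "{1..n}" and ?O = "orbit p ` {1..n}"
  have pp: "permutation p" using p permutes_imp_permutation by blast
  have self: "y \<in> orbit p y" for y using pp by (rule permutation_self_in_orbit)
  have sub: "orbit p y \<subseteq> ?A" if "y \<in> ?A" for y by (rule permutes_orbit_subset[OF p that])
  have finO: "finite (orbit p y)" if "y \<in> ?A" for y using sub[OF that] finite_subset by blast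
  have pos: "card C > 0" if "C \<in> ?O" for C using that finO self by (auto simp: card_gt_0_iff)
  have fib: "{y \<in> ?A. orbit p y = C} = C" if "C \<in> ?O" for C
  proof -
    obtain y where y: "y \<in> ?A" "C = orbit p y" using \<open>C \<in> ?O\<close> by blast
    show ?thesis
    proof (intro equalityI subsetI)
      fix z assume "z \<in> {y \<in> ?A. orbit p y = C}"
      then show "z \<in> C" using self[of z] by simp
    next
      fix z assume z: "z \<in> C"
      then have "z \<in> ?A" using sub[OF y(1)] y(2) by blast
      moreover have "orbit p z = C" unfolding y(2) by (rule orbit_eq_of_mem[OF pp]) (use z y(2) in simp)
      ultimately show "z \<in> {y \<in> ?A. orbit p y = C}" by simp
    qed
  qed
  have content: "image_mset (\<lambda>y\<in>?A. c (orbit p y)) (mset_set ?A) = (\<Sum>C\<in>?O. replicate_mset (card C) (c C))" for c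
  proof -
    have "image_mset (\<lambda>y\<in>?A. c (orbit p y)) (mset_set ?A) = image_mset (\<lambda>y. c (orbit p y)) (mset_set ?A)"
      by (rule image_mset_cong) auto
    also have "\<dots> = (\<Sum>y\<in>?A. {#c (orbit p y)#})"
      by (rule image_mset_mset_set_eq_sum) simp
    also have "\<dots> = (\<Sum>C\<in>?O. \<Sum>y | y \<in> ?A \<and> orbit p y = C. {#c (orbit p y)#})"
      by (rule sum.image_gen) simp
    also have "\<dots> = (\<Sum>C\<in>?O. replicate_mset (card C) (c C))"
    proof (rule sum.cong[OF refl])
      fix C assume C: "C \<in> ?O"
      have "(\<Sum>y | y \<in> ?A \<and> orbit p y = C. {#c (orbit p y)#}) = (\<Sum>y\<in>C. {#c C#})"
        by (rule sum.cong) (use fib[OF C] in auto)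
      also have "\<dots> = replicate_mset (card C) (c C)"
        using C finO by (intro sum_singleton_const) auto
      finally show "(\<Sum>y | y \<in> ?A \<and> orbit p y = C. {#c (orbit p y)#}) = replicate_mset (card C) (c C)" .
    qed
    finally show ?thesis .
  qed
  have "mfps_coeff (power_sum_sym x (cycle_type n p)) m
    = mfps_coeff (\<Prod>C\<in>?O. power_sum x (card C)) m"
    by (simp add: power_sum_sym_def cycle_type_def prod_unfold_prod_mset multiset.map_comp o_def)
  also have "\<dots> = of_nat (card {c \<in> ?O \<rightarrow>\<^sub>E range x. (\<Sum>C\<in>?O. replicate_mset (card C) (c C)) = m})"
    by (rule mfps_coeff_prod_power_sum[OF x]) (use pos in auto)
  also have "card {c \<in> ?O \<rightarrow>\<^sub>E range x. (\<Sum>C\<in>?O. replicate_mset (card C) (c C)) = m}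
    = card {f \<in> colourings ?A m. p \<in> young ?A f \<and> f ` ?A \<subseteq> range x}"
  proof (rule bij_betw_same_card[where f = "\<lambda>c. \<lambda>y\<in>?A. c (orbit p y)"], unfold bij_betw_def, intro conjI)
    show "inj_on (\<lambda>c. \<lambda>y\<in>?A. c (orbit p y)) {c \<in> ?O \<rightarrow>\<^sub>E range x. (\<Sum>C\<in>?O. replicate_mset (card C) (c C)) = m}"
    proof (rule inj_onI)
      fix c d assume c: "c \<in> {c \<in> ?O \<rightarrow>\<^sub>E range x. (\<Sum>C\<in>?O. replicate_mset (card C) (c C)) = m}"
        and d: "d \<in> {c \<in> ?O \<rightarrow>\<^sub>E range x. (\<Sum>C\<in>?O. replicate_mset (card C) (c C)) = m}"
        and e: "(\<lambda>y\<in>?A. c (orbit p y)) = (\<lambda>y\<in>?A. d (orbit p y))"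
      show "c = d"
      proof (rule extensionalityI[of _ ?O])
        fix C assume "C \<in> ?O"
        then obtain y where "y \<in> ?A" "C = orbit p y" by blast
        then show "c C = d C" using fun_cong[OF e, of y] by (simp del: atLeastAtMost_iff)
      qed (use c d in \<open>auto simp: PiE_def\<close>)
    qed
    show "(\<lambda>c. \<lambda>y\<in>?A. c (orbit p y)) ` {c \<in> ?O \<rightarrow>\<^sub>E range x. (\<Sum>C\<in>?O. replicate_mset (card C) (c C)) = m}
      = {f \<in> colourings ?A m. p \<in> young ?A f \<and> f ` ?A \<subseteq> range x}"
    proof (intro equalityI subsetI)
      fix f assume "f \<in> (\<lambda>c. \<lambda>y\<in>?A. c (orbit p y)) ` {c \<in> ?O \<rightarrow>\<^sub>E range x. (\<Sum>C\<in>?O. replicate_mset (card C) (c C)) = m}"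
      then obtain c where c: "c \<in> ?O \<rightarrow>\<^sub>E range x" "(\<Sum>C\<in>?O. replicate_mset (card C) (c C)) = m"
        and f: "f = (\<lambda>y\<in>?A. c (orbit p y))" by blast
      have "f \<in> colourings ?A m" unfolding colourings_def f using content[of c] c(2) by simp
      moreover have "p \<in> young ?A f"
      proof -
        have "f (p y) = f y" if "y \<in> ?A" for y
        proof -
          have "orbit p (p y) = orbit p y" by (rule orbit_eq_of_mem[OF pp]) (rule orbit.base)
          then show ?thesis using that permutes_in_image[OF p, of y] unfolding f by (simp del: atLeastAtMost_iff)
        qed
        then show ?thesis using p by (simp add: young_def)
      qed
      moreover have "f ` ?A \<subseteq> range x" using c(1) unfolding f by (auto simp: PiE_def Pi_def)
      ultimately show "f \<in> {f \<in> colourings ?A m. p \<in> young ?A f \<and> f ` ?A \<subseteq> range x}" by blast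
    next
      fix f assume f: "f \<in> {f \<in> colourings ?A m. p \<in> young ?A f \<and> f ` ?A \<subseteq> range x}"
      \<comment> \<open>The choice of a representative is harmless since \<open>f\<close> is
        constant on each orbit, as \<open>const\<close> shows.\<close>
      define c where "c = (\<lambda>C\<in>?O. f (SOME y. y \<in> C))"
      have const: "f z = f y" if "z \<in> orbit p y" "y \<in> ?A" for y z
      proof -
        have "z \<in> ?A \<and> f z = f y"
          using that(1)
        proof (induction rule: orbit.induct)
          case base
          then show ?case using that(2) f permutes_in_image[OF p, of y] by (auto simp: young_def)
        next
          case (step z)
          then show ?case using f permutes_in_image[OF p, of z] by (auto simp: young_def)
        qed
        then show ?thesis by simp
      qed
      have ext: "f \<in> extensional ?A" using f by (simp add: colourings_def)
      have fc: "f = (\<lambda>y\<in>?A. c (orbit p y))"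
      proof (rule extensionalityI[OF ext])
        fix y assume y: "y \<in> ?A"
        have "(SOME z. z \<in> orbit p y) \<in> orbit p y" using self by (rule someI)
        from const[OF this y] show "f y = (\<lambda>y\<in>?A. c (orbit p y)) y" using y by (simp add: c_def)
      qed simp
      have "c \<in> ?O \<rightarrow>\<^sub>E range x"
      proof (rule PiE_I)
        fix C assume "C \<in> ?O"
        then obtain y where y: "y \<in> ?A" "C = orbit p y" by blast
        have "c C = f y" using fun_cong[OF fc, of y] y by (simp del: atLeastAtMost_iff)
        then show "c C \<in> range x" using f y by auto
      qed (simp add: c_def)
      moreover have "(\<Sum>C\<in>?O. replicate_mset (card C) (c C)) = m"
        using content[of c] f unfolding fc[symmetric] by (simp add: colourings_def)
      ultimately show "f \<in> (\<lambda>c. \<lambda>y\<in>?A. c (orbit p y)) ` {c \<in> ?O \<rightarrow>\<^sub>E range x. (\<Sum>C\<in>?O. replicate_mset (card C) (c C)) = m}"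
        using fc by blast
    qed
  qed
  also have "{f \<in> colourings ?A m. p \<in> young ?A f \<and> f ` ?A \<subseteq> range x}
    = (if set_mset m \<subseteq> range x then {f \<in> colourings ?A m. p \<in> young ?A f} else {})"
    using colourings_image[of ?A _ m] by auto
  finally show ?thesis by (cases "set_mset m \<subseteq> range x") simp_all
qed

section \<open>Exponents and monomial symmetric functions\<close>

definition exponents :: "'v multiset \<Rightarrow> nat multiset" where
  "exponents m = image_mset (count m) (mset_set (set_mset m))"

lemma size_exponents: "size (exponents m) = card (set_mset m)"
  by (simp add: exponents_def)

lemma exponents_in_partitions: "exponents m \<in> partitions n \<longleftrightarrow> size m = n"
proof -
  have "sum_mset (exponents m) = size m"
    by (simp add: exponents_def size_multiset_overloaded_eq sum_unfold_sum_mset)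
  moreover have "0 \<notin># exponents m"
  proof
    assume "0 \<in># exponents m"
    then obtain v where "v \<in># m" "count m v = 0" by (auto simp: exponents_def)
    then show False by (simp add: count_eq_zero_iff)
  qed
  ultimately show ?thesis by (simp add: partitions_def)
qed

lemma count_image_mset_inj: "inj f \<Longrightarrow> count (image_mset f m) (f x) = count m x"
  by (induction m) (auto simp: inj_eq)

lemma exponents_image_mset:
  assumes "inj f"
  shows "exponents (image_mset f m) = exponents m"
proof -
  have "exponents (image_mset f m) = image_mset (count (image_mset f m)) (image_mset f (mset_set (set_mset m)))"
    using assms by (simp add: exponents_def image_mset_mset_set inj_on_subset)
  also have "\<dots> = exponents m"
    unfolding exponents_def multiset.map_comp
    by (rule image_mset_cong) (simp add: count_image_mset_inj[OF assms])
  finally show ?thesis .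
qed

lemma exponents_leading_monomial:
  assumes "0 \<notin># lam"
  shows "exponents (leading_monomial lam) = lam"
proof -
  define ps where "ps = rev (sorted_list_of_multiset lam)"
  have ps: "mset ps = lam" by (simp add: ps_def)
  have L: "leading_monomial lam = (\<Sum>i<length ps. replicate_mset (ps ! i) i)"
    by (simp add: leading_monomial_def ps_def)
  have c: "count (leading_monomial lam) j = (if j < length ps then ps ! j else 0)" for j
    unfolding L count_sum by (simp add: if_distrib cong: if_cong)
  have pos: "ps ! j \<noteq> 0" if "j < length ps" for j
    using assms ps that by (metis nth_mem set_mset_mset)
  have "set_mset (leading_monomial lam) = {..<length ps}"
    using pos by (auto simp: set_mset_def c split: if_splits)
  then have "exponents (leading_monomial lam) = image_mset (count (leading_monomial lam)) (mset_set {..<length ps})"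
    by (simp add: exponents_def)
  also have "\<dots> = image_mset (\<lambda>i. ps ! i) (mset_set {..<length ps})"
    by (rule image_mset_cong) (simp add: c)
  also have "\<dots> = mset (map (\<lambda>i. ps ! i) [0..<length ps])"
    by (simp add: mset_set_upto_eq_mset_upto)
  also have "\<dots> = lam" using ps by (simp only: map_nth)
  finally show ?thesis .
qed

lemma exponents_eq_imp_permuted:
  fixes m m' :: "'v multiset"
  assumes "exponents m = exponents m'"
  obtains p where "bij p" "m = image_mset p m'"
proof -
  let ?A = "set_mset m \<union> set_mset m'"
  \<comment> \<open>Exponents are listed over the union of both supports and padded by zeros, so
    that one finite set indexes both families and a permutation of it can match them.\<close>
  have *: "image_mset (count k) (mset_set ?A) = exponents k + replicate_mset (card (?A - set_mset k)) 0"
    if "k = m \<or> k = m'" for k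
  proof -
    have "mset_set ?A = mset_set (set_mset k) + mset_set (?A - set_mset k)"
      using that by (subst mset_set_Union[symmetric]) (auto intro!: arg_cong[of _ _ mset_set])
    moreover have "image_mset (count k) (mset_set (?A - set_mset k)) = image_mset (\<lambda>_. 0) (mset_set (?A - set_mset k))"
      by (rule image_mset_cong) (auto simp: not_in_iff)
    ultimately show ?thesis by (simp add: exponents_def image_mset_const_eq)
  qed
  have "card (set_mset m) = card (set_mset m')" using assms size_exponents by metis
  then have "card (?A - set_mset m) = card (?A - set_mset m')"
    by (subst (1 2) card_Diff_subset) auto
  then have "image_mset (count m) (mset_set ?A) = image_mset (count m') (mset_set ?A)"
    using *[of m] *[of m'] assms by simp
  then obtain q where q: "q permutes ?A" "\<forall>x\<in>?A. count m x = count m' (q x)"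
    using image_mset_eq_implies_permutes[of ?A "count m" "count m'"] by auto
  have cq: "count m x = count m' (q x)" for x
  proof (cases "x \<in> ?A")
    case False
    then show ?thesis using permutes_not_in[OF q(1) False] by (simp add: not_in_iff)
  qed (use q in blast)
  have bij: "bij (inv q)" using permutes_bij[OF permutes_inv[OF q(1)]] .
  have "count (image_mset (inv q) m') x = count m x" for x
    using count_image_mset_inj[OF bij_is_inj[OF bij], of m' "q x"] permutes_inverses[OF q(1)] cq by simp
  then have "m = image_mset (inv q) m'" by (simp add: multiset_eq_iff)
  with bij show ?thesis using that by blast
qed

text \<open>The exponents are invariant under renaming of variables, and by
  \<open>exponents_eq_imp_permuted\<close> they are a complete invariant; so the rearrangements of
  the leading monomial are the monomials with its exponents.\<close>

lemma mfps_coeff_monomial_sym: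
  assumes x: "inj x" and lam: "0 \<notin># lam"
  shows "mfps_coeff (monomial_sym x lam) m = (if set_mset m \<subseteq> range x \<and> exponents m = lam then 1 else 0)"
proof -
  have "(\<exists>\<pi>. bij \<pi> \<and> m = image_mset x (image_mset \<pi> (leading_monomial lam)))
      \<longleftrightarrow> set_mset m \<subseteq> range x \<and> exponents m = lam"
  proof
    assume "\<exists>\<pi>. bij \<pi> \<and> m = image_mset x (image_mset \<pi> (leading_monomial lam))"
    then obtain \<pi> where \<pi>: "bij \<pi>" "m = image_mset x (image_mset \<pi> (leading_monomial lam))" by blast
    then show "set_mset m \<subseteq> range x \<and> exponents m = lam"
      using exponents_image_mset[OF x] exponents_image_mset[OF bij_is_inj[OF \<pi>(1)]]
        exponents_leading_monomial[OF lam] by auto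
  next
    assume m: "set_mset m \<subseteq> range x \<and> exponents m = lam"
    define m' where "m' = image_mset (inv x) m"
    have mm: "m = image_mset x m'"
    proof -
      have "image_mset x m' = image_mset id m"
        unfolding m'_def multiset.map_comp by (rule image_mset_cong) (use m in \<open>auto simp: f_inv_into_f\<close>)
      then show ?thesis by simp
    qed
    have "exponents m' = exponents (leading_monomial lam)"
      using m mm exponents_image_mset[OF x, of m'] exponents_leading_monomial[OF lam] by simp
    then obtain \<pi> where "bij \<pi>" "m' = image_mset \<pi> (leading_monomial lam)"
      by (rule exponents_eq_imp_permuted)
    then show "\<exists>\<pi>. bij \<pi> \<and> m = image_mset x (image_mset \<pi> (leading_monomial lam))" using mm by blast
  qed
  then show ?thesis by (simp add: monomial_sym_def Abs_mfps_inverse)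
qed

lemma finite_partitions: "finite (partitions n)"
proof (rule finite_subset)
  show "partitions n \<subseteq> mset ` {xs. set xs \<subseteq> {..n} \<and> length xs \<le> n}"
  proof
    fix lam assume lam: "lam \<in> partitions n"
    obtain xs where xs: "mset xs = lam" using ex_mset by blast
    have "x \<le> n" if x: "x \<in># lam" for x
    proof -
      obtain l where "lam = add_mset x l" using x by (meson mset_add)
      then show ?thesis using lam by (simp add: partitions_def)
    qed
    moreover have "size lam \<le> n"
    proof -
      have "size lam = (\<Sum>x\<in>#lam. 1)" by (rule size_eq_sum_mset)
      also have "\<dots> \<le> (\<Sum>x\<in>#lam. x)"
        by (rule sum_mset_mono) (use lam in \<open>auto simp: partitions_def Suc_le_eq intro: gr0I\<close>)
      finally show ?thesis using lam by (simp add: partitions_def)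
    qed
    ultimately show "lam \<in> mset ` {xs. set xs \<subseteq> {..n} \<and> length xs \<le> n}"
      using xs by (intro image_eqI[of _ _ xs]) auto
  qed
  show "finite (mset ` {xs. set xs \<subseteq> {..n} \<and> length xs \<le> n})"
    by (rule finite_imageI, rule finite_lists_length_le) simp
qed

lemma cycle_type_in_partitions:
  assumes p: "p permutes {1..n}"
  shows "cycle_type n p \<in> partitions n"
proof -
  let ?O = "orbit p ` {1..n}"
  have pp: "permutation p" using p permutes_imp_permutation by blast
  have fin: "finite C" if "C \<in> ?O" for C
    using that permutes_orbit_subset[OF p] finite_subset by blast
  have "0 \<notin># cycle_type n p"
    using fin orbit_nonempty by (fastforce simp: cycle_type_def)
  moreover have "sum_mset (cycle_type n p) = (\<Sum>C\<in>?O. card C)"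
    by (simp add: cycle_type_def sum_unfold_sum_mset)
  moreover have "\<dots> = card (\<Union>?O)"
  proof (rule card_Union_disjoint[symmetric])
    show "pairwise disjnt ?O"
    proof (rule pairwiseI)
      fix C D assume "C \<in> ?O" "D \<in> ?O" "C \<noteq> D"
      then obtain y z where yz: "C = orbit p y" "D = orbit p z" by blast
      show "disjnt C D"
      proof (rule ccontr)
        assume "\<not> disjnt C D"
        then obtain w where "w \<in> C" "w \<in> D" by (auto simp: disjnt_def)
        then have "C = D" using yz orbit_eq_of_mem[OF pp] by metis
        then show False using \<open>C \<noteq> D\<close> by simp
      qed
    qed
  qed (use fin in auto)
  moreover have "\<Union>?O = {1..n}"
  proof (intro equalityI subsetI)
    fix y assume "y \<in> \<Union>?O"
    then obtain z where "z \<in> {1..n}" "y \<in> orbit p z" by blast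
    then show "y \<in> {1..n}" using permutes_orbit_subset[OF p] by blast
  next
    fix y assume "y \<in> {1..n}"
    then show "y \<in> \<Union>?O" using permutation_self_in_orbit[OF pp, of y] by blast
  qed
  ultimately show ?thesis by (simp add: partitions_def)
qed

section \<open>Regrouping sums over factorizations\<close>

lemma sum_coloured_perms_by_permutation:
  fixes F :: "('a \<Rightarrow> 'a) \<Rightarrow> nat"
  assumes A: "finite A"
  shows "(\<Sum>(f, p)\<in>coloured_perms A a. F p) = (\<Sum>p | p permutes A. card {f \<in> colourings A a. p \<in> young A f} * F p)"
proof -
  have "(\<Sum>x\<in>coloured_perms A a. F (snd x))
      = (\<Sum>p | p permutes A. \<Sum>x | x \<in> coloured_perms A a \<and> snd x = p. F (snd x))"
    by (rule sum.group[symmetric]) (use A finite_permutations[OF A] in \<open>auto simp: coloured_perms_def young_def\<close>)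
  also have "\<dots> = (\<Sum>p | p permutes A. card {f \<in> colourings A a. p \<in> young A f} * F p)"
  proof (rule sum.cong[OF refl])
    fix p
    have "{x. x \<in> coloured_perms A a \<and> snd x = p} = (\<lambda>f. (f, p)) ` {f \<in> colourings A a. p \<in> young A f}"
      by (auto simp: coloured_perms_def)
    then have "card {x. x \<in> coloured_perms A a \<and> snd x = p} = card {f \<in> colourings A a. p \<in> young A f}"
      by (simp add: card_image inj_on_def)
    moreover have "(\<Sum>x | x \<in> coloured_perms A a \<and> snd x = p. F (snd x))
        = (\<Sum>x | x \<in> coloured_perms A a \<and> snd x = p. F p)" by (rule sum.cong) auto
    ultimately show "(\<Sum>x | x \<in> coloured_perms A a \<and> snd x = p. F (snd x))
        = card {f \<in> colourings A a. p \<in> young A f} * F p" by simp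
  qed
  finally show ?thesis by (simp add: case_prod_unfold)
qed

lemma coloured_factorizations_eq_sum:
  assumes A: "finite A"
  shows "coloured_factorizations A \<gamma> a b c = (\<Sum>(p, q, r) | p permutes A \<and> q permutes A \<and> r permutes A \<and> p \<circ> q \<circ> r = \<gamma>.
    card {f \<in> colourings A a. p \<in> young A f} * card {f \<in> colourings A b. q \<in> young A f}
    * card {f \<in> colourings A c. r \<in> young A f})"
proof -
  let ?k = "\<lambda>a p. card {f \<in> colourings A a. p \<in> young A f}" and ?P = "{p. p permutes A}"
  have fP: "finite ?P" using finite_permutations[OF A] .
  have "coloured_factorizations A \<gamma> a b c = (\<Sum>p\<in>?P. ?k a p * (\<Sum>q\<in>?P. ?k b q * (\<Sum>r\<in>?P. ?k c r * (if p \<circ> q \<circ> r = \<gamma> then 1 else 0))))"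
    unfolding coloured_factorizations_def sum_coloured_perms_by_permutation[OF A] ..
  also have "\<dots> = (\<Sum>p\<in>?P. \<Sum>q\<in>?P. \<Sum>r\<in>?P. if p \<circ> q \<circ> r = \<gamma> then ?k a p * ?k b q * ?k c r else 0)"
    unfolding sum_distrib_left by (intro sum.cong refl) auto
  also have "\<dots> = (\<Sum>(p, q, r)\<in>?P \<times> ?P \<times> ?P. if p \<circ> q \<circ> r = \<gamma> then ?k a p * ?k b q * ?k c r else 0)"
    by (simp add: sum.cartesian_product)
  also have "\<dots> = (\<Sum>(p, q, r) | p permutes A \<and> q permutes A \<and> r permutes A \<and> p \<circ> q \<circ> r = \<gamma>. ?k a p * ?k b q * ?k c r)"
    by (rule sum.mono_neutral_cong_right) (use fP in \<open>auto simp: case_prod_unfold\<close>)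
  finally show ?thesis .
qed

lemma coloured_factorizations_eq_0:
  assumes A: "finite A" and "size a \<noteq> card A \<or> size b \<noteq> card A \<or> size c \<noteq> card A"
  shows "coloured_factorizations A \<gamma> a b c = 0"
proof -
  have z: "card {f \<in> colourings A d. p \<in> young A f} = 0" if "size d \<noteq> card A" for d :: "'b multiset" and p
  proof -
    have "colourings A d = {}" using that by (auto simp: colourings_def)
    then show ?thesis by simp
  qed
  show ?thesis unfolding coloured_factorizations_eq_sum[OF A]
    by (rule sum.neutral) (use assms(2) z in fastforce)
qed

text \<open>Grouping by cycle types trades the numbers of factorizations for a sum over
  permutations, where \<open>mfps_coeff_power_sum_cycle_type\<close> applies.\<close>

lemma sum_num_factorizations:
  fixes G :: "nat multiset \<Rightarrow> nat multiset \<Rightarrow> nat multiset \<Rightarrow> 'a :: comm_ring_1"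
  shows "(\<Sum>lam\<in>partitions n. \<Sum>mu\<in>partitions n. \<Sum>nu\<in>partitions n. of_nat (num_factorizations n lam mu nu) * G lam mu nu)
    = (\<Sum>(p, q, r) | p permutes {1..n} \<and> q permutes {1..n} \<and> r permutes {1..n} \<and> p \<circ> q \<circ> r = long_cycle n.
        G (cycle_type n p) (cycle_type n q) (cycle_type n r))"
proof -
  let ?A = "{1..n}" and ?P = "partitions n"
  define T where "T = {(p, q, r). p permutes ?A \<and> q permutes ?A \<and> r permutes ?A \<and> p \<circ> q \<circ> r = long_cycle n}"
  define ct where "ct = (\<lambda>(p, q, r). (cycle_type n p, cycle_type n q, cycle_type n r))"
  have fT: "finite T"
    by (rule finite_subset[of _ "{p. p permutes ?A} \<times> {p. p permutes ?A} \<times> {p. p permutes ?A}"])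
      (auto simp: T_def finite_permutations)
  have "(\<Sum>lam\<in>?P. \<Sum>mu\<in>?P. \<Sum>nu\<in>?P. of_nat (num_factorizations n lam mu nu) * G lam mu nu)
      = (\<Sum>(lam, mu, nu)\<in>?P \<times> ?P \<times> ?P. of_nat (num_factorizations n lam mu nu) * G lam mu nu)"
    by (simp add: sum.cartesian_product)
  also have "\<dots> = (\<Sum>y\<in>?P \<times> ?P \<times> ?P. \<Sum>x | x \<in> T \<and> ct x = y. case ct x of (lam, mu, nu) \<Rightarrow> G lam mu nu)"
  proof (rule sum.cong[OF refl])
    fix y assume "y \<in> ?P \<times> ?P \<times> ?P"
    obtain lam mu nu where y: "y = (lam, mu, nu)" by (metis prod_cases3)
    have "num_factorizations n lam mu nu = card {x. x \<in> T \<and> ct x = y}"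
      unfolding num_factorizations_def y
      by (rule arg_cong[of _ _ card]) (auto simp: T_def ct_def conj_class_def)
    moreover have "(\<Sum>x | x \<in> T \<and> ct x = y. case ct x of (lam, mu, nu) \<Rightarrow> G lam mu nu)
        = (\<Sum>x | x \<in> T \<and> ct x = y. G lam mu nu)"
      by (rule sum.cong) (auto simp: y)
    ultimately show "(case y of (lam, mu, nu) \<Rightarrow> of_nat (num_factorizations n lam mu nu) * G lam mu nu)
        = (\<Sum>x | x \<in> T \<and> ct x = y. case ct x of (lam, mu, nu) \<Rightarrow> G lam mu nu)" by (simp add: y)
  qed
  also have "\<dots> = (\<Sum>x\<in>T. case ct x of (lam, mu, nu) \<Rightarrow> G lam mu nu)"
    by (rule sum.group[OF fT]) (auto simp: finite_partitions T_def ct_def cycle_type_in_partitions)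
  finally show ?thesis by (simp add: T_def ct_def case_prod_unfold)
qed

lemma mfps_vars_power_sum_sym:
  assumes "inj x" "p permutes {1..n}"
  shows "mfps_vars (power_sum_sym x (cycle_type n p)) (range x)"
  unfolding mfps_vars_def mfps_coeff_power_sum_cycle_type[OF assms] by auto

lemma mfps_vars_monomial_sym:
  assumes "inj x" "lam \<in> partitions n"
  shows "mfps_vars (monomial_sym x lam) (range x)"
  using assms unfolding mfps_vars_def by (auto simp: mfps_coeff_monomial_sym partitions_def split: if_splits)

lemma sum_delta_triple:
  assumes "finite P"
  shows "(\<Sum>l\<in>P. \<Sum>k\<in>P. \<Sum>j\<in>P. if (a, b, c) = (l, k, j) then W l k j else (0 :: 'a :: comm_monoid_add))
    = (if a \<in> P \<and> b \<in> P \<and> c \<in> P then W a b c else 0)"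
proof -
  have "(\<Sum>l\<in>P. \<Sum>k\<in>P. \<Sum>j\<in>P. if (a, b, c) = (l, k, j) then W l k j else 0)
      = (\<Sum>y\<in>P \<times> P \<times> P. if (a, b, c) = y then (case y of (l, k, j) \<Rightarrow> W l k j) else 0)"
    unfolding sum.cartesian_product by (rule sum.cong) (auto split: if_splits)
  also have "\<dots> = (if a \<in> P \<and> b \<in> P \<and> c \<in> P then W a b c else 0)"
    using assms by (subst sum.delta') auto
  finally show ?thesis .
qed

theorem theorem1:
  fixes n :: nat
  assumes "n > 0"
  shows "(\<Sum>lam\<in>partitions n. \<Sum>mu\<in>partitions n. \<Sum>nu\<in>partitions n.
           of_nat (num_factorizations n lam mu nu) *
           (power_sum_sym X lam * power_sum_sym Y mu * power_sum_sym Z nu))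
       = (\<Sum>lam\<in>partitions n. \<Sum>mu\<in>partitions n. \<Sum>nu\<in>partitions n.
           mfps_const
             ((fact n)^2 * of_nat (M_coeff n (size lam) (size mu) (size nu)) /
              (of_nat ((n - 1) choose (size lam - 1)) *
               of_nat ((n - 1) choose (size mu - 1)) *
               of_nat ((n - 1) choose (size nu - 1)))) *
           (monomial_sym X lam * monomial_sym Y mu * monomial_sym Z nu)
           :: (var, rat) mfps)"
proof (rule mfps_eqI)
  fix m :: "var multiset"
  let ?A = "{1..n}"
  \<comment> \<open>The three families of variables are disjoint and exhaust \<open>var\<close>, so
    \<open>m\<close> is the product of these parts and the coefficients factor accordingly.\<close>
  define a where "a = filter_mset (\<lambda>v. v \<in> range X) m"
  define b where "b = filter_mset (\<lambda>v. v \<in> range Y) m"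
  define c where "c = filter_mset (\<lambda>v. v \<in> range Z) m"
  have inj: "inj X" "inj Y" "inj Z" by (auto simp: inj_def)
  have disj: "range X \<inter> range Y = {}" "range X \<inter> range Z = {}" "range Y \<inter> range Z = {}" by auto
  have all: "set_mset m \<subseteq> range X \<union> range Y \<union> range Z"
  proof
    fix v show "v \<in> range X \<union> range Y \<union> range Z" by (cases v) auto
  qed
  have sub: "set_mset a \<subseteq> range X" "set_mset b \<subseteq> range Y" "set_mset c \<subseteq> range Z"
    by (auto simp: a_def b_def c_def)
  note split = mfps_coeff_times3[OF _ _ _ disj all, folded a_def b_def c_def]
  let ?w = "\<lambda>l k j. (fact n)^2 * rat_of_nat (M_coeff n l k j) /
      (of_nat ((n - 1) choose (l - 1)) * of_nat ((n - 1) choose (k - 1)) * of_nat ((n - 1) choose (j - 1)))"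
  have "mfps_coeff (\<Sum>lam\<in>partitions n. \<Sum>mu\<in>partitions n. \<Sum>nu\<in>partitions n.
           of_nat (num_factorizations n lam mu nu) *
           (power_sum_sym X lam * power_sum_sym Y mu * power_sum_sym Z nu) :: (var, rat) mfps) m
    = (\<Sum>(p, q, r) | p permutes ?A \<and> q permutes ?A \<and> r permutes ?A \<and> p \<circ> q \<circ> r = long_cycle n.
        mfps_coeff (power_sum_sym X (cycle_type n p) * power_sum_sym Y (cycle_type n q) * power_sum_sym Z (cycle_type n r) :: (var, rat) mfps) m)"
    unfolding sum_num_factorizations mfps_coeff_sum by (simp add: case_prod_unfold)
  also have "\<dots> = (\<Sum>(p, q, r) | p permutes ?A \<and> q permutes ?A \<and> r permutes ?A \<and> p \<circ> q \<circ> r = long_cycle n.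
      rat_of_nat (card {f \<in> colourings ?A a. p \<in> young ?A f} * card {f \<in> colourings ?A b. q \<in> young ?A f}
        * card {f \<in> colourings ?A c. r \<in> young ?A f}))"
  proof (rule sum.cong[OF refl], clarify)
    fix p q r assume p: "p permutes ?A" and q: "q permutes ?A" and r: "r permutes ?A"
    show "mfps_coeff (power_sum_sym X (cycle_type n p) * power_sum_sym Y (cycle_type n q) * power_sum_sym Z (cycle_type n r)) m
      = rat_of_nat (card {f \<in> colourings ?A a. p \<in> young ?A f} * card {f \<in> colourings ?A b. q \<in> young ?A f}
        * card {f \<in> colourings ?A c. r \<in> young ?A f})"
      unfolding split[OF mfps_vars_power_sum_sym[OF inj(1) p] mfps_vars_power_sum_sym[OF inj(2) q] mfps_vars_power_sum_sym[OF inj(3) r]]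
        mfps_coeff_power_sum_cycle_type[OF inj(1) p] mfps_coeff_power_sum_cycle_type[OF inj(2) q] mfps_coeff_power_sum_cycle_type[OF inj(3) r]
      using sub by simp
  qed
  also have "\<dots> = rat_of_nat (coloured_factorizations ?A (long_cycle n) a b c)"
    unfolding coloured_factorizations_eq_sum[OF finite_atLeastAtMost] of_nat_sum by (simp add: case_prod_unfold)
  also have "\<dots> = (if size a = n \<and> size b = n \<and> size c = n
      then ?w (card (set_mset a)) (card (set_mset b)) (card (set_mset c)) else 0)"
  proof (cases "size a = n \<and> size b = n \<and> size c = n")
    case True
    \<comment> \<open>As \<open>n > 0\<close>, the numbers of colours lie between 1 and
      \<open>n\<close>, where \<open>M_coeff_alternating_sum\<close> applies.\<close>
    have bound: "1 \<le> card (set_mset d) \<and> card (set_mset d) \<le> n" if "size d = n" for d :: "var multiset"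
    proof -
      have "d \<noteq> {#}" using that assms by auto
      then have "card (set_mset d) > 0" by (simp add: card_gt_0_iff)
      moreover have "card (set_mset d) \<le> size d"
        by (metis mset_set_set_mset_msubset size_mset_mono size_mset_set)
      ultimately show ?thesis using that by simp
    qed
    have B: "1 \<le> card (set_mset a)" "card (set_mset a) \<le> n" "1 \<le> card (set_mset b)" "card (set_mset b) \<le> n"
      "1 \<le> card (set_mset c)" "card (set_mset c) \<le> n" using bound True by auto
    have "rat_of_nat (coloured_factorizations ?A (long_cycle n) a b c)
      = (fact n)\<^sup>2 * (\<Sum>k<n. (-1) ^ k * of_nat (card (set_mset a) - 1 choose k)
        * of_nat (card (set_mset b) - 1 choose k) * of_nat (card (set_mset c) - 1 choose k)
        / (of_nat (n - 1 choose k))\<^sup>2)"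
      using of_nat_coloured_factorizations[OF _ long_cycle_permutes cyclic_on_long_cycle[OF assms], of a b c] True by simp
    also have "\<dots> = ?w (card (set_mset a)) (card (set_mset b)) (card (set_mset c))"
      unfolding M_coeff_alternating_sum[OF B, symmetric] by simp
    finally show ?thesis using True by simp
  next
    case False
    then show ?thesis using coloured_factorizations_eq_0[of ?A a b c "long_cycle n"] by auto
  qed
  \<comment> \<open>Only the partitions given by the exponents of \<open>a\<close>, \<open>b\<close>
    and \<open>c\<close> can contribute. Their numbers of parts are the numbers of colours, and they
    are partitions of \<open>n\<close> exactly when the three parts have size
    \<open>n\<close>.\<close>
  also have "\<dots> = (\<Sum>lam\<in>partitions n. \<Sum>mu\<in>partitions n. \<Sum>nu\<in>partitions n.
      if (exponents a, exponents b, exponents c) = (lam, mu, nu) then ?w (size lam) (size mu) (size nu) else 0)"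
    unfolding sum_delta_triple[OF finite_partitions] exponents_in_partitions size_exponents ..
  also have "\<dots> = mfps_coeff (\<Sum>lam\<in>partitions n. \<Sum>mu\<in>partitions n. \<Sum>nu\<in>partitions n.
           mfps_const (?w (size lam) (size mu) (size nu)) *
           (monomial_sym X lam * monomial_sym Y mu * monomial_sym Z nu)) m"
    unfolding mfps_coeff_sum mfps_coeff_const_times
  proof (intro sum.cong refl)
    fix lam mu nu assume l: "lam \<in> partitions n" "mu \<in> partitions n" "nu \<in> partitions n"
    then have z: "0 \<notin># lam" "0 \<notin># mu" "0 \<notin># nu" by (auto simp: partitions_def)
    show "(if (exponents a, exponents b, exponents c) = (lam, mu, nu) then ?w (size lam) (size mu) (size nu) else 0)
      = ?w (size lam) (size mu) (size nu) * mfps_coeff (monomial_sym X lam * monomial_sym Y mu * monomial_sym Z nu) m"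
      unfolding split[OF mfps_vars_monomial_sym[OF inj(1) l(1)] mfps_vars_monomial_sym[OF inj(2) l(2)] mfps_vars_monomial_sym[OF inj(3) l(3)]]
        mfps_coeff_monomial_sym[OF inj(1) z(1)] mfps_coeff_monomial_sym[OF inj(2) z(2)] mfps_coeff_monomial_sym[OF inj(3) z(3)]
      using sub by simp
  qed
  finally show "mfps_coeff (\<Sum>lam\<in>partitions n. \<Sum>mu\<in>partitions n. \<Sum>nu\<in>partitions n.
           of_nat (num_factorizations n lam mu nu) *
           (power_sum_sym X lam * power_sum_sym Y mu * power_sum_sym Z nu) :: (var, rat) mfps) m
    = mfps_coeff (\<Sum>lam\<in>partitions n. \<Sum>mu\<in>partitions n. \<Sum>nu\<in>partitions n.
           mfps_const (?w (size lam) (size mu) (size nu)) *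
           (monomial_sym X lam * monomial_sym Y mu * monomial_sym Z nu)) m" .
qed

end
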